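(* For $i=1,2$, let $(X_i,\varphi_i)$ be a Stone system admitting a dense orbit. Then the groups $\mathsf{T}(\varphi_1)$ and $\mathsf{T}(\varphi_2)$ are isomorphic if and only if the system $(X_1,\varphi_1)$ is flow equivalent to $(X_2,\varphi_2)$ or to $(X_2,\varphi_2^{-1})$.
   Context: A Stone system $(X,\varphi)$ is a non-empty totally disconnected compact Hausdorff space $X$ together with a self-homeomorphism $\varphi$ of $X$. Suspension: $Y^\varphi=(X\times\mathbb R)/\mathbb Z$, the quotient by the $\mathbb Z$-action $n\cdot(x,t)=(\varphi^n(x),t-n)$; $[x,t]$ is the class of $(x,t)$, and the suspension flow is $\Phi^t([x,s])=[x,s+t]$. Two Stone systems $(X_1,\varphi_1)$ and $(X_2,\varphi_2)$ are flow equivalent if there is a homeomorphism $q\colon Y^{\varphi_1}\to Y^{\varphi_2}$ sending orbits of the suspension flow to orbits of the suspension flow in an orientation-preserving fashion. $\mathsf{H}_0(\varphi)$ is the group of homeomorphisms of $Y^\varphi$ that are isotopic to the identity; equivalently (Boyle–Carlsen–Eilers), the homeomorphisms $g$ of $Y^\varphi$ for which there is a continuous $\tau\colon Y^\varphi\to\mathbb R$ with $g(y)=\Phi^{\tau(y)}(y)$ for all $y$. Charts: for a clopen $C\subset X$ put $\tau_C=\min\{n\ge1:\exists x\in C,\ \varphi^n(x)\in C\}\in\mathbb N\cup\{\infty\}$. For an open interval $J\subset\mathbb R$ of length $|J|<\tau_C$, the map $\pi_{C,J}\colon C\times J\to Y^\varphi$, $(x,t)\mapsto[x,t]$, is injective;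 it is called a chart and its image is denoted $U_{C\times J}$ (a domain). A dyadic rational is a number $p/2^q$ with $p,q\in\mathbb Z$; an interval is dyadic if it is bounded with dyadic rational endpoints; a chart $\pi_{C,J}$ is dyadic if $J$ is. A piecewise linear (PL) homeomorphism between intervals is a homeomorphism that is piecewise affine with finitely many breakpoints; it is dyadic if both intervals are dyadic, the breakpoints are dyadic rationals, and each affine piece has the form $x\mapsto2^mx+b$ with $m\in\mathbb Z$, $b$ a dyadic rational. $\mathsf{T}(\varphi)$ is the group of all $g\in\mathsf{H}_0(\varphi)$ such that for every $y\in Y^\varphi$ there are a dyadic chart $\pi_{C,J}$ with $y\in U_{C\times J}$ and a dyadic PL homeomorphism $f\colon J\to f(J)\subset\mathbb R$ such that $g(U_{C\times J})=U_{C\times f(J)}$ and $\pi_{C,f(J)}^{-1}\circ g\circ\pi_{C,J}$ is the map $(x,t)\mapsto(x,f(t))$. *)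

theory Defs
  imports "HOL-Analysis.Analysis" "HOL-Algebra.Bij"
begin

section \<open>Stone systems\<close>

definition totally_disconnected_space :: "'a topology \<Rightarrow> bool" where
  "totally_disconnected_space X \<longleftrightarrow> (\<forall>S. connectedin X S \<longrightarrow> (\<exists>a. S \<subseteq> {a}))"

definition Stone_system :: "'a topology \<Rightarrow> ('a \<Rightarrow> 'a) \<Rightarrow> bool" where
  "Stone_system X \<phi> \<longleftrightarrow>
     topspace X \<noteq> {} \<and> totally_disconnected_space X \<and> compact_space X \<and> Hausdorff_space X \<and>
     homeomorphic_map X X \<phi>"

text \<open>The values of \<open>\<phi>\<close> outside \<open>topspace X\<close> are irrelevant, so inverses are taken relative
  to the carrier.\<close>

definition inv_map :: "'a topology \<Rightarrow> ('a \<Rightarrow> 'a) \<Rightarrow> 'a \<Rightarrow> 'a" where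
  "inv_map X \<phi> = inv_into (topspace X) \<phi>"

definition int_iter :: "'a topology \<Rightarrow> ('a \<Rightarrow> 'a) \<Rightarrow> int \<Rightarrow> 'a \<Rightarrow> 'a" where
  "int_iter X \<phi> n = (if n \<ge> 0 then \<phi> ^^ nat n else inv_map X \<phi> ^^ nat (- n))"

definition has_dense_orbit :: "'a topology \<Rightarrow> ('a \<Rightarrow> 'a) \<Rightarrow> bool" where
  "has_dense_orbit X \<phi> \<longleftrightarrow>
     (\<exists>x\<in>topspace X. X closure_of (range (\<lambda>n. int_iter X \<phi> n x)) = topspace X)"

section \<open>Suspensions\<close>

text \<open>For an equivalence relation \<open>R\<close> on the carrier of \<open>T\<close>.\<close>

definition quotient_topology :: "'a topology \<Rightarrow> ('a \<times> 'a) set \<Rightarrow> 'a set topology" where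
  "quotient_topology T R =
     topology (\<lambda>U. U \<subseteq> topspace T // R \<and> openin T {p \<in> topspace T. R `` {p} \<in> U})"

definition susp_rel :: "'a topology \<Rightarrow> ('a \<Rightarrow> 'a) \<Rightarrow> (('a \<times> real) \<times> ('a \<times> real)) set" where
  "susp_rel X \<phi> =
     {((x, t), (x', t')). x \<in> topspace X \<and> (\<exists>n. x' = int_iter X \<phi> n x \<and> t' = t - of_int n)}"

definition suspension :: "'a topology \<Rightarrow> ('a \<Rightarrow> 'a) \<Rightarrow> ('a \<times> real) set topology" where
  "suspension X \<phi> = quotient_topology (prod_topology X euclideanreal) (susp_rel X \<phi>)"

definition susp_class :: "'a topology \<Rightarrow> ('a \<Rightarrow> 'a) \<Rightarrow> 'a \<times> real \<Rightarrow> ('a \<times> real) set" where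
  "susp_class X \<phi> p = susp_rel X \<phi> `` {p}"

text \<open>Translating the second coordinate maps the class \<open>[x,s]\<close> onto the class \<open>[x,s+t]\<close>, see
  \<open>susp_flow_class\<close> below.\<close>

definition susp_flow :: "real \<Rightarrow> ('a \<times> real) set \<Rightarrow> ('a \<times> real) set" where
  "susp_flow t y = (\<lambda>(x, s). (x, s + t)) ` y"

definition flow_orbit :: "('a \<times> real) set \<Rightarrow> ('a \<times> real) set set" where
  "flow_orbit y = range (\<lambda>t. susp_flow t y)"

text \<open>A homeomorphism preserves the orientation of orbits if, along every orbit, it is given by
  an increasing homeomorphism of the time parameter; this also makes sense for periodic orbits.\<close>

definition flow_equivalent ::
    "'a topology \<Rightarrow> ('a \<Rightarrow> 'a) \<Rightarrow> 'b topology \<Rightarrow> ('b \<Rightarrow> 'b) \<Rightarrow> bool" where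
  "flow_equivalent X1 \<phi>1 X2 \<phi>2 \<longleftrightarrow>
     (\<exists>q. homeomorphic_map (suspension X1 \<phi>1) (suspension X2 \<phi>2) q \<and>
        (\<forall>y\<in>topspace (suspension X1 \<phi>1).
           q ` flow_orbit y = flow_orbit (q y) \<and>
           (\<exists>h h'. homeomorphism UNIV UNIV h h' \<and> strict_mono h \<and>
              (\<forall>t. q (susp_flow t y) = susp_flow (h t) (q y)))))"

section \<open>Charts and dyadic piecewise linear maps\<close>

text \<open>The infimum of the empty set is \<open>\<infinity>\<close>.\<close>

definition return_time :: "('a \<Rightarrow> 'a) \<Rightarrow> 'a set \<Rightarrow> enat" where
  "return_time \<phi> C = Inf (enat ` {n. 1 \<le> n \<and> (\<exists>x\<in>C. (\<phi> ^^ n) x \<in> C)})"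

definition is_chart :: "'a topology \<Rightarrow> ('a \<Rightarrow> 'a) \<Rightarrow> 'a set \<Rightarrow> real set \<Rightarrow> bool" where
  "is_chart X \<phi> C J \<longleftrightarrow>
     openin X C \<and> closedin X C \<and> open J \<and> is_interval J \<and>
     emeasure lborel J < ennreal_of_enat (return_time \<phi> C)"

definition chart_domain :: "'a topology \<Rightarrow> ('a \<Rightarrow> 'a) \<Rightarrow> 'a set \<Rightarrow> real set \<Rightarrow> ('a \<times> real) set set" where
  "chart_domain X \<phi> C J = susp_class X \<phi> ` (C \<times> J)"

definition dyadic :: "real \<Rightarrow> bool" where
  "dyadic r \<longleftrightarrow> (\<exists>p q :: int. r = of_int p / 2 powi q)"

text \<open>Intervals are non-degenerate and may or may not contain their endpoints.\<close>

definition dyadic_interval :: "real set \<Rightarrow> bool" where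
  "dyadic_interval J \<longleftrightarrow>
     (\<exists>a b. dyadic a \<and> dyadic b \<and> a < b \<and> {a<..<b} \<subseteq> J \<and> J \<subseteq> {a..b})"

text \<open>The set \<open>B\<close> contains the breakpoints; since \<open>f\<close> is continuous, it does not matter
  if \<open>B\<close> contains further dyadic points.\<close>

definition dyadic_PL_homeo :: "real set \<Rightarrow> real set \<Rightarrow> (real \<Rightarrow> real) \<Rightarrow> bool" where
  "dyadic_PL_homeo J J' f \<longleftrightarrow>
     dyadic_interval J \<and> dyadic_interval J' \<and> (\<exists>f'. homeomorphism J J' f f') \<and>
     (\<exists>B. finite B \<and> B \<subseteq> J \<and> (\<forall>t\<in>B. dyadic t) \<and>
        (\<forall>K\<in>components (J - B). \<exists>(m::int) b. dyadic b \<and> (\<forall>t\<in>K. f t = 2 powi m * t + b)))"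

section \<open>The groups\<close>

text \<open>Self-maps of the suspension are represented by extensional functions, as in
  \<open>BijGroup\<close>. The homotopy witnessing \<open>homotopic_with\<close> runs through homeomorphisms, so it
  is an isotopy.\<close>

definition H0 :: "'a topology \<Rightarrow> ('a \<Rightarrow> 'a) \<Rightarrow> (('a \<times> real) set \<Rightarrow> ('a \<times> real) set) set" where
  "H0 X \<phi> = {g \<in> Bij (topspace (suspension X \<phi>)).
     homotopic_with (homeomorphic_map (suspension X \<phi>) (suspension X \<phi>))
       (suspension X \<phi>) (suspension X \<phi>) id g}"

definition T_set :: "'a topology \<Rightarrow> ('a \<Rightarrow> 'a) \<Rightarrow> (('a \<times> real) set \<Rightarrow> ('a \<times> real) set) set" where
  "T_set X \<phi> = {g \<in> H0 X \<phi>. \<forall>y\<in>topspace (suspension X \<phi>). \<exists>C J f.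
     is_chart X \<phi> C J \<and> dyadic_interval J \<and> y \<in> chart_domain X \<phi> C J \<and>
     dyadic_PL_homeo J (f ` J) f \<and> is_chart X \<phi> C (f ` J) \<and>
     g ` chart_domain X \<phi> C J = chart_domain X \<phi> C (f ` J) \<and>
     (\<forall>x\<in>C. \<forall>t\<in>J. inv_into (C \<times> f ` J) (susp_class X \<phi>) (g (susp_class X \<phi> (x, t))) = (x, f t))}"

definition T_group ::
    "'a topology \<Rightarrow> ('a \<Rightarrow> 'a) \<Rightarrow> (('a \<times> real) set \<Rightarrow> ('a \<times> real) set) monoid" where
  "T_group X \<phi> = BijGroup (topspace (suspension X \<phi>))\<lparr>carrier := T_set X \<phi>\<rparr>"

section \<open>Basic facts\<close>

lemma openin_quotient_topology:
  "openin (quotient_topology T R) U \<longleftrightarrow>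
     U \<subseteq> topspace T // R \<and> openin T {p \<in> topspace T. R `` {p} \<in> U}"
proof -
  have "istopology (\<lambda>U. U \<subseteq> topspace T // R \<and> openin T {p \<in> topspace T. R `` {p} \<in> U})"
    unfolding istopology_def
  proof (intro conjI allI impI)
    fix U V
    assume U: "U \<subseteq> topspace T // R \<and> openin T {p \<in> topspace T. R `` {p} \<in> U}"
      and V: "V \<subseteq> topspace T // R \<and> openin T {p \<in> topspace T. R `` {p} \<in> V}"
    show "U \<inter> V \<subseteq> topspace T // R" using U by blast
    have "{p \<in> topspace T. R `` {p} \<in> U \<inter> V} =
        {p \<in> topspace T. R `` {p} \<in> U} \<inter> {p \<in> topspace T. R `` {p} \<in> V}" by blast
    then show "openin T {p \<in> topspace T. R `` {p} \<in> U \<inter> V}" using U V by (simp add: openin_Int)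
  next
    fix \<K>
    assume K: "\<forall>U\<in>\<K>. U \<subseteq> topspace T // R \<and> openin T {p \<in> topspace T. R `` {p} \<in> U}"
    show "\<Union>\<K> \<subseteq> topspace T // R" using K by blast
    have "{p \<in> topspace T. R `` {p} \<in> \<Union>\<K>} = (\<Union>U\<in>\<K>. {p \<in> topspace T. R `` {p} \<in> U})" by blast
    then show "openin T {p \<in> topspace T. R `` {p} \<in> \<Union>\<K>}" using K by auto
  qed
  then show ?thesis by (simp add: quotient_topology_def topology_inverse')
qed

lemma topspace_quotient_topology: "topspace (quotient_topology T R) = topspace T // R"
proof -
  have "{p \<in> topspace T. R `` {p} \<in> topspace T // R} = topspace T"
    by (auto intro: quotientI)
  then have "openin (quotient_topology T R) (topspace T // R)"
    by (simp add: openin_quotient_topology)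
  then show ?thesis
    by (meson openin_quotient_topology openin_subset openin_topspace subset_antisym)
qed

lemma quotient_map_quotient_topology:
  "quotient_map T (quotient_topology T R) (\<lambda>p. R `` {p})"
  by (auto simp: quotient_map_def topspace_quotient_topology openin_quotient_topology quotient_def)

lemma topspace_suspension:
  "topspace (suspension X \<phi>) = susp_class X \<phi> ` (topspace X \<times> UNIV)"
  by (auto simp: suspension_def topspace_quotient_topology susp_class_def quotient_def)

lemma susp_flow_class: "susp_flow t (susp_class X \<phi> (x, s)) = susp_class X \<phi> (x, s + t)"
proof -
  have "(x', t' + t) \<in> susp_class X \<phi> (x, s + t) \<longleftrightarrow> (x', t') \<in> susp_class X \<phi> (x, s)" for x' t'
    by (simp add: susp_class_def susp_rel_def algebra_simps)
  moreover have "(x', t') \<in> susp_flow t (susp_class X \<phi> (x, s)) \<longleftrightarrow>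
      (x', t' - t) \<in> susp_class X \<phi> (x, s)" for x' t'
    by (force simp: susp_flow_def)
  ultimately have "p \<in> susp_flow t (susp_class X \<phi> (x, s)) \<longleftrightarrow> p \<in> susp_class X \<phi> (x, s + t)" for p
    by (metis diff_add_cancel surj_pair)
  then show ?thesis by blast
qed

context
  fixes X :: "'a topology" and \<phi> :: "'a \<Rightarrow> 'a"
  assumes bij: "bij_betw \<phi> (topspace X) (topspace X)"
begin

lemma inv_map_in: "x \<in> topspace X \<Longrightarrow> inv_map X \<phi> x \<in> topspace X"
  unfolding inv_map_def by (metis bij bij_betw_def inv_into_into)

lemma inv_map_cancel:
  assumes "x \<in> topspace X"
  shows "\<phi> (inv_map X \<phi> x) = x" "inv_map X \<phi> (\<phi> x) = x"
  using assms bij unfolding inv_map_def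
  by (auto simp: bij_betw_inv_into_left bij_betw_inv_into_right)

lemma int_iter_in:
  assumes "x \<in> topspace X" shows "int_iter X \<phi> n x \<in> topspace X"
proof -
  have "(\<phi> ^^ k) x \<in> topspace X" for k
    by (induction k) (use assms bij in \<open>auto simp: bij_betw_def\<close>)
  moreover have "(inv_map X \<phi> ^^ k) x \<in> topspace X" for k
    by (induction k) (use assms inv_map_in in auto)
  ultimately show ?thesis by (simp add: int_iter_def)
qed

lemma int_iter_0: "int_iter X \<phi> 0 x = x"
  by (simp add: int_iter_def)

lemma int_iter_plus1:
  assumes x: "x \<in> topspace X" shows "int_iter X \<phi> (n + 1) x = \<phi> (int_iter X \<phi> n x)"
proof (cases "n \<ge> 0")
  case True
  then show ?thesis by (simp add: int_iter_def nat_add_distrib)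
next
  case False
  define k where "k = nat (- n - 1)"
  have n: "n = - int k - 1" using False by (simp add: k_def)
  have "int_iter X \<phi> n x = inv_map X \<phi> (int_iter X \<phi> (n + 1) x)"
    unfolding n int_iter_def by (auto simp: nat_add_distrib)
  then show ?thesis using inv_map_cancel(1) int_iter_in[OF x] by metis
qed

lemma int_iter_add:
  assumes x: "x \<in> topspace X"
  shows "int_iter X \<phi> (m + n) x = int_iter X \<phi> m (int_iter X \<phi> n x)"
proof (induction m rule: int_induct[where k = 0])
  case base
  show ?case by (simp add: int_iter_0)
next
  case (step1 i)
  have "int_iter X \<phi> (i + 1 + n) x = \<phi> (int_iter X \<phi> (i + n) x)"
    using int_iter_plus1[OF x, of "i + n"] by (simp add: algebra_simps)
  then show ?case using step1 int_iter_plus1[OF int_iter_in[OF x]] by simp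
next
  case (step2 i)
  have "\<phi> (int_iter X \<phi> (i - 1 + n) x) = int_iter X \<phi> (i + n) x"
    using int_iter_plus1[OF x, of "i - 1 + n"] by (simp add: algebra_simps)
  also have "\<dots> = \<phi> (int_iter X \<phi> (i - 1) (int_iter X \<phi> n x))"
    using step2 int_iter_plus1[OF int_iter_in[OF x], of "i - 1"] by simp
  finally show ?case
    using bij int_iter_in x by (metis bij_betw_def inj_onD)
qed

lemma equiv_susp_rel: "equiv (topspace X \<times> UNIV) (susp_rel X \<phi>)"
proof (rule equivI)
  show "susp_rel X \<phi> \<subseteq> (topspace X \<times> UNIV) \<times> (topspace X \<times> UNIV)"
    using int_iter_in by (auto simp: susp_rel_def)
  show "refl_on (topspace X \<times> UNIV) (susp_rel X \<phi>)"
  proof (rule refl_onI)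
    fix p :: "'a \<times> real" assume "p \<in> topspace X \<times> UNIV"
    then show "(p, p) \<in> susp_rel X \<phi>"
      by (auto simp: susp_rel_def int_iter_0 intro!: exI[of _ 0])
  qed
  show "sym (susp_rel X \<phi>)"
  proof (rule symI)
    fix p p' assume "(p, p') \<in> susp_rel X \<phi>"
    then obtain x t n where *: "x \<in> topspace X" "p = (x, t)" "p' = (int_iter X \<phi> n x, t - of_int n)"
      by (auto simp: susp_rel_def)
    have "int_iter X \<phi> (- n) (int_iter X \<phi> n x) = x"
      using int_iter_add[OF *(1), of "- n" n] by (simp add: int_iter_0)
    then show "(p', p) \<in> susp_rel X \<phi>"
      using * int_iter_in by (auto simp: susp_rel_def intro!: exI[of _ "- n"])
  qed
  show "trans (susp_rel X \<phi>)"
  proof (rule transI)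
    fix p p' p'' assume "(p, p') \<in> susp_rel X \<phi>" "(p', p'') \<in> susp_rel X \<phi>"
    then obtain x t m n where "x \<in> topspace X" "p = (x, t)"
        "p'' = (int_iter X \<phi> m (int_iter X \<phi> n x), t - of_int n - of_int m)"
      by (auto simp: susp_rel_def)
    then show "(p, p'') \<in> susp_rel X \<phi>"
      by (auto simp: susp_rel_def int_iter_add intro!: exI[of _ "m + n"])
  qed
qed

lemma inj_on_chart:
  assumes "is_chart X \<phi> C J"
  shows "inj_on (susp_class X \<phi>) (C \<times> J)"
proof -
  have CX: "C \<subseteq> topspace X" and J: "is_interval J"
    and len: "emeasure lborel J < ennreal_of_enat (return_time \<phi> C)"
    using assms by (auto simp: is_chart_def openin_subset)
  have no: "n \<le> 0" if "x \<in> C" "int_iter X \<phi> n x \<in> C" "t \<in> J" "t - of_int n \<in> J" for x t n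
  proof (rule ccontr)
    assume "\<not> n \<le> 0"
    then have n: "n > 0" by simp
    have "(\<phi> ^^ nat n) x \<in> C" using that n by (simp add: int_iter_def)
    then have "return_time \<phi> C \<le> enat (nat n)"
      unfolding return_time_def using that n by (intro Inf_lower imageI) auto
    then have "ennreal_of_enat (return_time \<phi> C) \<le> ennreal_of_enat (enat (nat n))"
      by (simp only: ennreal_of_enat_le_iff)
    also have "\<dots> = ennreal (of_int n)"
    proof -
      have "real_of_int n = real (nat n)" using n by simp
      then show ?thesis
        by (simp only: ennreal_of_enat_def enat.case ennreal_of_nat_eq_real_of_nat)
    qed
    also have "\<dots> = emeasure lborel {t - of_int n..t}"
      using n by simp
    also have "\<dots> \<le> emeasure lborel J"
    proof (rule emeasure_mono)
      show "{t - of_int n..t} \<subseteq> J"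
      proof
        fix s assume "s \<in> {t - of_int n..t}"
        then have "t - of_int n \<le> s" "s \<le> t" by auto
        then show "s \<in> J" using J that(3,4) unfolding is_interval_1 by metis
      qed
      show "J \<in> sets lborel" using assms by (simp add: is_chart_def)
    qed
    finally show False using len by simp
  qed
  show ?thesis
  proof (rule inj_onI, clarify)
    fix x t x' t'
    assume *: "x \<in> C" "t \<in> J" "x' \<in> C" "t' \<in> J" "susp_class X \<phi> (x, t) = susp_class X \<phi> (x', t')"
    have "((x, t), (x', t')) \<in> susp_rel X \<phi>"
      using eq_equiv_class[OF *(5)[unfolded susp_class_def] equiv_susp_rel] *(3) CX by blast
    then obtain n where n: "x' = int_iter X \<phi> n x" "t' = t - of_int n"
      by (auto simp: susp_rel_def)
    have "((x', t'), (x, t)) \<in> susp_rel X \<phi>"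
      using eq_equiv_class[OF *(5)[unfolded susp_class_def, symmetric] equiv_susp_rel] *(1) CX by blast
    then obtain m where m: "x = int_iter X \<phi> m x'" "t = t' - of_int m"
      by (auto simp: susp_rel_def)
    have "n \<le> 0" using no[of x n t] *(1-4) n by metis
    moreover have "m \<le> 0" using no[of x' m t'] *(1-4) m by metis
    moreover have "m = - n" using n(2) m(2) by linarith
    ultimately have "n = 0" by simp
    then have "x' = int_iter X \<phi> 0 x" "t' = t - of_int 0" using n by blast+
    then show "x = x' \<and> t = t'" unfolding int_iter_0 by simp
  qed
qed

end

end

theory Submission
  imports Defs
begin

text \<open>Both conditions are equivalent to the suspensions being homeomorphic.

  From an isomorphism of the groups to a homeomorphism: whether two elements have disjoint supports
  can be expressed in the group (Rubin; Belk, Elliott and Matucci), hence so can the regular open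
  sets spanned by supports. Rubin's local density fails transversally to the flow, so points are
  recovered differently: the closure of \<open>supp f\<close> lies in the regular open set spanned by \<open>supp g\<close>
  iff \<open>supp f\<close> is covered by finitely many supports each of which can be displaced from
  itself by an element supported in \<open>supp g\<close>. An element fixing an endpoint of a flow segment of a
  support preserves the orientation and cannot displace that support; this is where the
  piecewise linear germs and the dense orbit enter. This compact containment of
  supports determines a compact Hausdorff space.

  A homeomorphism \<open>q\<close> of suspensions lifts to \<open>(x,t) \<mapsto> (\<psi> x, H x t)\<close>, since cross sections are totally
  disconnected. Each \<open>H x\<close> is an increasing or decreasing bijection, with the same orientation for
  all \<open>x\<close> because of the dense orbit, and reversing the flow makes it increasing; this is
  a flow equivalence. Replacing \<open>H x\<close> on each \<open>[n,n+1]\<close> by a dyadic piecewise linear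
  interpolation between nearby dyadic values that depend locally constantly on \<open>x\<close> gives a homeomorphism
  which conjugates the two groups.\<close>

section \<open>Suspensions of Stone systems\<close>

text \<open>Membership in \<open>T_set\<close> is traded for a condition on germs
  (\<open>local_form\<close>), so that products, inverses and conjugates are checked at one point at
  a time and charts never have to be matched. Germs descend to the suspension because
  \<open>(x, t)\<close> and \<open>(it n x, t - n)\<close> differ by a dyadic translation. Isotopies
  can be conjugated by any homeomorphism of suspensions; what an arbitrary homeomorphism destroys is
  only the germ condition. To restore it, the new map must be dyadic piecewise linear in time,
  locally constant in \<open>x\<close>, and still equivariant for the integer actions. Equivariance
  is kept by prescribing values at time 0 only, on all of \<open>X\<close>, and transporting them to
  time \<open>n\<close> through \<open>it n\<close>. Locally constant prescriptions exist because
  compactness and a clopen basis turn local solutions of an open condition into a global locally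
  constant one. Reversal of time normalises the dyadic germs, so \<open>\<phi>\<close> and its
  inverse have isomorphic groups; this is where the two alternatives of the theorem come
  from.\<close>

definition loc_const :: "'a topology \<Rightarrow> ('a \<Rightarrow> 'c) \<Rightarrow> bool" where
  "loc_const X a \<longleftrightarrow> (\<forall>x\<in>topspace X. \<exists>C. openin X C \<and> x \<in> C \<and> (\<forall>x'\<in>C. a x' = a x))"

lemma continuous_map_locI:
  assumes "\<And>x. x \<in> topspace T \<Longrightarrow> \<exists>U. openin T U \<and> x \<in> U \<and> continuous_map (subtopology T U) Z f"
  shows "continuous_map T Z f"
proof -
  obtain U where U: "\<And>x. x \<in> topspace T \<Longrightarrow> openin T (U x) \<and> x \<in> U x \<and> continuous_map (subtopology T (U x)) Z f"
    using assms by metis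
  show ?thesis
    by (rule pasting_lemma[where I = "topspace T" and T = U and f = "\<lambda>_. f"]) (use U in auto)
qed

lemma continuous_map_locI_eq:
  assumes "\<And>x. x \<in> topspace T \<Longrightarrow>
    \<exists>U g. openin T U \<and> x \<in> U \<and> continuous_map T Z g \<and> (\<forall>z\<in>U. f z = g z)"
  shows "continuous_map T Z f"
proof (rule continuous_map_locI)
  fix x assume "x \<in> topspace T"
  then obtain U g where U: "openin T U" "x \<in> U" "continuous_map T Z g" "\<forall>z\<in>U. f z = g z"
    using assms by meson
  have "continuous_map (subtopology T U) Z f"
    by (rule continuous_map_eq[OF continuous_map_from_subtopology[OF U(3)]]) (use U in auto)
  then show "\<exists>U. openin T U \<and> x \<in> U \<and> continuous_map (subtopology T U) Z f" using U by blast
qed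

lemma loc_const_continuous_map:
  assumes "loc_const X a" "a \<in> topspace X \<rightarrow> topspace Z"
  shows "continuous_map X Z a"
proof (rule continuous_map_locI_eq)
  fix x assume x: "x \<in> topspace X"
  then obtain C where "openin X C" "x \<in> C" "\<forall>x'\<in>C. a x' = a x"
    using assms(1) unfolding loc_const_def by meson
  moreover have "continuous_map X Z (\<lambda>_. a x)" using assms(2) x by (auto simp: Pi_iff)
  ultimately show "\<exists>U g. openin X U \<and> x \<in> U \<and> continuous_map X Z g \<and> (\<forall>z\<in>U. a z = g z)"
    by blast
qed

lemma continuous_int_valued_loc_const:
  fixes u :: "'a \<Rightarrow> real"
  assumes u: "continuous_map X euclideanreal u" and "\<And>x. x \<in> topspace X \<Longrightarrow> u x \<in> \<int>"
  shows "loc_const X u"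
  unfolding loc_const_def
proof
  fix x assume x: "x \<in> topspace X"
  let ?C = "{x' \<in> topspace X. u x' \<in> {u x - 1/2<..<u x + 1/2}}"
  have "openin X ?C" by (rule openin_continuous_map_preimage[OF u]) auto
  moreover have "u x' = u x" if "x' \<in> ?C" for x'
  proof -
    have "u x' - u x \<in> \<int>" using assms(2) that x by auto
    then obtain k :: int where k: "u x' - u x = of_int k" by (auto elim: Ints_cases)
    have "\<bar>u x' - u x\<bar> < 1" using that by (auto simp: abs_less_iff)
    then have "k = 0" unfolding k by linarith
    then show ?thesis using k by simp
  qed
  moreover have "x \<in> ?C" using x by simp
  ultimately show "\<exists>C. openin X C \<and> x \<in> C \<and> (\<forall>x'\<in>C. u x' = u x)" by blast
qed

text \<open>The integers by which representatives differ are independent of time for this reason: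
  along a flow line they vary continuously.\<close>

lemma int_valued_continuous_const:
  fixes f :: "real \<Rightarrow> real"
  assumes c: "continuous_on UNIV f" and i: "\<And>t. f t \<in> \<int>"
  shows "f s = f t"
proof -
  have "loc_const euclideanreal f"
    using continuous_int_valued_loc_const[of euclideanreal f] c i by simp
  then have "f constant_on UNIV"
    by (intro locally_constant_imp_constant) (auto simp: loc_const_def connected_UNIV)
  then show ?thesis by (auto simp: constant_on_def)
qed

section \<open>The suspension of a Stone system: quotient map, separation, compactness, box
  neighbourhoods\<close>

locale stone =
  fixes X :: "'a topology" and \<phi> :: "'a \<Rightarrow> 'a"
  assumes stone: "Stone_system X \<phi>"
begin

abbreviation "cls \<equiv> susp_class X \<phi>"
abbreviation "Y \<equiv> suspension X \<phi>"
abbreviation "it \<equiv> int_iter X \<phi>"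
abbreviation "XR \<equiv> prod_topology X euclideanreal"

lemma td: "totally_disconnected_space X"
  and compact: "compact_space X" and haus: "Hausdorff_space X" and homeo: "homeomorphic_map X X \<phi>"
  using stone by (auto simp: Stone_system_def)

lemma bij: "bij_betw \<phi> (topspace X) (topspace X)"
  using homeo unfolding homeomorphic_eq_everything_map bij_betw_def by simp

lemmas it_in = int_iter_in[OF bij] and it_add = int_iter_add[OF bij] and it_plus1 = int_iter_plus1[OF bij]

lemma it_0 [simp]: "it 0 x = x" by (simp add: int_iter_def)

lemma it_inverse: "x \<in> topspace X \<Longrightarrow> it (- n) (it n x) = x" "x \<in> topspace X \<Longrightarrow> it n (it (- n) x) = x"
  using it_add[of x "- n" n] it_add[of x n "- n"] by simp_all

lemma it_inj: "x \<in> topspace X \<Longrightarrow> x' \<in> topspace X \<Longrightarrow> it n x = it n x' \<Longrightarrow> x = x'"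
  using it_inverse(1) by metis

lemma homeo_inv: "homeomorphic_map X X (inv_map X \<phi>)"
proof -
  obtain g where g: "homeomorphic_maps X X \<phi> g" using homeo homeomorphic_map_maps by blast
  have "inv_map X \<phi> x = g x" if "x \<in> topspace X" for x
  proof -
    have "\<phi> (g x) = x" "g x \<in> topspace X" using g that
      by (auto simp: homeomorphic_maps_def continuous_map_def)
    then show ?thesis using inv_map_cancel(2)[OF bij, of "g x"] by simp
  qed
  moreover have "homeomorphic_map X X g" using g homeomorphic_maps_map by blast
  ultimately show ?thesis using homeomorphic_map_eq by metis
qed

lemma it_cont: "continuous_map X X (it n)"
proof -
  have p: "continuous_map X X (f ^^ k)" if "continuous_map X X f" for f k
  proof (induction k)
    case (Suc k)
    then show ?case using continuous_map_compose[OF Suc that] by (simp add: o_def)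
  qed simp
  show ?thesis
    using p[OF homeomorphic_imp_continuous_map[OF homeo]] p[OF homeomorphic_imp_continuous_map[OF homeo_inv]]
    by (simp add: int_iter_def[abs_def])
qed

lemma cls_eq_iff:
  assumes "x \<in> topspace X" "x' \<in> topspace X"
  shows "cls (x, t) = cls (x', t') \<longleftrightarrow> (\<exists>n. x' = it n x \<and> t' = t - of_int n)"
  using eq_equiv_class_iff[OF equiv_susp_rel[OF bij], of "(x,t)" "(x',t')"] assms
  unfolding susp_class_def by (simp add: susp_rel_def)

lemma cls_it: "x \<in> topspace X \<Longrightarrow> cls (it n x, t - of_int n) = cls (x, t)"
  using cls_eq_iff[of x "it n x" t "t - of_int n"] it_in[of x n] by auto

lemma cls_it': "x \<in> topspace X \<Longrightarrow> cls (it n x, t) = cls (x, t + of_int n)"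
  using cls_it[of x n "t + of_int n"] by simp

text \<open>Representatives of one point differ in time by an integer, which vanishes if the times
  are less than 1 apart. This makes \<open>cls\<close> injective on short boxes over arbitrary sets,
  where no return time has to be considered.\<close>

lemma cls_eq_close:
  assumes "x \<in> topspace X" "x' \<in> topspace X" "cls (x, t) = cls (x', t')" "\<bar>t - t'\<bar> < 1"
  shows "x' = x" "t' = t"
proof -
  obtain n where n: "x' = it n x" "t' = t - of_int n"
    using assms(3) cls_eq_iff[OF assms(1,2)] by auto
  then have "\<bar>real_of_int n\<bar> < 1" using assms(4) by simp
  then have "n = 0" by linarith
  then show "x' = x" "t' = t" using n by auto
qed

lemma cls_in [simp]: "x \<in> topspace X \<Longrightarrow> cls (x, t) \<in> topspace Y"
  by (simp add: topspace_suspension)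

lemma Y_cases:
  assumes "y \<in> topspace Y" obtains x t where "x \<in> topspace X" "y = cls (x, t)"
  using assms by (auto simp: topspace_suspension)

lemma Y_cases_near:
  assumes "y \<in> topspace Y" obtains x t where "x \<in> topspace X" "y = cls (x, t)" "c \<le> t" "t < c + 1"
proof -
  obtain x t where xt: "x \<in> topspace X" "y = cls (x, t)" using assms Y_cases by blast
  let ?n = "\<lfloor>t - c\<rfloor>"
  have "y = cls (it ?n x, t - of_int ?n)" using xt cls_it[of x ?n t] by simp
  moreover have "c \<le> t - of_int ?n" "t - of_int ?n < c + 1" by linarith+
  ultimately show ?thesis by (rule that[OF it_in[OF xt(1)]])
qed

lemma quot: "quotient_map XR Y cls"
proof -
  have "cls = (\<lambda>p. susp_rel X \<phi> `` {p})" by (auto simp: susp_class_def)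
  then show ?thesis using quotient_map_quotient_topology[of XR "susp_rel X \<phi>"]
    by (simp add: suspension_def)
qed

lemma cls_cont: "continuous_map XR Y cls"
  using quot quotient_imp_continuous_map by blast

lemma shift_cont: "continuous_map XR XR (\<lambda>(x, t). (it n x, t - of_int n))"
proof -
  have "continuous_map XR X (it n \<circ> fst)" by (rule continuous_map_compose[OF continuous_map_fst it_cont])
  moreover have "continuous_map XR euclideanreal (\<lambda>p. snd p - of_int n)"
    by (intro continuous_intros continuous_map_snd)
  ultimately show ?thesis
    by (simp add: continuous_map_pairwise o_def case_prod_unfold)
qed

lemma cls_open: "open_map XR Y cls"
  unfolding open_map_def
proof (intro allI impI)
  fix W assume W: "openin XR W"
  then have WX: "W \<subseteq> topspace X \<times> UNIV" using openin_subset by fastforce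
  have iff: "cls (x, t) \<in> cls ` W \<longleftrightarrow> (\<exists>n. (it n x, t - of_int n) \<in> W)" if x: "x \<in> topspace X" for x t
  proof
    assume "cls (x, t) \<in> cls ` W"
    then obtain x' t' where x't': "(x', t') \<in> W" "cls (x, t) = cls (x', t')" by auto
    then have "x' \<in> topspace X" using WX by auto
    then show "\<exists>n. (it n x, t - of_int n) \<in> W" using cls_eq_iff[OF x] x't' by auto
  next
    assume "\<exists>n. (it n x, t - of_int n) \<in> W"
    then obtain n where "(it n x, t - of_int n) \<in> W" by blast
    then show "cls (x, t) \<in> cls ` W" using cls_it[OF x, of n t] by (metis image_eqI)
  qed
  have eq: "{p \<in> topspace XR. cls p \<in> cls ` W} =
    (\<Union>n. {p \<in> topspace XR. (\<lambda>(x, t). (it n x, t - of_int n)) p \<in> W})"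
  proof (rule Set.set_eqI)
    fix p :: "'a \<times> real"
    obtain x t where p: "p = (x, t)" by force
    show "p \<in> {p \<in> topspace XR. cls p \<in> cls ` W} \<longleftrightarrow>
        p \<in> (\<Union>n. {p \<in> topspace XR. (\<lambda>(x, t). (it n x, t - of_int n)) p \<in> W})"
      using iff[of x t] unfolding p by auto
  qed
  have "openin XR {p \<in> topspace XR. cls p \<in> cls ` W}"
    unfolding eq
  proof (intro openin_Union ballI)
    fix S assume "S \<in> range (\<lambda>n. {p \<in> topspace XR. (\<lambda>(x, t). (it n x, t - of_int n)) p \<in> W})"
    then obtain n where "S = {p \<in> topspace XR. (\<lambda>(x, t). (it n x, t - of_int n)) p \<in> W}" by blast
    then show "openin XR S" using openin_continuous_map_preimage[OF shift_cont W, of n] by simp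
  qed
  moreover have "cls ` W \<subseteq> topspace Y" using WX by (auto simp: topspace_suspension)
  ultimately show "openin Y (cls ` W)" using quot by (simp add: quotient_map_def)
qed

lemma cls_box_open: "openin X C \<Longrightarrow> open J \<Longrightarrow> openin Y (cls ` (C \<times> J))"
  using cls_open unfolding open_map_def by (simp add: openin_prod_Times_iff)

lemma descend:
  assumes h: "continuous_map XR Z h" and inv: "\<And>x t n. x \<in> topspace X \<Longrightarrow> h (it n x, t - of_int n) = h (x, t)"
  obtains g where "continuous_map Y Z g" "\<And>x t. x \<in> topspace X \<Longrightarrow> g (cls (x, t)) = h (x, t)"
proof -
  have "h p = h p'" if p: "p \<in> topspace XR" "p' \<in> topspace XR" "cls p = cls p'" for p p'
  proof -
    obtain x t x' t' where pp: "p = (x, t)" "p' = (x', t')" by (metis surj_pair)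
    then have x: "x \<in> topspace X" "x' \<in> topspace X" using p by auto
    then obtain n where "x' = it n x" "t' = t - of_int n" using cls_eq_iff[OF x] p(3) pp by auto
    then show ?thesis using inv[OF x(1)] pp by simp
  qed
  then have "\<exists>g. continuous_map Y Z g \<and> (\<forall>p\<in>topspace XR. g (cls p) = h p)"
  proof (rule quotient_map_lift_exists[OF quot h])
    fix g assume "continuous_map Y Z g" "\<And>p. p \<in> topspace XR \<Longrightarrow> g (cls p) = h p"
    then show ?thesis by (intro exI[of _ g] conjI ballI)
  qed
  then obtain g where g: "continuous_map Y Z g" "\<forall>p\<in>topspace XR. g (cls p) = h p" by blast
  show ?thesis by (rule that[OF g(1)]) (use g(2) in auto)
qed

lemma Y_compact: "compact_space Y"
proof -
  have "compactin XR (topspace X \<times> {0..1})"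
    using compact by (auto simp: compactin_Times compact_space_def)
  then have "compactin Y (cls ` (topspace X \<times> {0..1}))"
    using cls_cont image_compactin by blast
  moreover have "cls ` (topspace X \<times> {0..1}) = topspace Y"
  proof
    show "cls ` (topspace X \<times> {0..1}) \<subseteq> topspace Y" by auto
    show "topspace Y \<subseteq> cls ` (topspace X \<times> {0..1})"
    proof
      fix y assume "y \<in> topspace Y"
      then obtain x t where "x \<in> topspace X" "y = cls (x, t)" "0 \<le> t" "t < 0 + 1" by (rule Y_cases_near)
      then show "y \<in> cls ` (topspace X \<times> {0..1})" by auto
    qed
  qed
  ultimately show ?thesis by (simp add: compact_space_def)
qed

text \<open>Representatives are chosen with times at most 1/2 apart. Distinct points are then
  separated in time or, at equal times, in \<open>X\<close>; the boxes are so short that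
  \<open>cls_eq_close\<close> excludes any other identification between them.\<close>

lemma Y_haus: "Hausdorff_space Y"
  unfolding Hausdorff_space_def
proof (intro allI impI, elim conjE)
  fix y z assume y: "y \<in> topspace Y" and z: "z \<in> topspace Y" and ne: "y \<noteq> z"
  obtain x t where xt: "x \<in> topspace X" "y = cls (x, t)" using y Y_cases by blast
  obtain x' t' where xt': "x' \<in> topspace X" "z = cls (x', t')" "t - 1/2 \<le> t'" "t' < t - 1/2 + 1"
    using z by (rule Y_cases_near)
  show "\<exists>U V. openin Y U \<and> openin Y V \<and> y \<in> U \<and> z \<in> V \<and> disjnt U V"
  proof (cases "t = t'")
    case False
    define e where "e = \<bar>t - t'\<bar> / 2"
    have e: "0 < e" "e \<le> 1/4" using False xt'(3,4) by (auto simp: e_def abs_if)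
    let ?U = "cls ` (topspace X \<times> {t - e<..<t + e})"
    let ?V = "cls ` (topspace X \<times> {t' - e<..<t' + e})"
    have "disjnt ?U ?V"
    proof (rule ccontr)
      assume "\<not> ?thesis"
      then obtain a s b r where *: "a \<in> topspace X" "b \<in> topspace X" "cls (a, s) = cls (b, r)"
         "\<bar>s - t\<bar> < e" "\<bar>r - t'\<bar> < e" by (auto simp: disjnt_iff abs_less_iff)
      then have "\<bar>s - r\<bar> < 1" using e xt'(3,4) by (simp add: abs_if split: if_splits)
      then have "r = s" using cls_eq_close * by blast
      then show False using * False by (simp add: e_def abs_if split: if_splits)
    qed
    moreover have "openin Y ?U" "openin Y ?V" by (auto intro!: cls_box_open)
    moreover have "y \<in> ?U" "z \<in> ?V" using xt xt' e by auto
    ultimately show ?thesis by blast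
  next
    case True
    then have "x \<noteq> x'" using ne xt xt' by auto
    then obtain A B where AB: "openin X A" "openin X B" "x \<in> A" "x' \<in> B" "disjnt A B"
      using haus xt xt' unfolding Hausdorff_space_def by metis
    let ?U = "cls ` (A \<times> {t - 1/4<..<t + 1/4})"
    let ?V = "cls ` (B \<times> {t - 1/4<..<t + 1/4})"
    have "disjnt ?U ?V"
    proof (rule ccontr)
      assume "\<not> ?thesis"
      then obtain a s b r where *: "a \<in> A" "b \<in> B" "cls (a, s) = cls (b, r)"
         "t - 1/4 < s" "s < t + 1/4" "t - 1/4 < r" "r < t + 1/4"
        unfolding disjnt_iff by (auto simp del: less_divide_eq_numeral1 divide_less_eq_numeral1)
      then have "\<bar>s - r\<bar> < 1" by linarith
      moreover have "a \<in> topspace X" "b \<in> topspace X" using * AB openin_subset by blast+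
      ultimately have "b = a" using cls_eq_close *(3) by blast
      then show False using * AB by (auto simp: disjnt_iff)
    qed
    moreover have "openin Y ?U" "openin Y ?V" using AB by (auto intro!: cls_box_open)
    moreover have "y \<in> ?U" "z \<in> ?V" using xt xt' AB True by auto
    ultimately show ?thesis by blast
  qed
qed

text \<open>In a compact Hausdorff space, closed sets that no connected set joins are separated by a
  clopen set; here connected sets have at most one point.\<close>

lemma clopen_basis:
  assumes U: "openin X U" and x: "x \<in> U"
  obtains C where "openin X C" "closedin X C" "x \<in> C" "C \<subseteq> U"
proof -
  have xX: "x \<in> topspace X" using U x openin_subset by blast
  have "separated_between X {x} (topspace X - U)"
  proof (rule cut_wire_fence_theorem[OF compact haus])
    show "closedin X {x}" using haus xX by (simp add: closedin_Hausdorff_singleton)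
    show "closedin X (topspace X - U)" using U by blast
    fix C assume "connectedin X C"
    then obtain a where "C \<subseteq> {a}" using td unfolding totally_disconnected_space_def by blast
    then show "disjnt C {x} \<or> disjnt C (topspace X - U)" using x by (auto simp: disjnt_iff)
  qed
  then obtain A B where AB: "openin X A" "openin X B" "A \<union> B = topspace X" "disjnt A B" "{x} \<subseteq> A" "topspace X - U \<subseteq> B"
    unfolding separated_between_def by blast
  then have A: "A = topspace X - B" by (auto simp: disjnt_iff)
  then have "closedin X A" using AB by blast
  moreover have "A \<subseteq> U" using AB A by blast
  ultimately show ?thesis using that AB by blast
qed

lemma box_basis:
  assumes W: "openin XR W" and xt: "(x, t) \<in> W"
  obtains C e where "openin X C" "closedin X C" "x \<in> C" "e > 0" "C \<times> {t - e<..<t + e} \<subseteq> W"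
proof -
  obtain U V where UV: "openin X U" "open V" "x \<in> U" "t \<in> V" "U \<times> V \<subseteq> W"
    using W xt unfolding openin_prod_topology_alt by (metis open_openin)
  obtain C where C: "openin X C" "closedin X C" "x \<in> C" "C \<subseteq> U" using clopen_basis UV by blast
  obtain e where e: "e > 0" "ball t e \<subseteq> V" using UV open_contains_ball by blast
  have "{t - e<..<t + e} \<subseteq> V" using e by (auto simp: ball_def dist_real_def subset_iff)
  then show ?thesis using that[OF C(1-3) e(1)] C UV by blast
qed

lemma Y_box_basis:
  assumes W: "openin Y W" and xt: "cls (x, t) \<in> W" and x: "x \<in> topspace X"
  obtains C e where "openin X C" "closedin X C" "x \<in> C" "e > 0" "cls ` (C \<times> {t - e<..<t + e}) \<subseteq> W"
proof -
  have "openin XR {p \<in> topspace XR. cls p \<in> W}" by (rule openin_continuous_map_preimage[OF cls_cont W])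
  moreover have "(x, t) \<in> {p \<in> topspace XR. cls p \<in> W}" using xt x by simp
  ultimately obtain C e where "openin X C" "closedin X C" "x \<in> C" "e > 0"
     "C \<times> {t - e<..<t + e} \<subseteq> {p \<in> topspace XR. cls p \<in> W}" by (rule box_basis)
  then show ?thesis using that[of C e] by blast
qed

text \<open>Finitely many clopen sets, each with a constant solution, cover the space. The value
  chosen at \<open>x\<close> depends only on which of them contain \<open>x\<close>, and this
  pattern is constant on the atoms of the finite algebra that they generate.\<close>

lemma selection:
  assumes "\<And>x. x \<in> topspace X \<Longrightarrow> \<exists>v W. openin X W \<and> x \<in> W \<and> (\<forall>x'\<in>W. P x' v)"
  obtains a where "loc_const X a" "\<And>x. x \<in> topspace X \<Longrightarrow> P x (a x)"
proof -
  have "\<exists>v C. openin X C \<and> closedin X C \<and> x \<in> C \<and> (\<forall>x'\<in>C. P x' v)" if x: "x \<in> topspace X" for x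
    using assms[OF x] clopen_basis by (metis subset_eq)
  then obtain v C where C: "\<And>x. x \<in> topspace X \<Longrightarrow> openin X (C x) \<and> closedin X (C x) \<and> x \<in> C x \<and> (\<forall>x'\<in>C x. P x' (v x))"
    by metis
  obtain F where F: "finite F" "F \<subseteq> topspace X" "topspace X \<subseteq> (\<Union>x\<in>F. C x)"
  proof -
    have "\<forall>U\<in>C ` topspace X. openin X U" "topspace X \<subseteq> \<Union>(C ` topspace X)" using C by auto
    then obtain \<F> where "finite \<F>" "\<F> \<subseteq> C ` topspace X" and cov: "topspace X \<subseteq> \<Union>\<F>"
      using compact unfolding compact_space_alt by meson
    then obtain F where "F \<subseteq> topspace X" "finite F" "\<F> = C ` F" by (meson finite_subset_image)
    then show ?thesis using that cov by blast
  qed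
  define D where "D x = {z \<in> F. x \<in> C z}" for x
  define a where "a x = v (SOME z. z \<in> D x)" for x
  have ne: "D x \<noteq> {}" if "x \<in> topspace X" for x using F that by (auto simp: D_def)
  have "loc_const X a"
    unfolding loc_const_def
  proof
    fix x assume x: "x \<in> topspace X"
    let ?C = "topspace X \<inter> (\<Inter>z\<in>F. if x \<in> C z then C z else topspace X - C z)"
    have "openin X ?C"
    proof (cases "F = {}")
      case False
      then have "openin X (\<Inter>z\<in>F. if x \<in> C z then C z else topspace X - C z)"
        using F C by (intro openin_INT2) auto
      then show ?thesis by blast
    qed auto
    moreover have "x \<in> ?C" using x by auto
    moreover have "D x' = D x" if "x' \<in> ?C" for x' using that by (auto simp: D_def split: if_splits)
    then have "\<forall>x'\<in>?C. a x' = a x" by (metis a_def)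
    ultimately show "\<exists>C. openin X C \<and> x \<in> C \<and> (\<forall>x'\<in>C. a x' = a x)" by blast
  qed
  moreover have "P x (a x)" if x: "x \<in> topspace X" for x
  proof -
    have "(SOME z. z \<in> D x) \<in> D x" using ne[OF x] by (simp add: some_in_eq)
    then show ?thesis using C F by (auto simp: D_def a_def)
  qed
  ultimately show ?thesis using that by blast
qed

end

section \<open>Germs of dyadic piecewise linear maps\<close>

lemma dyadic_nat: "dyadic r \<longleftrightarrow> (\<exists>(p::int) (n::nat). r = of_int p / 2 ^ n)"
proof
  assume "dyadic r"
  then obtain p q :: int where r: "r = of_int p / 2 powi q" by (auto simp: dyadic_def)
  show "\<exists>(p::int) (n::nat). r = of_int p / 2 ^ n"
  proof (cases "q \<ge> 0")
    case True
    then show ?thesis using r by (intro exI[of _ p] exI[of _ "nat q"]) (simp add: power_int_def)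
  next
    case False
    then have "r = of_int (p * 2 ^ nat (- q)) / 2 ^ 0"
      using r by (simp add: power_int_def divide_simps)
    then show ?thesis by blast
  qed
next
  assume "\<exists>(p::int) (n::nat). r = of_int p / 2 ^ n"
  then obtain p :: int and n :: nat where "r = of_int p / 2 ^ n" by blast
  then have "r = of_int p / 2 powi (int n)" by simp
  then show "dyadic r" unfolding dyadic_def by blast
qed

lemma dyadic_of_int [simp]: "dyadic (of_int n)"
  unfolding dyadic_nat by (rule exI[of _ n], rule exI[of _ 0]) simp

lemma dyadic_0 [simp]: "dyadic 0" and dyadic_1 [simp]: "dyadic 1"
  using dyadic_of_int[of 0] dyadic_of_int[of 1] by simp_all

lemma dyadic_add [intro]: "dyadic a \<Longrightarrow> dyadic b \<Longrightarrow> dyadic (a + b)"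
proof -
  assume "dyadic a" "dyadic b"
  then obtain p q :: int and m n :: nat where "a = of_int p / 2 ^ m" "b = of_int q / 2 ^ n"
    unfolding dyadic_nat by blast
  then have "a + b = of_int (p * 2 ^ n + q * 2 ^ m) / 2 ^ (m + n)"
    by (simp add: add_divide_distrib power_add)
  then show ?thesis unfolding dyadic_nat by blast
qed

lemma dyadic_mult [intro]: "dyadic a \<Longrightarrow> dyadic b \<Longrightarrow> dyadic (a * b)"
proof -
  assume "dyadic a" "dyadic b"
  then obtain p q :: int and m n :: nat where "a = of_int p / 2 ^ m" "b = of_int q / 2 ^ n"
    unfolding dyadic_nat by blast
  then have "a * b = of_int (p * q) / 2 ^ (m + n)"
    by (simp add: power_add)
  then show ?thesis unfolding dyadic_nat by blast
qed

lemma dyadic_minus [intro]: "dyadic a \<Longrightarrow> dyadic (- a)"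
  using dyadic_mult[OF dyadic_of_int[of "-1"], of a] by simp

lemma dyadic_diff [intro]: "dyadic a \<Longrightarrow> dyadic b \<Longrightarrow> dyadic (a - b)"
  using dyadic_add[of a "- b"] dyadic_minus[of b] by simp

lemma dyadic_dense:
  assumes "a < b" obtains d where "dyadic d" "a < d" "d < b"
proof -
  obtain k where k: "(1/2) ^ k < b - a"
    using real_arch_pow_inv[of "b - a" "1/2"] assms by auto
  define d where "d = of_int (\<lfloor>a * 2 ^ k\<rfloor> + 1) / (2::real) ^ k"
  have "a * 2 ^ k < of_int (\<lfloor>a * 2 ^ k\<rfloor> + 1)" by linarith
  then have "a < d" unfolding d_def by (simp add: field_simps)
  moreover have "of_int (\<lfloor>a * 2 ^ k\<rfloor> + 1) \<le> a * 2 ^ k + 1" by linarith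
  then have "d \<le> (a * 2 ^ k + 1) / 2 ^ k" unfolding d_def by (intro divide_right_mono) auto
  then have "d \<le> a + (1/2) ^ k" by (simp add: add_divide_distrib power_divide)
  moreover have "dyadic d" unfolding d_def dyadic_nat by blast
  ultimately show ?thesis using that k by force
qed

section \<open>Piecewise affine germs with power-of-two slopes\<close>

definition pow2 :: "real \<Rightarrow> bool" where "pow2 l \<longleftrightarrow> (\<exists>m::int. l = 2 powi m)"

lemma pow2_pos: "pow2 l \<Longrightarrow> l > 0" by (auto simp: pow2_def)

lemma pow2_dyadic: "pow2 l \<Longrightarrow> dyadic l"
proof -
  assume "pow2 l"
  then obtain m :: int where "l = of_int 1 / 2 powi (- m)"
    by (auto simp: pow2_def power_int_minus divide_simps)
  then show ?thesis unfolding dyadic_def by blast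
qed

lemma pow2_1 [simp]: "pow2 1" unfolding pow2_def by (rule exI[of _ 0]) simp
lemma pow2_2 [simp]: "pow2 2" unfolding pow2_def by (rule exI[of _ 1]) simp
lemma pow2_mult: "pow2 l \<Longrightarrow> pow2 r \<Longrightarrow> pow2 (l * r)"
  unfolding pow2_def by (metis power_int_add zero_neq_numeral)
lemma pow2_inverse: "pow2 l \<Longrightarrow> pow2 (1 / l)"
  unfolding pow2_def by (metis power_int_minus inverse_eq_divide)
lemma pow2_power: "pow2 (2 ^ n)" unfolding pow2_def by (rule exI[of _ "int n"]) simp

text \<open>Normal form of a piecewise linear germ through \<open>(t0, v)\<close>. It is used as a
  map of the whole line because, for positive slopes, its inverse is again of this form, with
  \<open>t0\<close> and \<open>v\<close> exchanged and the slopes inverted.\<close>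

definition aff2 :: "real \<Rightarrow> real \<Rightarrow> real \<Rightarrow> real \<Rightarrow> real \<Rightarrow> real" where
  "aff2 v l r t0 t = v + (if t \<le> t0 then l else r) * (t - t0)"

lemma aff2_cont: "continuous_on UNIV (aff2 v l r t0)"
proof -
  have "aff2 v l r t0 = (\<lambda>t. v + l * min (t - t0) 0 + r * max (t - t0) 0)"
    by (rule ext) (auto simp: aff2_def min_def max_def)
  then show ?thesis by (simp only:) (intro continuous_intros)
qed

lemma aff2_isCont: "isCont (aff2 v l r t0) t"
  using aff2_cont continuous_on_eq_continuous_at open_UNIV by blast

lemma aff2_at [simp]: "aff2 v l r t0 t0 = v" by (simp add: aff2_def)

lemma aff2_inverse:
  assumes "l > 0" "r > 0"
  shows "aff2 t0 (1/l) (1/r) v (aff2 v l r t0 t) = t" 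
proof -
  have "aff2 v l r t0 t \<le> v \<longleftrightarrow> t \<le> t0"
    using assms by (auto simp: aff2_def mult_le_0_iff not_le)
  then show ?thesis using assms by (simp add: aff2_def)
qed

lemma aff2_inverse':
  assumes "l > 0" "r > 0"
  shows "aff2 v l r t0 (aff2 t0 (1/l) (1/r) v t) = t"
  using aff2_inverse[of "1/l" "1/r" v t0 t] assms by simp

lemma aff2_strict_mono:
  assumes "l > 0" "r > 0" "s < t" shows "aff2 v l r t0 s < aff2 v l r t0 t"
proof -
  consider "t \<le> t0" | "s > t0" | "s \<le> t0" "t0 < t" by linarith
  then show ?thesis
  proof cases
    case 3
    then have "l * (s - t0) \<le> 0" "0 < r * (t - t0)" using assms by (auto simp: mult_le_0_iff)
    then show ?thesis using 3 by (simp add: aff2_def)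
  next
    case 1
    then have "l * s < l * t" using assms by simp
    then show ?thesis using 1 assms by (simp add: aff2_def algebra_simps)
  next
    case 2
    then have "r * s < r * t" using assms by simp
    then show ?thesis using 2 assms by (simp add: aff2_def algebra_simps)
  qed
qed

lemma aff2_le_iff:
  assumes "l > 0" "r > 0" shows "aff2 v l r t0 t \<le> v \<longleftrightarrow> t \<le> t0"
  using assms by (auto simp: aff2_def mult_le_0_iff not_le)

text \<open>If the slopes at \<open>t0\<close> agree, \<open>t0\<close> itself need not be dyadic, only the constant term of the affine map.\<close>

definition dgerm :: "(real \<Rightarrow> real) \<Rightarrow> real \<Rightarrow> bool" where
  "dgerm f t0 \<longleftrightarrow> (\<exists>l r. pow2 l \<and> pow2 r \<and>
     (l = r \<and> dyadic (f t0 - l * t0) \<or> dyadic t0 \<and> dyadic (f t0)) \<and>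
     (\<forall>\<^sub>F t in nhds t0. f t = aff2 (f t0) l r t0 t))"

lemma dgermE:
  assumes "dgerm f t0"
  obtains l r where "pow2 l" "pow2 r" "l > 0" "r > 0"
    "l = r \<and> dyadic (f t0 - l * t0) \<or> dyadic t0 \<and> dyadic (f t0)"
    "\<forall>\<^sub>F t in nhds t0. f t = aff2 (f t0) l r t0 t"
  using assms pow2_pos unfolding dgerm_def by blast

lemma dgerm_cong_imp:
  assumes "dgerm f t0" "\<forall>\<^sub>F t in nhds t0. f t = g t" shows "dgerm g t0"
proof -
  have eq: "f t0 = g t0" using assms(2) eventually_nhds_x_imp_x by blast
  obtain l r where lr: "pow2 l" "pow2 r" "l = r \<and> dyadic (f t0 - l * t0) \<or> dyadic t0 \<and> dyadic (f t0)"
    "\<forall>\<^sub>F t in nhds t0. f t = aff2 (f t0) l r t0 t" using assms(1) by (rule dgermE)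
  have "\<forall>\<^sub>F t in nhds t0. g t = aff2 (g t0) l r t0 t"
    using lr(4) assms(2) by eventually_elim (simp add: eq)
  then show ?thesis using lr eq unfolding dgerm_def by auto
qed

lemma dgerm_isCont: assumes "dgerm f t0" shows "isCont f t0"
proof -
  obtain l r where "\<forall>\<^sub>F t in nhds t0. f t = aff2 (f t0) l r t0 t" using assms by (rule dgermE)
  then show ?thesis using isCont_cong[of f "aff2 (f t0) l r t0" t0] aff2_isCont by blast
qed

lemma eventually_nhds_comp:
  fixes f :: "'c::t2_space \<Rightarrow> 'd::topological_space"
  assumes "isCont f t0" "\<forall>\<^sub>F s in nhds (f t0). P s"
  shows "\<forall>\<^sub>F t in nhds t0. P (f t)"
proof -
  have "filterlim f (nhds (f t0)) (nhds t0)"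
    using assms(1) by (simp add: isCont_def tendsto_at_iff_tendsto_nhds)
  then show ?thesis using assms(2) filterlim_iff by blast
qed

lemma dgerm_dyadic: assumes "dgerm f t0" "dyadic t0" shows "dyadic (f t0)"
proof -
  obtain l r where lr: "pow2 l" "l = r \<and> dyadic (f t0 - l * t0) \<or> dyadic t0 \<and> dyadic (f t0)"
    using assms(1) by (rule dgermE)
  have "dyadic (f t0 - l * t0 + l * t0)" if "dyadic (f t0 - l * t0)"
    using that assms(2) pow2_dyadic[OF lr(1)] by blast
  then show ?thesis using lr(2) by auto
qed

text \<open>Increasing maps preserve sides, so slopes multiply on each side. For the side condition:
  a germ sends dyadic points to dyadic ones, and one without a break sends non-dyadic points to
  non-dyadic ones. Hence either all points involved are dyadic or neither germ has a break.\<close>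

lemma dgerm_comp:
  assumes f: "dgerm f t0" and g: "dgerm g (f t0)" shows "dgerm (\<lambda>t. g (f t)) t0"
proof -
  obtain l r where lr: "pow2 l" "pow2 r" "l > 0" "r > 0"
    "l = r \<and> dyadic (f t0 - l * t0) \<or> dyadic t0 \<and> dyadic (f t0)"
    "\<forall>\<^sub>F t in nhds t0. f t = aff2 (f t0) l r t0 t" using f by (rule dgermE)
  obtain l' r' where lr': "pow2 l'" "pow2 r'" "l' > 0" "r' > 0"
    "l' = r' \<and> dyadic (g (f t0) - l' * f t0) \<or> dyadic (f t0) \<and> dyadic (g (f t0))"
    "\<forall>\<^sub>F t in nhds (f t0). g t = aff2 (g (f t0)) l' r' (f t0) t" using g by (rule dgermE)
  have ev: "\<forall>\<^sub>F t in nhds t0. g (f t) = aff2 (g (f t0)) (l' * l) (r' * r) t0 t"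
    using lr(6) eventually_nhds_comp[OF dgerm_isCont[OF f] lr'(6)]
  proof eventually_elim
    case (elim t)
    have "f t \<le> f t0 \<longleftrightarrow> t \<le> t0"
      using aff2_le_iff[OF lr(3,4), of "f t0" t0 t] elim(1) by simp
    then have "g (f t) = g (f t0) + (if t \<le> t0 then l' else r') * (f t - f t0)"
      using elim(2) by (simp add: aff2_def)
    moreover have "f t - f t0 = (if t \<le> t0 then l else r) * (t - t0)"
      using elim(1) by (simp add: aff2_def)
    ultimately show ?case by (simp add: aff2_def)
  qed
  have d: "l' * l = r' * r \<and> dyadic (g (f t0) - l' * l * t0) \<or> dyadic t0 \<and> dyadic (g (f t0))"
  proof -
    have gf: "dyadic (g (f t0))" if "dyadic (f t0)"
    proof -
      have "dyadic (g (f t0) - l' * f t0) \<Longrightarrow> dyadic (g (f t0) - l' * f t0 + l' * f t0)"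
        using that pow2_dyadic[OF lr'(1)] by blast
      then show ?thesis using lr'(5) by auto
    qed
    consider "dyadic t0" "dyadic (f t0)" | "l = r" "dyadic (f t0 - l * t0)" "\<not> dyadic t0"
      using lr(5) by (cases "dyadic t0 \<and> dyadic (f t0)") (use lr(5) dgerm_dyadic[OF f] in auto)
    then show ?thesis
    proof cases
      case 1
      then show ?thesis using gf by blast
    next
      case 2
      have "\<not> dyadic (f t0)"
      proof
        assume "dyadic (f t0)"
        then have "dyadic (1 / l * (f t0 - (f t0 - l * t0)))"
          using 2 pow2_dyadic[OF pow2_inverse[OF lr(1)]] by blast
        then show False using 2 lr(3) by simp
      qed
      then have "l' = r'" "dyadic (g (f t0) - l' * f t0)" using lr'(5) by auto
      then have "dyadic (g (f t0) - l' * f t0 + l' * (f t0 - l * t0))"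
        using 2 pow2_dyadic[OF lr'(1)] by blast
      moreover have "g (f t0) - l' * f t0 + l' * (f t0 - l * t0) = g (f t0) - l' * l * t0"
        by (simp add: algebra_simps)
      ultimately have "dyadic (g (f t0) - l' * l * t0)" by argo
      then show ?thesis using 2(1) \<open>l' = r'\<close> by simp
    qed
  qed
  show ?thesis
    unfolding dgerm_def using ev d pow2_mult lr(1,2) lr'(1,2) by blast
qed

lemma dgerm_affine:
  assumes "pow2 l" "dyadic b" shows "dgerm (\<lambda>t. l * t + b) t0"
  unfolding dgerm_def
  by (rule exI[of _ l], rule exI[of _ l]) (use assms in \<open>auto simp: aff2_def algebra_simps\<close>)

lemma dgerm_shift: "dyadic b \<Longrightarrow> dgerm (\<lambda>t. t + b) t0"
  using dgerm_affine[of 1 b t0] by simp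

lemma dgerm_id: "dgerm (\<lambda>t. t) t0"
  using dgerm_affine[of 1 0 t0] by simp

lemma dgerm_inverse_ex:
  assumes "dgerm f t0"
  obtains f' where "dgerm f' (f t0)" "f' (f t0) = t0"
    "\<forall>\<^sub>F s in nhds (f t0). f (f' s) = s" "\<forall>\<^sub>F t in nhds t0. f' (f t) = t"
proof -
  obtain l r where lr: "pow2 l" "pow2 r" "l > 0" "r > 0"
    "l = r \<and> dyadic (f t0 - l * t0) \<or> dyadic t0 \<and> dyadic (f t0)"
    "\<forall>\<^sub>F t in nhds t0. f t = aff2 (f t0) l r t0 t" using assms by (rule dgermE)
  define f' where "f' = aff2 t0 (1/l) (1/r) (f t0)"
  have at: "f' (f t0) = t0" by (simp add: f'_def)
  have "dyadic (1/l * - (f t0 - l * t0))" if "dyadic (f t0 - l * t0)"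
    using that pow2_dyadic[OF pow2_inverse[OF lr(1)]] by blast
  then have "dyadic (t0 - 1/l * f t0)" if "dyadic (f t0 - l * t0)"
    using that lr(3) by (simp add: right_diff_distrib)
  then have "dgerm f' (f t0)"
    unfolding dgerm_def at using lr(5) pow2_inverse[OF lr(1)] pow2_inverse[OF lr(2)]
    by (intro exI[of _ "1/l"] exI[of _ "1/r"]) (auto simp: f'_def)
  moreover have "\<forall>\<^sub>F s in nhds (f t0). f (f' s) = s"
  proof -
    have "\<forall>\<^sub>F s in nhds (f t0). f (f' s) = aff2 (f t0) l r t0 (f' s)"
      using eventually_nhds_comp[where f = f' and ?t0.0 = "f t0" and P = "\<lambda>t. f t = aff2 (f t0) l r t0 t"] lr(6) at aff2_isCont
      unfolding f'_def by simp
    then show ?thesis by eventually_elim (simp add: f'_def aff2_inverse' lr)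
  qed
  moreover have "\<forall>\<^sub>F t in nhds t0. f' (f t) = t"
    using lr(6) by eventually_elim (simp add: f'_def aff2_inverse lr)
  ultimately show ?thesis using that at by blast
qed

text \<open>\<open>f\<close> covers a neighbourhood of \<open>f t0\<close>, so a left inverse is
  determined there and agrees with the inverse germ.\<close>

lemma dgerm_left_inverse:
  assumes "dgerm f t0" "\<forall>\<^sub>F t in nhds t0. g (f t) = t" shows "dgerm g (f t0)"
proof -
  obtain f' where f': "dgerm f' (f t0)" "f' (f t0) = t0" "\<forall>\<^sub>F s in nhds (f t0). f (f' s) = s"
    using assms(1) by (rule dgerm_inverse_ex)
  have "\<forall>\<^sub>F s in nhds (f t0). g (f (f' s)) = f' s"
    using eventually_nhds_comp[OF dgerm_isCont[OF f'(1)], of "\<lambda>t. g (f t) = t"] assms(2) f'(2) by simp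
  with f'(3) have "\<forall>\<^sub>F s in nhds (f t0). f' s = g s" by eventually_elim simp
  then show ?thesis using dgerm_cong_imp f'(1) by blast
qed

text \<open>The left slope comes from \<open>f\<close> and the right slope from \<open>g\<close>.
  They may differ, so the second alternative in \<open>dgerm\<close> is needed: \<open>a\<close> is
  dyadic, hence so is the common value.\<close>

lemma dgerm_glue:
  assumes "dgerm f a" "dgerm g a" "f a = g a" "dyadic a"
    and "\<forall>\<^sub>F t in nhds a. h t = (if t \<le> a then f t else g t)"
  shows "dgerm h a"
proof -
  obtain l r where lr: "pow2 l" "pow2 r" "\<forall>\<^sub>F t in nhds a. f t = aff2 (f a) l r a t"
    using assms(1) by (rule dgermE)
  obtain l' r' where lr': "pow2 l'" "pow2 r'" "\<forall>\<^sub>F t in nhds a. g t = aff2 (g a) l' r' a t"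
    using assms(2) by (rule dgermE)
  have ha: "h a = f a" using eventually_nhds_x_imp_x[OF assms(5)] by simp
  have "\<forall>\<^sub>F t in nhds a. h t = aff2 (h a) l r' a t"
    using lr(3) lr'(3) assms(5) by eventually_elim (use assms(3) ha in \<open>auto simp: aff2_def\<close>)
  then show ?thesis
    unfolding dgerm_def using lr(1) lr'(2) assms(4) dgerm_dyadic[OF assms(1,4)] ha by auto
qed

text \<open>Conjugation by the reflection exchanges the left and the right slope and keeps them
  positive. This is what makes the groups of \<open>\<phi>\<close> and its inverse
  isomorphic.\<close>

lemma dgerm_neg: assumes "dgerm f t0" shows "dgerm (\<lambda>t. - f (- t)) (- t0)"
proof -
  obtain l r where lr: "pow2 l" "pow2 r" 
    "l = r \<and> dyadic (f t0 - l * t0) \<or> dyadic t0 \<and> dyadic (f t0)"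
    "\<forall>\<^sub>F t in nhds t0. f t = aff2 (f t0) l r t0 t" using assms by (rule dgermE)
  have "\<forall>\<^sub>F t in nhds (- t0). f (- t) = aff2 (f t0) l r t0 (- t)"
    using eventually_nhds_comp[where f = uminus and ?t0.0 = "- t0" and P = "\<lambda>t. f t = aff2 (f t0) l r t0 t"] lr(4) by simp
  then have "\<forall>\<^sub>F t in nhds (- t0). - f (- t) = aff2 (- f t0) r l (- t0) t"
  proof eventually_elim
    case (elim t)
    show ?case
    proof (cases t "- t0" rule: linorder_cases)
      case less
      then have "\<not> - t \<le> t0" "t \<le> - t0" by auto
      then show ?thesis using elim unfolding aff2_def by (simp add: algebra_simps)
    next
      case greater
      then have "- t \<le> t0" "\<not> t \<le> - t0" by auto
      then show ?thesis using elim unfolding aff2_def by (simp add: algebra_simps)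
    qed (use elim in simp)
  qed
  moreover have "r = l \<and> dyadic (- f t0 - r * - t0) \<or> dyadic (- t0) \<and> dyadic (- f t0)"
    using lr(3) dyadic_minus[of "f t0 - l * t0"] dyadic_minus[of t0] dyadic_minus[of "f t0"] by auto
  ultimately show ?thesis
    unfolding dgerm_def using lr(1,2) by (intro exI[of _ r] exI[of _ l]) simp
qed

text \<open>At a breakpoint the adjacent affine pieces are compared with \<open>f t0\<close> through
  one-sided limits; they agree there, and \<open>dgerm_glue\<close> applies.\<close>

lemma dyadic_PL_homeo_dgerm:
  assumes f: "dyadic_PL_homeo J J' f" and J: "open J" and t0: "t0 \<in> J"
  shows "dgerm f t0"
proof -
  obtain B where B: "finite B" "B \<subseteq> J" "\<forall>t\<in>B. dyadic t"
    "\<forall>K\<in>components (J - B). \<exists>(m::int) b. dyadic b \<and> (\<forall>t\<in>K. f t = 2 powi m * t + b)"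
    using f unfolding dyadic_PL_homeo_def by blast
  obtain f' where "homeomorphism J J' f f'" using f unfolding dyadic_PL_homeo_def by blast
  then have "continuous_on J f" by (simp add: homeomorphism_def)
  then have cont: "isCont f t0" using J t0 continuous_on_eq_continuous_at by blast
  \<comment> \<open>A neighbourhood of \<open>t0\<close> that contains no breakpoint except possibly
    \<open>t0\<close> itself.\<close>
  have "open (J - (B - {t0}))" using J B by (simp add: open_Diff finite_imp_closed)
  then obtain e where e: "e > 0" "ball t0 e \<subseteq> J - (B - {t0})"
    using t0 open_contains_ball by (metis DiffI Diff_iff insertI1)
  have aff: "\<exists>l b. pow2 l \<and> dyadic b \<and> (\<forall>t\<in>S. f t = l * t + b)"
    if S: "connected S" "S \<noteq> {}" "S \<subseteq> J - B" for S
  proof -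
    obtain K where "K \<in> components (J - B)" "S \<subseteq> K" using S exists_component_superset[of S "J - B"] by blast
    then show ?thesis using B(4) unfolding pow2_def by (metis subset_eq)
  qed
  show ?thesis
  proof (cases "t0 \<in> B")
    case False
    then obtain l b where "pow2 l" "dyadic b" "\<forall>t\<in>ball t0 e. f t = l * t + b"
      using aff[of "ball t0 e"] e by auto
    moreover from this e have "\<forall>\<^sub>F t in nhds t0. l * t + b = f t"
      unfolding eventually_nhds_metric by (metis dist_commute mem_ball)
    ultimately show ?thesis using dgerm_cong_imp[OF dgerm_affine] by blast
  next
    case True
    then have d: "dyadic t0" using B by blast
    have L: "{t0 - e<..<t0} \<subseteq> J - B" "{t0<..<t0 + e} \<subseteq> J - B"
      using e(2) by (force simp: subset_iff ball_def dist_real_def)+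
    obtain l b where lb: "pow2 l" "dyadic b" "\<forall>t\<in>{t0 - e<..<t0}. f t = l * t + b"
      using aff[of "{t0 - e<..<t0}"] L e by auto
    obtain r c where rc: "pow2 r" "dyadic c" "\<forall>t\<in>{t0<..<t0 + e}. f t = r * t + c"
      using aff[of "{t0<..<t0 + e}"] L e by auto
    have 1: "f t0 = l * t0 + b"
    proof (rule tendsto_unique)
      show "(f \<longlongrightarrow> f t0) (at_left t0)" using cont
        by (simp add: continuous_at filterlim_at_split)
      have "((\<lambda>t. l * t + b) \<longlongrightarrow> l * t0 + b) (at_left t0)" by (intro tendsto_intros)
      moreover have "\<forall>\<^sub>F t in at_left t0. l * t + b = f t"
        using eventually_at_left_real[of "t0 - e" t0] e lb(3) by (auto elim!: eventually_mono)
      ultimately show "(f \<longlongrightarrow> l * t0 + b) (at_left t0)" by (rule Lim_transform_eventually)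
    qed simp
    have 2: "f t0 = r * t0 + c"
    proof (rule tendsto_unique)
      show "(f \<longlongrightarrow> f t0) (at_right t0)" using cont
        by (simp add: continuous_at filterlim_at_split)
      have "((\<lambda>t. r * t + c) \<longlongrightarrow> r * t0 + c) (at_right t0)" by (intro tendsto_intros)
      moreover have "\<forall>\<^sub>F t in at_right t0. r * t + c = f t"
        using eventually_at_right_real[of t0 "t0 + e"] e rc(3) by (auto elim!: eventually_mono)
      ultimately show "(f \<longlongrightarrow> r * t0 + c) (at_right t0)" by (rule Lim_transform_eventually)
    qed simp
    have "f t = (if t \<le> t0 then l * t + b else r * t + c)" if "dist t t0 < e" for t
    proof (cases t t0 rule: linorder_cases)
      case less then show ?thesis using lb(3) that by (auto simp: dist_real_def)
    next
      case equal then show ?thesis using 1 by simp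
    next
      case greater then show ?thesis using rc(3) that by (auto simp: dist_real_def)
    qed
    then have "\<forall>\<^sub>F t in nhds t0. f t = (if t \<le> t0 then l * t + b else r * t + c)"
      unfolding eventually_nhds_metric using e(1) by blast
    then show ?thesis
      using dgerm_glue[OF dgerm_affine[OF lb(1,2)] dgerm_affine[OF rc(1,2)] _ d] 1 2 by simp
  qed
qed

text \<open>Both intervals are made shorter than 1: return times are at least 1, so such intervals
  give charts over every clopen set. The property \<open>P\<close> is carried along to keep the
  formula of a group element valid on the whole interval.\<close>

lemma dgerm_PL_homeo:
  assumes f: "dgerm f t0" and ev: "\<forall>\<^sub>F t in nhds t0. P t"
  obtains a b a' b' where "dyadic a" "dyadic b" "dyadic a'" "dyadic b'" "a < t0" "t0 < b"
    "b - a < 1" "a' < b'" "b' - a' < 1"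
    "dyadic_PL_homeo {a<..<b} {a'<..<b'} f" "f ` {a<..<b} = {a'<..<b'}" "\<forall>t\<in>{a<..<b}. P t"
proof -
  obtain l r where lr: "pow2 l" "pow2 r" "l > 0" "r > 0"
    "l = r \<and> dyadic (f t0 - l * t0) \<or> dyadic t0 \<and> dyadic (f t0)"
    "\<forall>\<^sub>F t in nhds t0. f t = aff2 (f t0) l r t0 t" using f by (rule dgermE)
  define A where "A = aff2 (f t0) l r t0"
  define A' where "A' = aff2 t0 (1/l) (1/r) (f t0)"
  have A': "A' (A t) = t" "A (A' t) = t" for t
    using lr by (simp_all add: A_def A'_def aff2_inverse aff2_inverse')
  have mono: "A s < A t \<longleftrightarrow> s < t" for s t
    unfolding A_def using aff2_strict_mono[OF lr(3,4)] by (metis linorder_neqE_linordered_idom not_less_iff_gr_or_eq)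
  have "\<forall>\<^sub>F t in nhds t0. dist (A t) (A t0) < 1/2"
  proof (rule eventually_nhds_comp[where f = A])
    show "isCont A t0" unfolding A_def by (rule aff2_isCont)
    have "(1/2::real) > 0" by simp
    then show "\<forall>\<^sub>F s in nhds (A t0). dist s (A t0) < 1/2" unfolding eventually_nhds_metric by blast
  qed
  with lr(6) ev have "\<forall>\<^sub>F t in nhds t0. dist (A t) (A t0) < 1/2 \<and> f t = A t \<and> P t"
    by eventually_elim (simp add: A_def)
  then obtain e where e: "e > 0" "\<And>t. dist t t0 < e \<Longrightarrow> dist (A t) (A t0) < 1/2 \<and> f t = A t \<and> P t"
    unfolding eventually_nhds_metric by blast
  obtain a where a: "dyadic a" "t0 - min e (1/2) < a" "a < t0" using dyadic_dense[of "t0 - min e (1/2)" t0] e by auto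
  obtain b where b: "dyadic b" "t0 < b" "b < t0 + min e (1/2)" using dyadic_dense[of t0 "t0 + min e (1/2)"] e by auto
  have near: "dist t t0 < e" if "t \<in> {a..b}" for t using that a b by (auto simp: dist_real_def)
  have fA: "f t = A t" if "t \<in> {a..b}" for t using e near that by blast
  have img: "f ` {a<..<b} = {A a<..<A b}"
  proof -
    have "f ` {a<..<b} = A ` {a<..<b}" using fA by (intro image_cong) auto
    also have "\<dots> = {A a<..<A b}"
    proof
      show "A ` {a<..<b} \<subseteq> {A a<..<A b}" using mono by auto
      show "{A a<..<A b} \<subseteq> A ` {a<..<b}"
      proof
        fix s assume "s \<in> {A a<..<A b}"
        then have "A' s \<in> {a<..<b}" using mono[of a "A' s"] mono[of "A' s" b] A' by simp
        then show "s \<in> A ` {a<..<b}" using A'(2) by (metis image_eqI)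
      qed
    qed
    finally show ?thesis .
  qed
  \<comment> \<open>The endpoints must have dyadic images even if \<open>t0\<close> is not dyadic;
    in that case \<open>A\<close> is affine with a dyadic constant term.\<close>
  have dA: "dyadic (A t)" if "dyadic t" for t
  proof (cases "dyadic t0 \<and> dyadic (f t0)")
    case True
    then show ?thesis using that pow2_dyadic lr(1,2) unfolding A_def aff2_def
      by (auto intro!: dyadic_add dyadic_mult dyadic_diff)
  next
    case False
    then have "l = r" "dyadic (f t0 - l * t0)" using lr(5) by auto
    then have "dyadic (f t0 - l * t0 + l * t)" using that pow2_dyadic lr(1) by blast
    moreover have "f t0 - l * t0 + l * t = A t" using \<open>l = r\<close> by (simp add: A_def aff2_def algebra_simps)
    ultimately show ?thesis by simp
  qed
  have "homeomorphism {a<..<b} {A a<..<A b} f A'"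
  proof (rule homeomorphismI)
    have "continuous_on {a<..<b} A" unfolding A_def using aff2_cont continuous_on_subset by blast
    then show "continuous_on {a<..<b} f" by (rule continuous_on_eq) (use fA in auto)
    show "continuous_on {A a<..<A b} A'" unfolding A'_def using aff2_cont continuous_on_subset by blast
    show "f ` {a<..<b} \<subseteq> {A a<..<A b}" using img by blast
    show "A' ` {A a<..<A b} \<subseteq> {a<..<b}"
    proof
      fix t assume "t \<in> A' ` {A a<..<A b}"
      then obtain s where "t = A' s" "A a < s" "s < A b" by auto
      then show "t \<in> {a<..<b}" using mono[of a "A' s"] mono[of "A' s" b] A' by simp
    qed
    show "A' (f t) = t" if "t \<in> {a<..<b}" for t using fA[of t] that A' by simp
    show "f (A' s) = s" if "s \<in> {A a<..<A b}" for s
    proof -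
      have "a < A' s" "A' s < b" using that mono[of a "A' s"] mono[of "A' s" b] A' by simp_all
      then show ?thesis using fA[of "A' s"] A' by simp
    qed
  qed
  moreover have ab: "A a < A b" using a b mono by simp
  moreover have "dyadic_interval {a<..<b}" "dyadic_interval {A a<..<A b}"
  proof -
    show "dyadic_interval {a<..<b}" unfolding dyadic_interval_def
      by (rule exI[of _ a], rule exI[of _ b]) (use a b in auto)
    have "{A a<..<A b} \<subseteq> {A a..A b}" by auto
    then show "dyadic_interval {A a<..<A b}" unfolding dyadic_interval_def
      using dA[OF a(1)] dA[OF b(1)] ab by blast
  qed
  moreover have "\<exists>B. finite B \<and> B \<subseteq> {a<..<b} \<and> (\<forall>t\<in>B. dyadic t) \<and>
        (\<forall>K\<in>components ({a<..<b} - B). \<exists>(m::int) c. dyadic c \<and> (\<forall>t\<in>K. f t = 2 powi m * t + c))"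
  proof -
    obtain m1 m2 :: int where m: "l = 2 powi m1" "r = 2 powi m2" using lr(1,2) by (auto simp: pow2_def)
    show ?thesis
    proof (cases "dyadic t0 \<and> dyadic (f t0)")
      case True
      have "\<exists>(m::int) c. dyadic c \<and> (\<forall>t\<in>K. f t = 2 powi m * t + c)"
        if K: "K \<in> components ({a<..<b} - {t0})" for K
      proof -
        have sub: "K \<subseteq> {a<..<b} - {t0}" using K in_components_subset by blast
        have "connected K" using K in_components_connected by blast
        have "K \<subseteq> {..t0} \<or> K \<subseteq> {t0..}"
        proof (rule ccontr)
          assume "\<not> ?thesis"
          then obtain s t where "s \<in> K" "t \<in> K" "s > t0" "t < t0" by force
          then have "t0 \<in> K" using \<open>connected K\<close> unfolding connected_iff_interval by (meson less_imp_le)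
          then show False using sub by blast
        qed
        then show ?thesis
        proof
          assume side: "K \<subseteq> {..t0}"
          then have "f t = 2 powi m1 * t + (f t0 - l * t0)" if "t \<in> K" for t
          proof -
            have "t \<in> {a<..<b}" "t \<noteq> t0" using sub that by auto
            moreover have "t \<le> t0" using side that by auto
            ultimately have "f t = f t0 + l * (t - t0)" using fA[of t] by (simp add: A_def aff2_def)
            then show ?thesis by (simp add: m algebra_simps)
          qed
          then have "\<forall>t\<in>K. f t = 2 powi m1 * t + (f t0 - l * t0)" by blast
          moreover have "dyadic (f t0 - l * t0)" using True pow2_dyadic[OF lr(1)] by blast
          ultimately show ?thesis by blast
        next
          assume side: "K \<subseteq> {t0..}"
          then have "f t = 2 powi m2 * t + (f t0 - r * t0)" if "t \<in> K" for t
          proof -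
            have "t \<in> {a<..<b}" "t \<noteq> t0" using sub that by auto
            moreover have "t \<ge> t0" using side that by auto
            ultimately have "f t = f t0 + r * (t - t0)" using fA[of t] by (simp add: A_def aff2_def)
            then show ?thesis by (simp add: m algebra_simps)
          qed
          then have "\<forall>t\<in>K. f t = 2 powi m2 * t + (f t0 - r * t0)" by blast
          moreover have "dyadic (f t0 - r * t0)" using True pow2_dyadic[OF lr(2)] by blast
          ultimately show ?thesis by blast
        qed
      qed
      then show ?thesis using True a b by (intro exI[of _ "{t0}"]) auto
    next
      case False
      then have *: "l = r" "dyadic (f t0 - l * t0)" using lr(5) by auto
      have "f t = 2 powi m1 * t + (f t0 - l * t0)" if "t \<in> {a<..<b}" for t
      proof -
        have "f t = f t0 + l * (t - t0)" using fA[of t] that *(1) by (simp add: A_def aff2_def)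
        then show ?thesis by (simp add: m algebra_simps)
      qed
      then have "\<forall>K\<in>components ({a<..<b} - {}). \<exists>(m::int) c. dyadic c \<and> (\<forall>t\<in>K. f t = 2 powi m * t + c)"
        using *(2) in_components_subset by (metis Diff_empty subset_eq)
      then show ?thesis by blast
    qed
  qed
  ultimately have "dyadic_PL_homeo {a<..<b} {A a<..<A b} f"
    unfolding dyadic_PL_homeo_def by blast
  moreover have "A b - A a < 1"
  proof -
    have "dist (A b) (A t0) < 1/2" "dist (A a) (A t0) < 1/2" using e near a b by auto
    then show ?thesis by (simp add: dist_real_def abs_if split: if_splits)
  qed
  moreover have "b - a < 1" using a b by linarith
  moreover have "\<forall>t\<in>{a<..<b}. P t" using e(2) near by auto
  ultimately show ?thesis using that[of a b "A a" "A b"] a b dA ab img by blast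
qed

section \<open>The group in local coordinates\<close>

context stone
begin

text \<open>A chart-free form of the condition in \<open>T_set\<close>: any representative of the
  point may be used, \<open>C\<close> need not be clopen, and no bound on lengths occurs.\<close>

definition local_form :: "(('a \<times> real) set \<Rightarrow> ('a \<times> real) set) \<Rightarrow> bool" where
  "local_form g \<longleftrightarrow> (\<forall>x0\<in>topspace X. \<forall>t0. \<exists>C f. openin X C \<and> x0 \<in> C \<and> dgerm f t0 \<and>
     (\<forall>\<^sub>F t in nhds t0. \<forall>x\<in>C. g (cls (x, t)) = cls (x, f t)))"

lemma local_formE:
  assumes "local_form g" "x0 \<in> topspace X"
  obtains C f where "openin X C" "x0 \<in> C" "C \<subseteq> topspace X" "dgerm f t0"
    "\<forall>\<^sub>F t in nhds t0. \<forall>x\<in>C. g (cls (x, t)) = cls (x, f t)"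
  using assms openin_subset unfolding local_form_def by meson

lemma return_time_ge_1: "1 \<le> return_time \<phi> C"
proof -
  have "1 \<le> enat n" if "1 \<le> n" for n using that by (simp add: one_enat_def)
  then show ?thesis unfolding return_time_def by (intro Inf_greatest) auto
qed

lemma is_chart_short:
  assumes "openin X C" "closedin X C" "a \<le> b" "b - a < 1"
  shows "is_chart X \<phi> C {a<..<b}"
proof -
  have "emeasure lborel {a<..<b} = ennreal (b - a)" using assms(3) by simp
  also have "\<dots> < ennreal 1" using assms by (subst ennreal_less_iff) auto
  also have "\<dots> = ennreal_of_enat 1" by (simp add: one_enat_def ennreal_of_enat_def)
  also have "\<dots> \<le> ennreal_of_enat (return_time \<phi> C)"
    using return_time_ge_1 by (simp only: ennreal_of_enat_le_iff)
  finally show ?thesis using assms by (simp add: is_chart_def is_interval_oo)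
qed

definition chart_form :: "(('a \<times> real) set \<Rightarrow> ('a \<times> real) set) \<Rightarrow> ('a \<times> real) set \<Rightarrow> 'a set \<Rightarrow> real set \<Rightarrow> (real \<Rightarrow> real) \<Rightarrow> bool" where
  "chart_form g y C J f \<longleftrightarrow> is_chart X \<phi> C J \<and> dyadic_interval J \<and> y \<in> chart_domain X \<phi> C J \<and>
     dyadic_PL_homeo J (f ` J) f \<and> is_chart X \<phi> C (f ` J) \<and>
     g ` chart_domain X \<phi> C J = chart_domain X \<phi> C (f ` J) \<and>
     (\<forall>x\<in>C. \<forall>t\<in>J. inv_into (C \<times> f ` J) cls (g (cls (x, t))) = (x, f t))"

lemma T_set_chart_form:
  "g \<in> T_set X \<phi> \<longleftrightarrow> g \<in> H0 X \<phi> \<and> (\<forall>y\<in>topspace Y. \<exists>C J f. chart_form g y C J f)"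
  unfolding T_set_def chart_form_def by simp

text \<open>A chart around a point may contain it through another representative
  \<open>(it n x0, t0 - n)\<close>; its germ is then conjugated by the translation by
  \<open>n\<close>, which is dyadic. Conversely, a germ is realised on a clopen subset of the
  transversal and on intervals shorter than 1.\<close>

lemma T_set_iff: "g \<in> T_set X \<phi> \<longleftrightarrow> g \<in> H0 X \<phi> \<and> local_form g"
proof
  assume g: "g \<in> T_set X \<phi>"
  have "\<exists>C f. openin X C \<and> x0 \<in> C \<and> dgerm f t0 \<and>
     (\<forall>\<^sub>F t in nhds t0. \<forall>x\<in>C. g (cls (x, t)) = cls (x, f t))" if x0: "x0 \<in> topspace X" for x0 t0
  proof -
    obtain C J f where "chart_form g (cls (x0, t0)) C J f"
      using g cls_in[OF x0, of t0] unfolding T_set_chart_form by meson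
    then have CJ: "is_chart X \<phi> C J" "cls (x0, t0) \<in> chart_domain X \<phi> C J"
      "dyadic_PL_homeo J (f ` J) f" "is_chart X \<phi> C (f ` J)"
      "g ` chart_domain X \<phi> C J = chart_domain X \<phi> C (f ` J)"
      "\<forall>x\<in>C. \<forall>t\<in>J. inv_into (C \<times> f ` J) cls (g (cls (x, t))) = (x, f t)"
      unfolding chart_form_def by auto
    have CX: "C \<subseteq> topspace X" "open J" and Co: "openin X C" using CJ(1) openin_subset by (auto simp: is_chart_def)
    \<comment> \<open>The inverse chart is only an \<open>inv_into\<close>, meaningful on the image
      of the chart; that \<open>g\<close> maps domain onto domain puts the point there.\<close>
    have gf: "g (cls (x, t)) = cls (x, f t)" if "x \<in> C" "t \<in> J" for x t
    proof -
      have "g (cls (x, t)) \<in> cls ` (C \<times> f ` J)"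
        using CJ(5) that by (auto simp: chart_domain_def)
      then have "cls (inv_into (C \<times> f ` J) cls (g (cls (x, t)))) = g (cls (x, t))"
        by (rule f_inv_into_f)
      then show ?thesis using CJ(6) that by simp
    qed
    obtain x' t' where x't': "x' \<in> C" "t' \<in> J" "cls (x0, t0) = cls (x', t')"
      using CJ(2) by (auto simp: chart_domain_def)
    then obtain n where n: "x' = it n x0" "t' = t0 - of_int n"
      using cls_eq_iff[OF x0 subsetD[OF CX(1) x't'(1)]] by auto
    let ?C = "{x \<in> topspace X. it n x \<in> C}"
    let ?f = "\<lambda>t. f (t + - of_int n) + of_int n"
    have "openin X ?C" by (rule openin_continuous_map_preimage[OF it_cont Co])
    moreover have "x0 \<in> ?C" using x0 x't' n by simp
    moreover have "dgerm ?f t0"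
    proof (rule dgerm_comp[where g = "\<lambda>s. s + of_int n"])
      show "dgerm (\<lambda>t. f (t + - of_int n)) t0"
      proof (rule dgerm_comp[where f = "\<lambda>t. t + - of_int n"])
        show "dgerm (\<lambda>t. t + - of_int n) t0" by (rule dgerm_shift) (auto intro: dyadic_minus)
        show "dgerm f (t0 + - of_int n)"
          using dyadic_PL_homeo_dgerm[OF CJ(3) CX(2)] x't'(2) n(2) by simp
      qed
    qed (simp add: dgerm_shift)
    moreover have "\<forall>\<^sub>F t in nhds t0. \<forall>x\<in>?C. g (cls (x, t)) = cls (x, ?f t)"
    proof -
      have "\<forall>\<^sub>F t in nhds t0. t + - of_int n \<in> J"
      proof (rule eventually_nhds_comp[where f = "\<lambda>t. t + - of_int n"])
        show "\<forall>\<^sub>F t in nhds (t0 + - of_int n). t \<in> J" using CX(2) x't'(2) n(2) by (intro eventually_nhds_in_open) auto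
      qed (intro continuous_intros)
      then show ?thesis
      proof eventually_elim
        case (elim t)
        show ?case
        proof
          fix x assume x: "x \<in> ?C"
          then have "g (cls (x, t)) = g (cls (it n x, t + - of_int n))" using cls_it[of x n t] by simp
          also have "\<dots> = cls (it n x, f (t + - of_int n))" using gf x elim by blast
          also have "\<dots> = cls (x, ?f t)" using cls_it' x by blast
          finally show "g (cls (x, t)) = cls (x, ?f t)" .
        qed
      qed
    qed
    ultimately show ?thesis by blast
  qed
  then have "local_form g" unfolding local_form_def by simp
  then show "g \<in> H0 X \<phi> \<and> local_form g" using g unfolding T_set_chart_form by simp
next
  assume g: "g \<in> H0 X \<phi> \<and> local_form g"
  have "\<exists>C J f. chart_form g y C J f" if y: "y \<in> topspace Y" for y
  proof -
    obtain x0 t0 where xt: "x0 \<in> topspace X" "y = cls (x0, t0)" using y Y_cases by blast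
    have "local_form g" using g by simp
    from this xt(1) obtain U f where U: "openin X U" "x0 \<in> U" "U \<subseteq> topspace X" "dgerm f t0"
      "\<forall>\<^sub>F t in nhds t0. \<forall>x\<in>U. g (cls (x, t)) = cls (x, f t)" by (rule local_formE)
    obtain C where C: "openin X C" "closedin X C" "x0 \<in> C" "C \<subseteq> U" using clopen_basis U by blast
    obtain a b a' b' where ab: "dyadic a" "dyadic b" "dyadic a'" "dyadic b'" "a < t0" "t0 < b" "b - a < 1" "a' < b'" "b' - a' < 1"
      "dyadic_PL_homeo {a<..<b} {a'<..<b'} f" "f ` {a<..<b} = {a'<..<b'}"
      "\<forall>t\<in>{a<..<b}. \<forall>x\<in>U. g (cls (x, t)) = cls (x, f t)"
      by (rule dgerm_PL_homeo[OF U(4,5)])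
    let ?J = "{a<..<b}"
    have ch: "is_chart X \<phi> C ?J" "is_chart X \<phi> C (f ` ?J)"
      unfolding ab(11) using C ab by (auto intro!: is_chart_short)
    have gf: "g (cls (x, t)) = cls (x, f t)" if "x \<in> C" "t \<in> ?J" for x t using ab(12) C that by blast
    have "g ` chart_domain X \<phi> C ?J = chart_domain X \<phi> C (f ` ?J)"
    proof -
      have "g ` chart_domain X \<phi> C ?J = (\<lambda>(x, t). g (cls (x, t))) ` (C \<times> ?J)"
        unfolding chart_domain_def image_image by (simp add: case_prod_unfold)
      also have "\<dots> = (\<lambda>(x, t). cls (x, f t)) ` (C \<times> ?J)" using gf by (intro image_cong) auto
      also have "\<dots> = chart_domain X \<phi> C (f ` ?J)" unfolding chart_domain_def by (auto simp: image_iff)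
      finally show ?thesis .
    qed
    moreover have "inv_into (C \<times> f ` ?J) cls (g (cls (x, t))) = (x, f t)" if "x \<in> C" "t \<in> ?J" for x t
      unfolding gf[OF that] by (rule inv_into_f_f[OF inj_on_chart[OF bij ch(2)]]) (use that in auto)
    moreover have "y \<in> chart_domain X \<phi> C ?J" using xt C ab by (auto simp: chart_domain_def)
    moreover have "dyadic_interval ?J" using ab(10) by (simp add: dyadic_PL_homeo_def)
    ultimately have "chart_form g y C ?J f"
      unfolding chart_form_def using ch ab(10,11) by simp
    then show ?thesis by blast
  qed
  then show "g \<in> T_set X \<phi>" using g unfolding T_set_chart_form by simp
qed

section \<open>The group structure of \<open>T_set\<close>\<close>

abbreviation "SY \<equiv> topspace Y"

lemma H0_homeo: "g \<in> H0 X \<phi> \<Longrightarrow> homeomorphic_map Y Y g"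
  unfolding H0_def using homotopic_with_imp_property by blast

lemma H0_Bij: "g \<in> H0 X \<phi> \<Longrightarrow> g \<in> Bij SY"
  by (simp add: H0_def)

text \<open>The isotopy from the identity to \<open>g\<close>, composed with \<open>h\<close> on the
  right, runs from \<open>h\<close> to the product and is appended to the isotopy of
  \<open>h\<close>.\<close>

lemma H0_compose: assumes g: "g \<in> H0 X \<phi>" and h: "h \<in> H0 X \<phi>" shows "compose SY g h \<in> H0 X \<phi>"
proof -
  let ?P = "homeomorphic_map Y Y"
  have hg: "homotopic_with ?P Y Y id g" "homotopic_with ?P Y Y id h" using g h by (auto simp: H0_def)
  have "homotopic_with ?P Y Y (id \<circ> h) (g \<circ> h)"
    using homotopic_with_compose_continuous_map_right[OF hg(1) homeomorphic_imp_continuous_map[OF H0_homeo[OF h]], of ?P]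
      homeomorphic_map_compose[OF H0_homeo[OF h]] by blast
  then have "homotopic_with ?P Y Y id (g \<circ> h)" using hg(2) homotopic_with_trans by fastforce
  then have "homotopic_with ?P Y Y id (compose SY g h)"
    by (rule homotopic_with_eq) (auto simp: compose_def intro: homeomorphic_map_eq)
  then show ?thesis using compose_Bij[OF H0_Bij[OF g] H0_Bij[OF h]] by (simp add: H0_def)
qed

text \<open>Composing the isotopy of \<open>g\<close> with the inverse of \<open>g\<close> on the
  right gives an isotopy from that inverse to the identity.\<close>

lemma H0_inv: assumes g: "g \<in> H0 X \<phi>" shows "restrict (inv_into SY g) SY \<in> H0 X \<phi>"
proof -
  let ?P = "homeomorphic_map Y Y"
  let ?k = "restrict (inv_into SY g) SY"
  have hg: "homotopic_with ?P Y Y id g" using g by (auto simp: H0_def)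
  have bg: "bij_betw g SY SY" using H0_Bij[OF g] by (simp add: Bij_def)
  obtain g' where g': "homeomorphic_maps Y Y g g'" using H0_homeo[OF g] homeomorphic_map_maps by blast
  have kg': "?k y = g' y" if "y \<in> SY" for y
  proof -
    have "g (g' y) = y" "g' y \<in> SY" using g' that by (auto simp: homeomorphic_maps_def continuous_map_def)
    then show ?thesis using that bg by (metis bij_betw_def inv_into_f_f restrict_apply')
  qed
  have k: "?P ?k" using homeomorphic_map_eq[of Y Y g' ?k] kg' g' homeomorphic_maps_map by metis
  have "homotopic_with ?P Y Y (id \<circ> ?k) (g \<circ> ?k)"
    using homotopic_with_compose_continuous_map_right[OF hg homeomorphic_imp_continuous_map[OF k], of ?P]
      homeomorphic_map_compose[OF k] by blast
  then have "homotopic_with ?P Y Y ?k id"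
  proof (rule homotopic_with_eq)
    fix y assume "y \<in> SY"
    then show "id y = (g \<circ> ?k) y" using bg by (simp add: bij_betw_inv_into_right)
  qed (auto intro: homeomorphic_map_eq)
  then have "homotopic_with ?P Y Y id ?k" using homotopic_with_sym by blast
  then show ?thesis using restrict_inv_into_Bij[OF H0_Bij[OF g]] by (simp add: H0_def)
qed

lemma local_form_compose:
  assumes g: "local_form g" and h: "local_form h"
  shows "local_form (compose SY g h)"
  unfolding local_form_def
proof (intro ballI allI)
  fix x0 t0 assume x0: "x0 \<in> topspace X"
  obtain C f where C: "openin X C" "x0 \<in> C" "C \<subseteq> topspace X" "dgerm f t0"
    "\<forall>\<^sub>F t in nhds t0. \<forall>x\<in>C. h (cls (x, t)) = cls (x, f t)" by (rule local_formE[OF h x0])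
  obtain C' f' where C': "openin X C'" "x0 \<in> C'" "C' \<subseteq> topspace X" "dgerm f' (f t0)"
    "\<forall>\<^sub>F t in nhds (f t0). \<forall>x\<in>C'. g (cls (x, t)) = cls (x, f' t)" by (rule local_formE[OF g x0])
  have "\<forall>\<^sub>F t in nhds t0. \<forall>x\<in>C'. g (cls (x, f t)) = cls (x, f' (f t))"
    by (rule eventually_nhds_comp[OF dgerm_isCont[OF C(4)] C'(5)])
  with C(5) have "\<forall>\<^sub>F t in nhds t0. \<forall>x\<in>C \<inter> C'. compose SY g h (cls (x, t)) = cls (x, f' (f t))"
    by eventually_elim (use C(3) in \<open>auto simp: compose_def\<close>)
  moreover have "openin X (C \<inter> C')" "x0 \<in> C \<inter> C'" using C C' by auto
  moreover have "dgerm (\<lambda>t. f' (f t)) t0" using dgerm_comp C(4) C'(4) by blast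
  ultimately show "\<exists>C f. openin X C \<and> x0 \<in> C \<and> dgerm f t0 \<and>
     (\<forall>\<^sub>F t in nhds t0. \<forall>x\<in>C. compose SY g h (cls (x, t)) = cls (x, f t))" by blast
qed

text \<open>The image of a representative of the preimage point matches the given representative
  only up to an integer \<open>n\<close>, so the inverse germ is conjugated by the translation by
  \<open>n\<close>.\<close>

lemma local_form_inv:
  assumes g: "local_form g" and b: "bij_betw g SY SY"
  shows "local_form (restrict (inv_into SY g) SY)"
  unfolding local_form_def
proof (intro ballI allI)
  fix x0 t0 assume x0: "x0 \<in> topspace X"
  let ?k = "restrict (inv_into SY g) SY"
  obtain x1 t1 where x1: "x1 \<in> topspace X" "g (cls (x1, t1)) = cls (x0, t0)"
  proof -
    obtain y where "y \<in> SY" "g y = cls (x0, t0)"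
      using b cls_in[OF x0, of t0] unfolding bij_betw_def by (metis imageE)
    then show ?thesis using that Y_cases[of y thesis] by blast
  qed
  obtain C f where C: "openin X C" "x1 \<in> C" "C \<subseteq> topspace X" "dgerm f t1"
    "\<forall>\<^sub>F t in nhds t1. \<forall>x\<in>C. g (cls (x, t)) = cls (x, f t)" by (rule local_formE[OF g x1(1)])
  have "cls (x0, t0) = cls (x1, f t1)" using eventually_nhds_x_imp_x[OF C(5)] C(2) x1(2) by auto
  then obtain n where n: "x1 = it n x0" "f t1 = t0 - of_int n" using cls_eq_iff[OF x0 x1(1)] by auto
  obtain f' where f': "dgerm f' (f t1)" "f' (f t1) = t1" "\<forall>\<^sub>F s in nhds (f t1). f (f' s) = s"
    by (rule dgerm_inverse_ex[OF C(4)])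
  let ?C = "{x \<in> topspace X. it n x \<in> C}"
  let ?f = "\<lambda>t. f' (t + - of_int n) + of_int n"
  have sh: "dgerm (\<lambda>t. t + - of_int n) t0" by (rule dgerm_shift) (auto intro: dyadic_minus)
  have "dgerm (\<lambda>t. f' (t + - of_int n)) t0"
    by (rule dgerm_comp[OF sh]) (use f'(1) n(2) in simp)
  then have "dgerm ?f t0" using dgerm_comp[OF _ dgerm_shift[OF dyadic_of_int]] by blast
  moreover have "openin X ?C" by (rule openin_continuous_map_preimage[OF it_cont C(1)])
  moreover have "x0 \<in> ?C" using x0 C n by simp
  moreover have "\<forall>\<^sub>F t in nhds t0. \<forall>x\<in>?C. ?k (cls (x, t)) = cls (x, ?f t)"
  proof -
    have "\<forall>\<^sub>F s in nhds (f t1). \<forall>x\<in>C. g (cls (x, f' s)) = cls (x, f (f' s))"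
      by (rule eventually_nhds_comp[OF dgerm_isCont[OF f'(1)]]) (use C(5) f'(2) in simp)
    with f'(3) have "\<forall>\<^sub>F s in nhds (f t1). \<forall>x\<in>C. g (cls (x, f' s)) = cls (x, s)"
      by eventually_elim simp
    then have "\<forall>\<^sub>F s in nhds (t0 + - of_int n). \<forall>x\<in>C. g (cls (x, f' s)) = cls (x, s)"
      using n(2) by simp
    from eventually_nhds_comp[OF dgerm_isCont[OF sh] this] show ?thesis
    proof eventually_elim
      case (elim t)
      show ?case
      proof
        fix x assume x: "x \<in> ?C"
        have "g (cls (x, ?f t)) = g (cls (it n x, f' (t + - of_int n)))" using cls_it' x by simp
        also have "\<dots> = cls (it n x, t + - of_int n)" using elim x by blast
        also have "\<dots> = cls (x, t)" using cls_it[of x n t] x by simp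
        finally show "?k (cls (x, t)) = cls (x, ?f t)"
          using b x by (metis (no_types, lifting) bij_betw_def cls_in inv_into_f_f mem_Collect_eq restrict_apply')
      qed
    qed
  qed
  ultimately show "\<exists>C f. openin X C \<and> x0 \<in> C \<and> dgerm f t0 \<and>
     (\<forall>\<^sub>F t in nhds t0. \<forall>x\<in>C. ?k (cls (x, t)) = cls (x, f t))" by blast
qed

lemma id_T_set: "(\<lambda>y\<in>SY. y) \<in> T_set X \<phi>"
proof -
  have "homotopic_with (homeomorphic_map Y Y) Y Y id id"
    by (simp add: homotopic_with_refl homeomorphic_map_id)
  then have "homotopic_with (homeomorphic_map Y Y) Y Y id (\<lambda>y\<in>SY. y)"
    by (rule homotopic_with_eq) (auto intro: homeomorphic_map_eq)
  then have "(\<lambda>y\<in>SY. y) \<in> H0 X \<phi>" using id_Bij by (simp add: H0_def)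
  moreover have "local_form (\<lambda>y\<in>SY. y)"
    unfolding local_form_def
  proof (intro ballI allI)
    fix x0 t0 assume x0: "x0 \<in> topspace X"
    have "\<forall>\<^sub>F t in nhds t0. \<forall>x\<in>topspace X. (\<lambda>y\<in>SY. y) (cls (x, t)) = cls (x, t)" by simp
    then show "\<exists>C f. openin X C \<and> x0 \<in> C \<and> dgerm f t0 \<and>
      (\<forall>\<^sub>F t in nhds t0. \<forall>x\<in>C. (\<lambda>y\<in>SY. y) (cls (x, t)) = cls (x, f t))"
      using x0 dgerm_id[of t0] by (intro exI[of _ "topspace X"] exI[of _ "\<lambda>t. t"]) auto
  qed
  ultimately show ?thesis by (simp add: T_set_iff)
qed

lemma T_subgroup: "subgroup (T_set X \<phi>) (BijGroup SY)"
proof (rule group.subgroupI[OF group_BijGroup])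
  show "T_set X \<phi> \<subseteq> carrier (BijGroup SY)" using H0_Bij T_set_iff by (auto simp: BijGroup_def)
  show "T_set X \<phi> \<noteq> {}" using id_T_set by blast
  fix g h assume g: "g \<in> T_set X \<phi>"
  then have gB: "g \<in> Bij SY" using H0_Bij T_set_iff by blast
  show "inv\<^bsub>BijGroup SY\<^esub> g \<in> T_set X \<phi>"
    unfolding inv_BijGroup[OF gB] using g gB H0_inv local_form_inv by (simp add: T_set_iff Bij_def)
  assume h: "h \<in> T_set X \<phi>"
  then have hB: "h \<in> Bij SY" using H0_Bij T_set_iff by blast
  have "g \<otimes>\<^bsub>BijGroup SY\<^esub> h = compose SY g h" using gB hB by (simp add: BijGroup_def)
  then show "g \<otimes>\<^bsub>BijGroup SY\<^esub> h \<in> T_set X \<phi>"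
    using g h H0_compose local_form_compose by (simp add: T_set_iff)
qed

lemma T_group: "group (T_group X \<phi>)"
  unfolding T_group_def using group.subgroup_imp_group[OF group_BijGroup T_subgroup] .

lemma T_carrier [simp]: "carrier (T_group X \<phi>) = T_set X \<phi>"
  by (simp add: T_group_def)

lemma T_mult:
  assumes "g \<in> T_set X \<phi>" "h \<in> T_set X \<phi>" shows "g \<otimes>\<^bsub>T_group X \<phi>\<^esub> h = compose SY g h"
  using assms H0_Bij by (simp add: T_group_def BijGroup_def T_set_iff)

lemma T_one: "\<one>\<^bsub>T_group X \<phi>\<^esub> = (\<lambda>y\<in>SY. y)"
  by (simp add: T_group_def BijGroup_def)

lemma T_homeo: "g \<in> T_set X \<phi> \<Longrightarrow> homeomorphic_map Y Y g"
  using H0_homeo T_set_iff by blast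

lemma T_ext: "g \<in> T_set X \<phi> \<Longrightarrow> g \<in> extensional SY"
  using H0_Bij T_set_iff Bij_imp_extensional by blast

end

section \<open>Reconstruction of a space from a group of homeomorphisms\<close>

definition commutes :: "('g, 'm) monoid_scheme \<Rightarrow> 'g \<Rightarrow> 'g \<Rightarrow> bool" where
  "commutes G g h \<longleftrightarrow> g \<otimes>\<^bsub>G\<^esub> h = h \<otimes>\<^bsub>G\<^esub> g"

definition commut :: "('g, 'm) monoid_scheme \<Rightarrow> 'g \<Rightarrow> 'g \<Rightarrow> 'g" where
  "commut G g h = g \<otimes>\<^bsub>G\<^esub> h \<otimes>\<^bsub>G\<^esub> (inv\<^bsub>G\<^esub> g \<otimes>\<^bsub>G\<^esub> inv\<^bsub>G\<^esub> h)"

text \<open>For groups of homeomorphisms: disjointness of \<open>supp f\<close> and \<open>supp g\<close> implies \<open>alg_disjoint G f g\<close>,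
  which in turn implies disjointness of \<open>supp f\<close> and \<open>supp (g\<^sup>1\<^sup>2)\<close>. The exponent is the least common
  multiple of \<open>1,\<dots>,4\<close>: a point moved by \<open>g\<^sup>1\<^sup>2\<close> has five distinct translates, whereas the support
  of \<open>[f1,[f2,h]]\<close> is covered by the four sets \<open>V\<close>, \<open>f1 V\<close>, \<open>f2 V\<close>, \<open>f1 f2 V\<close> if \<open>supp h \<subseteq> V\<close>.\<close>

definition alg_disjoint :: "('g, 'm) monoid_scheme \<Rightarrow> 'g \<Rightarrow> 'g \<Rightarrow> bool" where
  "alg_disjoint G f g \<longleftrightarrow> (\<forall>h\<in>carrier G. \<not> commutes G f h \<longrightarrow>
     (\<exists>f1\<in>carrier G. \<exists>f2\<in>carrier G. commutes G f1 g \<and> commutes G f2 g \<and>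
        commut G f1 (commut G f2 h) \<noteq> \<one>\<^bsub>G\<^esub> \<and> commutes G (commut G f1 (commut G f2 h)) g))"

text \<open>For the actions in \<open>rubin_action\<close> this is the rigid stabilizer of the
  regular open set spanned by \<open>supp f\<close>, see \<open>alg_rist_iff\<close>. The twelfth
  power compensates for the gap between \<open>alg_disjoint\<close> and disjointness of
  supports.\<close>

definition alg_rist :: "('g, 'm) monoid_scheme \<Rightarrow> 'g \<Rightarrow> 'g set" where
  "alg_rist G f = {h \<in> carrier G. \<forall>g\<in>carrier G. alg_disjoint G f g \<longrightarrow> commutes G h (g [^]\<^bsub>G\<^esub> (12::nat))}"

text \<open>Unlike \<open>alg_disjoint\<close>, this describes disjointness of supports exactly, see
  \<open>rist_disjoint_iff\<close>.\<close>

definition rist_disjoint :: "('g, 'm) monoid_scheme \<Rightarrow> 'g \<Rightarrow> 'g \<Rightarrow> bool" where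
  "rist_disjoint G f g \<longleftrightarrow> (\<forall>h\<in>carrier G. h \<in> alg_rist G f \<and> h \<in> alg_rist G g \<longrightarrow> h = \<one>\<^bsub>G\<^esub>)"

text \<open>Group-theoretic form of \<open>csupp f \<subseteq> isupp g\<close>, see
  \<open>well_inside_iff\<close>. The last clause only says that the supports of \<open>K\<close>
  are dense in \<open>supp f\<close>; since \<open>K\<close> is finite, their closures then cover
  \<open>csupp f\<close>.\<close>

definition well_inside :: "('g, 'm) monoid_scheme \<Rightarrow> 'g \<Rightarrow> 'g \<Rightarrow> bool" where
  "well_inside G f g \<longleftrightarrow> (\<exists>K. finite K \<and> K \<subseteq> carrier G \<and>
     (\<forall>k\<in>K. \<exists>r\<in>carrier G. r \<in> alg_rist G g \<and> rist_disjoint G (r \<otimes>\<^bsub>G\<^esub> k \<otimes>\<^bsub>G\<^esub> inv\<^bsub>G\<^esub> r) k) \<and>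
     (\<forall>h\<in>carrier G. h \<noteq> \<one>\<^bsub>G\<^esub> \<and> h \<in> alg_rist G f \<longrightarrow> (\<exists>k\<in>K. \<not> rist_disjoint G h k)))"

section \<open>Invariance of these relations under group isomorphisms\<close>

locale group_iso =
  G: group G + H: group H for G (structure) and H (structure) +
  fixes \<theta>
  assumes iso: "\<theta> \<in> iso G H"
begin

lemma iso_hom: "\<theta> \<in> hom G H" using iso by (simp add: iso_def)

lemma gh: "group_hom G H \<theta>"
  by (simp add: group_hom_def group_hom_axioms_def iso_hom G.is_group H.is_group)

lemma bij: "bij_betw \<theta> (carrier G) (carrier H)" using iso by (simp add: iso_def)

lemma closed [simp]: "g \<in> carrier G \<Longrightarrow> \<theta> g \<in> carrier H" using bij bij_betwE by metis

lemma inj [simp]: "g \<in> carrier G \<Longrightarrow> h \<in> carrier G \<Longrightarrow> \<theta> g = \<theta> h \<longleftrightarrow> g = h"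
  using bij by (meson bij_betw_def inj_on_eq_iff)

lemma ball_iff: "(\<forall>h\<in>carrier H. P h) \<longleftrightarrow> (\<forall>g\<in>carrier G. P (\<theta> g))"
  using bij unfolding bij_betw_def by (metis imageE imageI)

lemma bex_iff: "(\<exists>h\<in>carrier H. P h) \<longleftrightarrow> (\<exists>g\<in>carrier G. P (\<theta> g))"
  using ball_iff[of "\<lambda>h. \<not> P h"] by blast

lemmas hom_simps = group_hom.hom_mult[OF gh] group_hom.hom_inv[OF gh] group_hom.hom_one[OF gh] group_hom.hom_nat_pow[OF gh]

lemma one_iff: "g \<in> carrier G \<Longrightarrow> \<theta> g = \<one>\<^bsub>H\<^esub> \<longleftrightarrow> g = \<one>\<^bsub>G\<^esub>"
  using inj[of g "\<one>\<^bsub>G\<^esub>"] by (simp add: hom_simps)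

lemma commut_closed: "g \<in> carrier G \<Longrightarrow> h \<in> carrier G \<Longrightarrow> commut G g h \<in> carrier G"
  by (simp add: commut_def)

lemma commut_iso: "g \<in> carrier G \<Longrightarrow> h \<in> carrier G \<Longrightarrow> commut H (\<theta> g) (\<theta> h) = \<theta> (commut G g h)"
  by (simp add: commut_def hom_simps)

lemma commutes_iso: "g \<in> carrier G \<Longrightarrow> h \<in> carrier G \<Longrightarrow> commutes H (\<theta> g) (\<theta> h) \<longleftrightarrow> commutes G g h"
  unfolding commutes_def using inj[of "g \<otimes>\<^bsub>G\<^esub> h" "h \<otimes>\<^bsub>G\<^esub> g"] by (simp add: hom_simps)

lemma alg_disjoint_iso:
  "f \<in> carrier G \<Longrightarrow> g \<in> carrier G \<Longrightarrow> alg_disjoint H (\<theta> f) (\<theta> g) \<longleftrightarrow> alg_disjoint G f g"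
  unfolding alg_disjoint_def ball_iff bex_iff
  by (simp add: commutes_iso commut_iso commut_closed one_iff cong: ball_cong bex_cong)

lemma alg_rist_iso:
  "f \<in> carrier G \<Longrightarrow> h \<in> carrier G \<Longrightarrow> \<theta> h \<in> alg_rist H (\<theta> f) \<longleftrightarrow> h \<in> alg_rist G f"
  unfolding alg_rist_def mem_Collect_eq ball_iff
  by (simp add: commutes_iso alg_disjoint_iso hom_simps(4)[symmetric] cong: ball_cong)

lemma rist_disjoint_iso:
  "f \<in> carrier G \<Longrightarrow> g \<in> carrier G \<Longrightarrow> rist_disjoint H (\<theta> f) (\<theta> g) \<longleftrightarrow> rist_disjoint G f g"
  unfolding rist_disjoint_def ball_iff
  by (simp add: alg_rist_iso one_iff cong: ball_cong)

lemma well_inside_iso: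
  assumes "f \<in> carrier G" "g \<in> carrier G"
  shows "well_inside H (\<theta> f) (\<theta> g) \<longleftrightarrow> well_inside G f g"
proof -
  let ?P = "\<lambda>M f g K. (\<forall>k\<in>K. \<exists>r\<in>carrier M. r \<in> alg_rist M g \<and> rist_disjoint M (r \<otimes>\<^bsub>M\<^esub> k \<otimes>\<^bsub>M\<^esub> inv\<^bsub>M\<^esub> r) k) \<and>
     (\<forall>h\<in>carrier M. h \<noteq> \<one>\<^bsub>M\<^esub> \<and> h \<in> alg_rist M f \<longrightarrow> (\<exists>k\<in>K. \<not> rist_disjoint M h k))"
  have conj: "rist_disjoint H (\<theta> r \<otimes>\<^bsub>H\<^esub> \<theta> k \<otimes>\<^bsub>H\<^esub> inv\<^bsub>H\<^esub> (\<theta> r)) (\<theta> k) \<longleftrightarrow>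
      rist_disjoint G (r \<otimes>\<^bsub>G\<^esub> k \<otimes>\<^bsub>G\<^esub> inv\<^bsub>G\<^esub> r) k" if "r \<in> carrier G" "k \<in> carrier G" for r k
    using rist_disjoint_iso[of "r \<otimes>\<^bsub>G\<^esub> k \<otimes>\<^bsub>G\<^esub> inv\<^bsub>G\<^esub> r" k] that by (simp add: hom_simps)
  have P: "?P H (\<theta> f) (\<theta> g) (\<theta> ` K) \<longleftrightarrow> ?P G f g K" if "K \<subseteq> carrier G" for K
  proof -
    have k: "k \<in> carrier G" if "k \<in> K" for k using that \<open>K \<subseteq> carrier G\<close> by blast
    show ?thesis
      unfolding ball_iff bex_iff ball_simps bex_simps
      using assms k by (simp add: conj alg_rist_iso rist_disjoint_iso one_iff cong: ball_cong bex_cong)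
  qed
  have "well_inside H (\<theta> f) (\<theta> g) \<longleftrightarrow> (\<exists>K. finite K \<and> K \<subseteq> carrier G \<and> ?P H (\<theta> f) (\<theta> g) (\<theta> ` K))"
  proof
    assume "well_inside H (\<theta> f) (\<theta> g)"
    then obtain L where L: "finite L" "L \<subseteq> carrier H" "?P H (\<theta> f) (\<theta> g) L" unfolding well_inside_def by auto
    then obtain K where K: "K \<subseteq> carrier G" "finite K" "L = \<theta> ` K"
      using bij unfolding bij_betw_def by (metis finite_subset_image)
    show "\<exists>K. finite K \<and> K \<subseteq> carrier G \<and> ?P H (\<theta> f) (\<theta> g) (\<theta> ` K)"
      by (rule exI[of _ K]) (use K L(3) in blast)
  next
    assume "\<exists>K. finite K \<and> K \<subseteq> carrier G \<and> ?P H (\<theta> f) (\<theta> g) (\<theta> ` K)"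
    then obtain K where K: "finite K" "K \<subseteq> carrier G" "?P H (\<theta> f) (\<theta> g) (\<theta> ` K)" by blast
    then have "finite (\<theta> ` K)" "\<theta> ` K \<subseteq> carrier H" by auto
    with K(3) show "well_inside H (\<theta> f) (\<theta> g)" unfolding well_inside_def by blast
  qed
  also have "\<dots> \<longleftrightarrow> well_inside G f g" unfolding well_inside_def by (rule ex_cong1, rule conj_cong[OF refl], rule conj_cong[OF refl]) (rule P)
  finally show ?thesis .
qed

end

text \<open>The last two axioms replace Rubin's local density. For \<open>T_group\<close>, a support near a point \<open>y\<close> of its
  closure contains one side of \<open>y\<close> on the flow line, so no element fixing \<open>y\<close> can displace it.\<close>

locale rubin_action = group G for G (structure) +
  fixes Y :: "'y topology" and act :: "'g \<Rightarrow> 'y \<Rightarrow> 'y"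
  assumes compact: "compact_space Y" and haus: "Hausdorff_space Y"
    and homeo: "g \<in> carrier G \<Longrightarrow> homeomorphic_map Y Y (act g)"
    and act_mult: "g \<in> carrier G \<Longrightarrow> h \<in> carrier G \<Longrightarrow> y \<in> topspace Y \<Longrightarrow> act (g \<otimes> h) y = act g (act h y)"
    and faithful: "g \<in> carrier G \<Longrightarrow> (\<And>y. y \<in> topspace Y \<Longrightarrow> act g y = y) \<Longrightarrow> g = \<one>"
    and micro: "openin Y U \<Longrightarrow> U \<noteq> {} \<Longrightarrow>
      \<exists>g\<in>carrier G. {y \<in> topspace Y. act g y \<noteq> y} \<subseteq> U \<and> g [^] (12::nat) \<noteq> \<one>"
    and fixed_not_displaced: "k \<in> carrier G \<Longrightarrow> r \<in> carrier G \<Longrightarrow>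
      y \<in> Y closure_of {y \<in> topspace Y. act k y \<noteq> y} \<Longrightarrow> act r y = y \<Longrightarrow>
      \<exists>z\<in>topspace Y. act k z \<noteq> z \<and> act k (act r z) \<noteq> act r z"
    and displaceable: "openin Y U \<Longrightarrow> y \<in> U \<Longrightarrow> \<exists>k\<in>carrier G. \<exists>r\<in>carrier G.
      act k y \<noteq> y \<and> {y \<in> topspace Y. act r y \<noteq> y} \<subseteq> U \<and>
      (\<forall>z\<in>topspace Y. act k z \<noteq> z \<longrightarrow> act k (act r z) = act r z)"
begin

section \<open>Supports and commutation in a group of homeomorphisms\<close>

definition supp :: "'g \<Rightarrow> 'y set" where "supp g = {y \<in> topspace Y. act g y \<noteq> y}"

definition csupp :: "'g \<Rightarrow> 'y set" where "csupp g = Y closure_of supp g"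

definition isupp :: "'g \<Rightarrow> 'y set" where "isupp g = Y interior_of csupp g"

lemma act_in [simp]: "g \<in> carrier G \<Longrightarrow> y \<in> topspace Y \<Longrightarrow> act g y \<in> topspace Y"
  using homeomorphic_imp_surjective_map[OF homeo] by blast

lemma act_cont: "g \<in> carrier G \<Longrightarrow> continuous_map Y Y (act g)"
  using homeo homeomorphic_imp_continuous_map by blast

lemma act_inj: "g \<in> carrier G \<Longrightarrow> y \<in> topspace Y \<Longrightarrow> z \<in> topspace Y \<Longrightarrow> act g y = act g z \<longleftrightarrow> y = z"
  using homeo homeomorphic_imp_injective_map by (metis inj_onD)

lemma act_one [simp]: "y \<in> topspace Y \<Longrightarrow> act \<one> y = y"
  using act_mult[of \<one> \<one> y] act_inj[of \<one> "act \<one> y" y] by simp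

lemma act_inv [simp]:
  assumes "g \<in> carrier G" "y \<in> topspace Y"
  shows "act g (act (inv g) y) = y" "act (inv g) (act g y) = y"
  using act_mult[of g "inv g" y] act_mult[of "inv g" g y] assms by simp_all

lemma act_pow: "g \<in> carrier G \<Longrightarrow> y \<in> topspace Y \<Longrightarrow> act (g [^] (n::nat)) y = (act g ^^ n) y"
proof (induction n arbitrary: y)
  case (Suc n)
  then show ?case using Suc.IH[of "act g y"] by (simp add: act_mult funpow_swap1)
qed simp

lemma act_eqI: "g \<in> carrier G \<Longrightarrow> h \<in> carrier G \<Longrightarrow> (\<And>y. y \<in> topspace Y \<Longrightarrow> act g y = act h y) \<Longrightarrow> g = h"
proof -
  assume g: "g \<in> carrier G" and h: "h \<in> carrier G" and eq: "\<And>y. y \<in> topspace Y \<Longrightarrow> act g y = act h y"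
  have "inv g \<otimes> h = \<one>"
  proof (rule faithful)
    fix y assume y: "y \<in> topspace Y"
    then show "act (inv g \<otimes> h) y = y" using g h eq[OF y, symmetric] by (simp add: act_mult)
  qed (use g h in simp)
  then show ?thesis using g h by (metis inv_equality inv_inv inv_closed)
qed

lemma supp_sub: "supp g \<subseteq> topspace Y" by (auto simp: supp_def)

lemma supp_open: assumes "g \<in> carrier G" shows "openin Y (supp g)"
proof -
  have "closedin Y {y \<in> topspace Y. act g y = y}"
    using closedin_continuous_maps_eq[OF haus act_cont[OF assms] continuous_map_id] by simp
  moreover have "supp g = topspace Y - {y \<in> topspace Y. act g y = y}" by (auto simp: supp_def)
  ultimately show ?thesis using openin_diff[OF openin_topspace] by simp
qed

lemma supp_act: "g \<in> carrier G \<Longrightarrow> y \<in> supp g \<Longrightarrow> act g y \<in> supp g"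
  using act_inj[of g "act g y" y] by (auto simp: supp_def)

lemma not_supp: "y \<in> topspace Y \<Longrightarrow> y \<notin> supp g \<Longrightarrow> act g y = y"
  by (simp add: supp_def)

lemma supp_ne: "g \<in> carrier G \<Longrightarrow> g \<noteq> \<one> \<Longrightarrow> supp g \<noteq> {}"
  using faithful unfolding supp_def by blast

lemma supp_pow: "g \<in> carrier G \<Longrightarrow> supp (g [^] (n::nat)) \<subseteq> supp g"
proof
  fix y assume g: "g \<in> carrier G" and y: "y \<in> supp (g [^] n)"
  have "(act g ^^ n) y = y" if "act g y = y" using that by (induction n) auto
  then show "y \<in> supp g" using g y act_pow[of g y n] by (auto simp: supp_def)
qed

lemma disjoint_commutes:
  assumes "f \<in> carrier G" "g \<in> carrier G" "supp f \<inter> supp g = {}" shows "commutes G f g"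
  unfolding commutes_def
proof (rule act_eqI)
  fix y assume y: "y \<in> topspace Y"
  consider "y \<in> supp f" | "y \<in> supp g" | "y \<notin> supp f" "y \<notin> supp g" by blast
  then show "act (f \<otimes> g) y = act (g \<otimes> f) y"
  proof cases
    case 1
    then have "act g y = y" "act g (act f y) = act f y"
      using supp_act[OF assms(1) 1] assms 1 y not_supp[of y g] not_supp[of "act f y" g] by auto
    then show ?thesis using assms y by (simp add: act_mult)
  next
    case 2
    then have "act f y = y" "act f (act g y) = act g y"
      using supp_act[OF assms(2) 2] assms 2 y not_supp[of y f] not_supp[of "act g y" f] by auto
    then show ?thesis using assms y by (simp add: act_mult)
  next
    case 3
    then have "act f y = y" "act g y = y" using y by (auto simp: supp_def)
    then show ?thesis using assms y by (simp add: act_mult)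
  qed
qed (use assms in auto)

lemma displace:
  assumes g: "g \<in> carrier G" and U: "openin Y U" "x \<in> U" and ne: "act g x \<noteq> x"
  obtains V where "openin Y V" "x \<in> V" "V \<subseteq> U" "\<And>v. v \<in> V \<Longrightarrow> act g v \<notin> V"
proof -
  have x: "x \<in> topspace Y" using U openin_subset by blast
  then obtain A B where AB: "openin Y A" "openin Y B" "act g x \<in> A" "x \<in> B" "disjnt A B"
    using haus ne act_in[OF g x] unfolding Hausdorff_space_def by metis
  let ?V = "U \<inter> B \<inter> {y \<in> topspace Y. act g y \<in> A}"
  have "openin Y ?V" using U AB openin_continuous_map_preimage[OF act_cont[OF g] AB(1)] by blast
  moreover have "x \<in> ?V" using U AB x by auto
  moreover have "act g v \<notin> ?V" if "v \<in> ?V" for v using that AB by (auto simp: disjnt_iff)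
  ultimately show ?thesis using that[of ?V] by blast
qed

text \<open>Commuting elements preserve each other's supports, whereas \<open>f\<close> moves
  \<open>supp h\<close> off itself.\<close>

lemma not_commutes:
  assumes f: "f \<in> carrier G" and h: "h \<in> carrier G" "h \<noteq> \<one>" "supp h \<subseteq> V"
    and V: "\<And>v. v \<in> V \<Longrightarrow> act f v \<notin> V"
  shows "\<not> commutes G f h"
proof
  assume c: "commutes G f h"
  obtain v where v: "v \<in> supp h" using supp_ne[OF h(1,2)] by blast
  then have vY: "v \<in> topspace Y" using supp_sub by blast
  have "act f v \<notin> supp h" using V h(3) v by blast
  then have "act h (act f v) = act f v" using f vY by (auto simp: supp_def)
  then have "act f (act h v) = act f v"
    using c f h(1) vY act_mult[of f h v] act_mult[of h f v] by (simp add: commutes_def)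
  then have "act h v = v" using act_inj f h vY by auto
  then show False using v by (simp add: supp_def)
qed

lemma micro': assumes "openin Y U" "U \<noteq> {}"
  obtains g where "g \<in> carrier G" "supp g \<subseteq> U" "g [^] (12::nat) \<noteq> \<one>" "g \<noteq> \<one>"
proof -
  obtain g where g: "g \<in> carrier G" "supp g \<subseteq> U" "g [^] (12::nat) \<noteq> \<one>"
    using micro[OF assms] unfolding supp_def by blast
  then have "g \<noteq> \<one>" by auto
  with g show ?thesis using that by blast
qed

lemma noncommuting_pair:
  assumes "openin Y U" "U \<noteq> {}"
  obtains f1 f2 where "f1 \<in> carrier G" "f2 \<in> carrier G" "supp f1 \<subseteq> U" "supp f2 \<subseteq> U" "\<not> commutes G f1 f2"
proof -
  obtain f1 where f1: "f1 \<in> carrier G" "supp f1 \<subseteq> U" "f1 \<noteq> \<one>" using micro' assms by metis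
  then obtain x where x: "x \<in> supp f1" using supp_ne by blast
  then have "x \<in> U" "act f1 x \<noteq> x" using f1(2) by (auto simp: supp_def)
  from displace[OF f1(1) assms(1) this]
  obtain V where V: "openin Y V" "x \<in> V" "V \<subseteq> U" "\<And>v. v \<in> V \<Longrightarrow> act f1 v \<notin> V" by blast
  have "V \<noteq> {}" using V(2) by blast
  from micro'[OF V(1) this]
  obtain f2 where f2: "f2 \<in> carrier G" "supp f2 \<subseteq> V" "f2 \<noteq> \<one>" by blast
  have "\<not> commutes G f1 f2" using not_commutes[OF f1(1) f2(1,3,2) V(4)] by blast
  then show ?thesis using that f1 f2 V by blast
qed

lemma supp_conj:
  assumes "r \<in> carrier G" "k \<in> carrier G"
  shows "supp (r \<otimes> k \<otimes> inv r) = act r ` supp k"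
proof
  show "supp (r \<otimes> k \<otimes> inv r) \<subseteq> act r ` supp k"
  proof
    fix y assume y: "y \<in> supp (r \<otimes> k \<otimes> inv r)"
    then have yY: "y \<in> topspace Y" by (simp add: supp_def)
    have "act (inv r) y \<in> supp k"
      using y yY assms by (auto simp: supp_def act_mult)
    then show "y \<in> act r ` supp k" using assms yY by (metis act_inv(1) imageI)
  qed
  show "act r ` supp k \<subseteq> supp (r \<otimes> k \<otimes> inv r)"
    using assms act_inj by (auto simp: supp_def act_mult)
qed

lemma supp_inv: "g \<in> carrier G \<Longrightarrow> supp (inv g) = supp g"
proof -
  assume g: "g \<in> carrier G"
  have "act (inv g) y = y \<longleftrightarrow> act g y = y" if "y \<in> topspace Y" for y
    using act_inv[OF g that] by metis
  then show ?thesis by (auto simp: supp_def)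
qed

lemma supp_mult: "g \<in> carrier G \<Longrightarrow> h \<in> carrier G \<Longrightarrow> supp (g \<otimes> h) \<subseteq> supp g \<union> supp h"
  by (auto simp: supp_def act_mult)

section \<open>Commutators and algebraic disjointness\<close>

lemma commut_alt: "g \<in> carrier G \<Longrightarrow> h \<in> carrier G \<Longrightarrow> commut G g h = (g \<otimes> h \<otimes> inv g) \<otimes> inv h"
  by (simp add: commut_def m_assoc)

lemma supp_commut: "g \<in> carrier G \<Longrightarrow> h \<in> carrier G \<Longrightarrow> supp (commut G g h) \<subseteq> act g ` supp h \<union> supp h"
  using supp_mult[of "g \<otimes> h \<otimes> inv g" "inv h"] by (simp add: commut_alt supp_conj supp_inv)

lemma commut_one_iff:
  assumes "g \<in> carrier G" "h \<in> carrier G" shows "commut G g h = \<one> \<longleftrightarrow> commutes G g h"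
proof -
  have "commut G g h = (g \<otimes> h) \<otimes> inv (h \<otimes> g)" using assms by (simp add: commut_def inv_mult_group)
  then show ?thesis using assms
    by (metis commutes_def inv_equality inv_inv m_closed inv_closed r_inv)
qed

lemma commut_closed [simp]: "g \<in> carrier G \<Longrightarrow> h \<in> carrier G \<Longrightarrow> commut G g h \<in> carrier G"
  by (simp add: commut_def)

lemma commutes_sym: "commutes G g h \<longleftrightarrow> commutes G h g" by (auto simp: commutes_def)

lemma commutes_mult:
  assumes "a \<in> carrier G" "b \<in> carrier G" "g \<in> carrier G" "commutes G a g" "commutes G b g"
  shows "commutes G (a \<otimes> b) g"
  using assms unfolding commutes_def by (metis m_assoc)

lemma commutes_inv:
  assumes "a \<in> carrier G" "g \<in> carrier G" "commutes G a g" shows "commutes G (inv a) g"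
proof -
  have "inv a \<otimes> (g \<otimes> a) \<otimes> inv a = inv a \<otimes> (a \<otimes> g) \<otimes> inv a" using assms by (simp add: commutes_def)
  moreover have "inv a \<otimes> (g \<otimes> a) \<otimes> inv a = inv a \<otimes> g" using assms by (simp add: m_assoc)
  moreover have "inv a \<otimes> (a \<otimes> g) \<otimes> inv a = g \<otimes> inv a" using assms by (simp add: m_assoc[symmetric])
  ultimately show ?thesis by (simp add: commutes_def)
qed

lemma commutes_commut:
  assumes "a \<in> carrier G" "b \<in> carrier G" "g \<in> carrier G" "commutes G a g" "commutes G b g"
  shows "commutes G (commut G a b) g"
  unfolding commut_def using assms by (intro commutes_mult commutes_inv) auto

lemma commut_mult_commuting:
  assumes "a \<in> carrier G" "b \<in> carrier G" "p \<in> carrier G" "commutes G p a"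
  shows "commut G a (b \<otimes> p) = commut G a b"
proof -
  have "commutes G p (inv a)" using commutes_inv[of a p] assms commutes_sym by blast
  then have pa: "p \<otimes> inv a = inv a \<otimes> p" by (simp add: commutes_def)
  have "commut G a (b \<otimes> p) = a \<otimes> b \<otimes> (p \<otimes> inv a) \<otimes> (inv p \<otimes> inv b)"
    using assms by (simp add: commut_def inv_mult_group m_assoc)
  also have "\<dots> = a \<otimes> b \<otimes> inv a \<otimes> (p \<otimes> inv p) \<otimes> inv b"
    unfolding pa using assms by (simp only: m_assoc m_closed inv_closed)
  also have "\<dots> = commut G a b" using assms by (simp add: commut_def m_assoc)
  finally show ?thesis .
qed

text \<open>Take \<open>V\<close> inside \<open>supp f\<close> displaced by \<open>h\<close>, and
  \<open>f1\<close>, \<open>f2\<close> supported in \<open>V\<close> that do not commute. Then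
  \<open>[f2,h]\<close> is \<open>f2\<close> times a conjugate of its inverse supported in
  \<open>h V\<close>, which \<open>f1\<close> does not see. Hence
  \<open>[f1,[f2,h]] = [f1,f2]\<close>, which is nontrivial and commutes with
  \<open>g\<close>.\<close>

lemma disjoint_alg_disjoint:
  assumes f: "f \<in> carrier G" and g: "g \<in> carrier G" and dis: "supp f \<inter> supp g = {}"
  shows "alg_disjoint G f g"
  unfolding alg_disjoint_def
proof (intro ballI impI)
  fix h assume h: "h \<in> carrier G" and nc: "\<not> commutes G f h"
  then obtain x where x: "x \<in> supp f" "x \<in> supp h" using disjoint_commutes[OF f h] by blast
  have "act h x \<noteq> x" using x(2) by (simp add: supp_def)
  from displace[OF h supp_open[OF f] x(1) this]
  obtain V where V: "openin Y V" "x \<in> V" "V \<subseteq> supp f" "\<And>v. v \<in> V \<Longrightarrow> act h v \<notin> V" by blast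
  obtain f1 f2 where f12: "f1 \<in> carrier G" "f2 \<in> carrier G" "supp f1 \<subseteq> V" "supp f2 \<subseteq> V" "\<not> commutes G f1 f2"
    using noncommuting_pair[OF V(1)] V(2) by blast
  define p where "p = h \<otimes> inv f2 \<otimes> inv h"
  have p: "p \<in> carrier G" using h f12 by (simp add: p_def)
  have "supp p = act h ` supp f2" using supp_conj[OF h] f12 by (simp add: p_def supp_inv)
  then have "supp p \<inter> supp f1 = {}" using V(4) f12(3,4) by auto
  then have "commutes G p f1" using disjoint_commutes p f12 by blast
  then have "commut G f1 (f2 \<otimes> p) = commut G f1 f2" using commut_mult_commuting p f12 by blast
  moreover have "commut G f2 h = f2 \<otimes> p" using f12 h by (simp add: commut_def p_def m_assoc)
  ultimately have eq: "commut G f1 (commut G f2 h) = commut G f1 f2" by simp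
  have c: "commutes G f1 g" "commutes G f2 g" using disjoint_commutes f12 g dis V(3) by blast+
  have "commut G f1 (commut G f2 h) \<noteq> \<one>" using eq commut_one_iff f12 by simp
  moreover have "commutes G (commut G f1 (commut G f2 h)) g"
    unfolding eq using commutes_commut[OF f12(1,2) g c] .
  ultimately show "\<exists>f1\<in>carrier G. \<exists>f2\<in>carrier G. commutes G f1 g \<and> commutes G f2 g \<and>
        commut G f1 (commut G f2 h) \<noteq> \<one> \<and> commutes G (commut G f1 (commut G f2 h)) g"
    using c f12 by blast
qed

lemma act_commutes:
  assumes "commutes G a g" "a \<in> carrier G" "g \<in> carrier G" "y \<in> topspace Y"
  shows "act a (act g y) = act g (act a y)"
  using assms act_mult[of a g y] act_mult[of g a y] by (simp add: commutes_def)

text \<open>At a common point choose \<open>V\<close> displaced by \<open>f\<close> and by the first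
  four powers of \<open>g\<close>, and \<open>h\<close> supported in \<open>V\<close>. The double
  commutator \<open>k\<close> commutes with \<open>g\<close>, so its support contains five
  consecutive points of a \<open>g\<close>-orbit, and two of them lie in the same one of the four
  translates of \<open>V\<close>. The translating element commutes with \<open>g\<close>, so some
  power of \<open>g\<close> with exponent 1 to 4 takes a point of \<open>V\<close> into
  \<open>V\<close>.\<close>

lemma alg_disjoint_disjoint:
  assumes f: "f \<in> carrier G" and g: "g \<in> carrier G" and alg: "alg_disjoint G f g"
  shows "supp f \<inter> supp (g [^] (12::nat)) = {}"
proof (rule ccontr)
  assume "\<not> ?thesis"
  then obtain x where x: "x \<in> supp f" "x \<in> supp (g [^] (12::nat))" by blast
  have xY: "x \<in> topspace Y" and fx: "act f x \<noteq> x" using x by (auto simp: supp_def)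
  have move: "act (g [^] d) x \<noteq> x" if d: "d \<in> {1,2,3,4::nat}" for d
  proof
    assume eq: "act (g [^] d) x = x"
    obtain m where m: "12 = d * m" using d by (auto simp: dvd_def intro: that[of 12] that[of 6] that[of 4] that[of 3])
    have "(act (g [^] d) ^^ m) x = x" by (induction m) (use eq in auto)
    then have "act ((g [^] d) [^] m) x = x" using act_pow[of "g [^] d" x m] g xY by simp
    then have "act (g [^] (12::nat)) x = x" using g by (simp add: nat_pow_pow m)
    then show False using x(2) by (simp add: supp_def)
  qed
  obtain V0 where V0: "openin Y V0" "x \<in> V0" "V0 \<subseteq> topspace Y" "\<And>v. v \<in> V0 \<Longrightarrow> act f v \<notin> V0"
    using displace[OF f openin_topspace xY fx] by blast
  obtain V1 where V1: "openin Y V1" "x \<in> V1" "V1 \<subseteq> V0" "\<And>v. v \<in> V1 \<Longrightarrow> act (g [^] (1::nat)) v \<notin> V1"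
    using displace[of "g [^] (1::nat)", OF _ V0(1,2) move] g by blast
  obtain V2 where V2: "openin Y V2" "x \<in> V2" "V2 \<subseteq> V1" "\<And>v. v \<in> V2 \<Longrightarrow> act (g [^] (2::nat)) v \<notin> V2"
    using displace[of "g [^] (2::nat)", OF _ V1(1,2) move] g by blast
  obtain V3 where V3: "openin Y V3" "x \<in> V3" "V3 \<subseteq> V2" "\<And>v. v \<in> V3 \<Longrightarrow> act (g [^] (3::nat)) v \<notin> V3"
    using displace[of "g [^] (3::nat)", OF _ V2(1,2) move] g by blast
  obtain V where V: "openin Y V" "x \<in> V" "V \<subseteq> V3" "\<And>v. v \<in> V \<Longrightarrow> act (g [^] (4::nat)) v \<notin> V"
    using displace[of "g [^] (4::nat)", OF _ V3(1,2) move] g by blast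
  have Vd: "act (g [^] d) v \<notin> V" if "d \<in> {1,2,3,4::nat}" "v \<in> V" for d v
  proof -
    have v: "v \<in> V1" "v \<in> V2" "v \<in> V3" using that(2) V(3) V3(3) V2(3) by blast+
    have "act (g [^] (1::nat)) v \<notin> V" "act (g [^] (2::nat)) v \<notin> V" "act (g [^] (3::nat)) v \<notin> V"
      using V1(4)[OF v(1)] V2(4)[OF v(2)] V3(4)[OF v(3)] V(3) V3(3) V2(3) by blast+
    then show ?thesis using V(4)[OF that(2)] that(1) by auto
  qed
  have VY: "V \<subseteq> topspace Y" using V(1) openin_subset by blast
  obtain h where h: "h \<in> carrier G" "supp h \<subseteq> V" "h \<noteq> \<one>" using micro'[OF V(1)] V(2) by blast
  have "\<not> commutes G f h"
  proof (rule not_commutes[OF f h(1,3,2)])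
    fix v assume "v \<in> V"
    then have "v \<in> V0" "V \<subseteq> V0" using V(3) V3(3) V2(3) V1(3) by blast+
    then show "act f v \<notin> V" using V0(4) by blast
  qed
  then obtain f1 f2 where f12: "f1 \<in> carrier G" "f2 \<in> carrier G" "commutes G f1 g" "commutes G f2 g"
     "commut G f1 (commut G f2 h) \<noteq> \<one>" "commutes G (commut G f1 (commut G f2 h)) g"
    using alg h(1) unfolding alg_disjoint_def by blast
  define k where "k = commut G f1 (commut G f2 h)"
  have k: "k \<in> carrier G" "k \<noteq> \<one>" "commutes G k g" using f12 h by (auto simp: k_def)
  define u where "u j = [\<one>, f1, f2, f1 \<otimes> f2] ! j" for j :: nat
  have four: "{..<4::nat} = {0,1,2,3}" by auto
  have u: "u j \<in> carrier G \<and> commutes G (u j) g" if "j < 4" for j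
  proof -
    have "commutes G (f1 \<otimes> f2) g" "commutes G \<one> g"
      using commutes_mult[of f1 f2 g] f12 g by (simp_all add: commutes_def)
    moreover have "j \<in> {0, 1, 2, 3}" using that four by blast
    ultimately show ?thesis using f12 by (auto simp: u_def)
  qed
  have "supp (commut G f2 h) \<subseteq> act f2 ` V \<union> V"
    using supp_commut[OF f12(2) h(1)] h(2) by blast
  then have sk: "supp k \<subseteq> act f1 ` (act f2 ` V \<union> V) \<union> (act f2 ` V \<union> V)"
    unfolding k_def
    using supp_commut[OF f12(1) commut_closed[OF f12(2) h(1)]] image_mono[of "supp (commut G f2 h)" _ "act f1"]
    by (meson Un_mono order_trans)
  have cover: "\<exists>j<4. \<exists>v\<in>V. y = act (u j) v" if "y \<in> supp k" for y
  proof -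
    from sk that consider v where "v \<in> V" "y = act f1 (act f2 v)" | v where "v \<in> V" "y = act f1 v"
      | v where "v \<in> V" "y = act f2 v" | "y \<in> V" by blast
    then show ?thesis
    proof cases
      case 1
      then have "y = act (u 3) v" using f12 VY by (auto simp: u_def numeral_eq_Suc act_mult)
      then show ?thesis using 1 by (intro exI[of _ 3]) auto
    next
      case 2
      then show ?thesis by (intro exI[of _ 1]) (auto simp: u_def)
    next
      case 3
      then have "y = act (u 2) v" by (auto simp: u_def numeral_eq_Suc)
      then show ?thesis using 3 by (intro exI[of _ 2]) auto
    next
      case 4
      then have "y = act (u 0) y" using VY by (auto simp: u_def)
      then show ?thesis using 4 by (intro exI[of _ 0]) auto
    qed
  qed
  obtain y where y: "y \<in> supp k" using supp_ne k by blast
  then have yY: "y \<in> topspace Y" using supp_sub by blast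
  have gi: "g [^] i \<in> carrier G" for i :: nat using g by simp
  have cg: "commutes G a (g [^] i)" if "a \<in> carrier G" "commutes G a g" for a and i :: nat
  proof (induction i)
    case 0 then show ?case using that by (simp add: commutes_def)
  next
    case (Suc i)
    then show ?case using commutes_mult[OF gi[of i] g that(1)] that commutes_sym by simp
  qed
  have yi: "act (g [^] i) y \<in> supp k" for i :: nat
  proof -
    have "act k (act (g [^] i) y) = act (g [^] i) (act k y)"
      by (rule act_commutes[OF cg]) (use k yY g in auto)
    then show ?thesis using y act_inj[OF gi[of i], of "act k y" y] k yY g by (auto simp: supp_def)
  qed
  have "\<forall>i::nat. \<exists>j. j < 4 \<and> (\<exists>v\<in>V. act (g [^] i) y = act (u j) v)" using cover[OF yi] by blast
  then obtain J where J: "\<And>i::nat. J i < 4 \<and> (\<exists>v\<in>V. act (g [^] i) y = act (u (J i)) v)"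
    using choice[of "\<lambda>i j. j < 4 \<and> (\<exists>v\<in>V. act (g [^] (i::nat)) y = act (u j) v)"] by blast
  have "\<not> inj_on J {..<5}"
  proof
    assume "inj_on J {..<5}"
    then have "card {..<5::nat} \<le> card {..<4::nat}"
      by (rule card_inj_on_le) (use J in auto)
    then show False by simp
  qed
  then obtain a b where ab: "a < 5" "b < 5" "a < b" "J a = J b"
    unfolding inj_on_def by (metis lessThan_iff linorder_neqE_nat)
  define w where "w = u (J a)"
  have w: "w \<in> carrier G" "commutes G w g" using u J by (auto simp: w_def)
  obtain v v' where v: "v \<in> V" "v' \<in> V" "act (g [^] a) y = act w v" "act (g [^] b) y = act w v'"
    using J[of a] J[of b] ab(4) by (auto simp: w_def)
  let ?d = "b - a"
  have "act w v' = act (g [^] ?d \<otimes> g [^] a) y" using ab g v by (simp add: nat_pow_mult)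
  also have "\<dots> = act (g [^] ?d) (act w v)" using v g yY by (simp add: act_mult)
  also have "\<dots> = act w (act (g [^] ?d) v)"
    by (rule act_commutes[OF cg, symmetric]) (use w g v VY in auto)
  finally have "v' = act (g [^] ?d) v" using act_inj[OF w(1)] v VY gi by (metis act_in subsetD)
  moreover have "?d \<in> {1,2,3,4}" using ab by auto
  ultimately show False using Vd v by blast
qed

text \<open>If \<open>h\<close> moves a point outside \<open>csupp f\<close>, there is
  \<open>g\<close> with small support near that point, disjoint from \<open>supp f\<close>, with
  nontrivial twelfth power, and with support displaced by \<open>h\<close>; then \<open>h\<close>
  cannot commute with that power. This is why \<open>micro\<close> asks for more than a nontrivial
  element.\<close>

lemma alg_rist_iff:
  assumes f: "f \<in> carrier G" and h: "h \<in> carrier G"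
  shows "h \<in> alg_rist G f \<longleftrightarrow> supp h \<subseteq> csupp f"
proof
  assume s: "supp h \<subseteq> csupp f"
  show "h \<in> alg_rist G f"
    unfolding alg_rist_def
  proof (clarify, intro conjI ballI impI)
    fix g assume g: "g \<in> carrier G" and "alg_disjoint G f g"
    then have "supp f \<inter> supp (g [^] (12::nat)) = {}" using alg_disjoint_disjoint f by blast
    then have "csupp f \<inter> supp (g [^] (12::nat)) = {}"
      unfolding csupp_def using openin_Int_closure_of_eq_empty[OF supp_open, of "g [^] (12::nat)" "supp f"] g by blast
    then show "commutes G h (g [^] (12::nat))" using disjoint_commutes[OF h] g s by blast
  qed (rule h)
next
  assume r: "h \<in> alg_rist G f"
  show "supp h \<subseteq> csupp f"
  proof (rule ccontr)
    assume "\<not> ?thesis"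
    then obtain x where x: "x \<in> supp h" "x \<notin> csupp f" by blast
    let ?U = "topspace Y - csupp f"
    have U: "openin Y ?U" using closedin_closure_of[of Y "supp f"] unfolding csupp_def by (rule openin_diff[OF openin_topspace])
    have "x \<in> ?U" "act h x \<noteq> x" using x by (auto simp: supp_def)
    from displace[OF h U this]
    obtain V where V: "openin Y V" "x \<in> V" "V \<subseteq> ?U" "\<And>v. v \<in> V \<Longrightarrow> act h v \<notin> V" by blast
    obtain g where g: "g \<in> carrier G" "supp g \<subseteq> V" "g [^] (12::nat) \<noteq> \<one>"
      using micro'[OF V(1)] V(2) by blast
    have "supp f \<subseteq> csupp f" unfolding csupp_def by (rule closure_of_subset[OF supp_sub])
    then have "alg_disjoint G f g" using disjoint_alg_disjoint[OF f g(1)] g(2) V(3) by blast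
    then have "commutes G h (g [^] (12::nat))" using r g(1) by (simp add: alg_rist_def)
    moreover have "supp (g [^] (12::nat)) \<subseteq> V" using supp_pow g(1,2) by blast
    ultimately show False using not_commutes[OF h _ g(3) _ V(4)] g(1) by blast
  qed
qed

text \<open>An open set that meets the closure of a set meets the set itself, so an element below
  both \<open>f\<close> and \<open>g\<close> yields a point in both supports.\<close>

lemma rist_disjoint_iff:
  assumes f: "f \<in> carrier G" and g: "g \<in> carrier G"
  shows "rist_disjoint G f g \<longleftrightarrow> supp f \<inter> supp g = {}"
proof
  assume d: "rist_disjoint G f g"
  show "supp f \<inter> supp g = {}"
  proof (rule ccontr)
    assume "supp f \<inter> supp g \<noteq> {}"
    moreover have "openin Y (supp f \<inter> supp g)" using supp_open f g by blast
    ultimately obtain h where h: "h \<in> carrier G" "supp h \<subseteq> supp f \<inter> supp g" "h \<noteq> \<one>" using micro' by metis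
    have "supp f \<subseteq> csupp f" "supp g \<subseteq> csupp g" unfolding csupp_def by (rule closure_of_subset[OF supp_sub])+
    then have "h \<in> alg_rist G f" "h \<in> alg_rist G g" using alg_rist_iff f g h by blast+
    then show False using d h by (auto simp: rist_disjoint_def)
  qed
next
  assume d: "supp f \<inter> supp g = {}"
  show "rist_disjoint G f g"
    unfolding rist_disjoint_def
  proof (intro ballI impI, elim conjE, rule ccontr)
    fix h assume h: "h \<in> carrier G" "h \<in> alg_rist G f" "h \<in> alg_rist G g" "h \<noteq> \<one>"
    then have s: "supp h \<subseteq> csupp f" "supp h \<subseteq> csupp g" "supp h \<noteq> {}"
      using alg_rist_iff f g supp_ne by blast+
    have o: "openin Y (supp h)" using supp_open h by blast
    have "supp h \<inter> supp f \<noteq> {}"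
      using s openin_Int_closure_of_eq_empty[OF o, of "supp f"] unfolding csupp_def by blast
    moreover have "openin Y (supp h \<inter> supp f)" using o supp_open f by blast
    ultimately show False
      using s d openin_Int_closure_of_eq_empty[of Y "supp h \<inter> supp f" "supp g"] unfolding csupp_def by blast
  qed
qed

section \<open>Compact containment of supports\<close>

lemma isupp_open: "openin Y (isupp f)" and isupp_sub_csupp: "isupp f \<subseteq> csupp f"
  by (simp_all add: isupp_def interior_of_subset)

lemma csupp_closed: "closedin Y (csupp f)" by (simp add: csupp_def)

lemma supp_sub_csupp: "supp f \<subseteq> csupp f" unfolding csupp_def by (rule closure_of_subset[OF supp_sub])

lemma supp_sub_isupp: "f \<in> carrier G \<Longrightarrow> supp f \<subseteq> isupp f"
  unfolding isupp_def by (rule interior_of_maximal[OF supp_sub_csupp supp_open])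

text \<open>\<open>micro\<close> gives supports inside \<open>U\<close>, but not through a
  prescribed point. The element \<open>r\<close> of \<open>displaceable\<close> works: it moves
  \<open>supp k\<close> off itself and \<open>y\<close> lies in \<open>supp k\<close>.\<close>

lemma local_elt: assumes "openin Y U" "y \<in> U"
  obtains f where "f \<in> carrier G" "y \<in> supp f" "supp f \<subseteq> U"
proof -
  obtain k r where kr: "k \<in> carrier G" "r \<in> carrier G" "act k y \<noteq> y" "{y \<in> topspace Y. act r y \<noteq> y} \<subseteq> U"
      "\<forall>z\<in>topspace Y. act k z \<noteq> z \<longrightarrow> act k (act r z) = act r z"
    using displaceable[OF assms] by blast
  have y: "y \<in> topspace Y" using assms openin_subset by blast
  have "act r y \<noteq> y" using kr(3,5) y by auto
  then show ?thesis using that[of r] kr y by (auto simp: supp_def)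
qed

text \<open>Compactness of \<open>csupp f\<close> extracts the finite set from
  \<open>displaceable\<close>. Conversely, a point \<open>y\<close> of \<open>csupp f\<close> lies
  in some \<open>csupp k\<close>; an \<open>r\<close> that displaces \<open>supp k\<close> cannot
  fix \<open>y\<close> by \<open>fixed_not_displaced\<close>, and the points moved by
  \<open>r\<close> lie in \<open>isupp g\<close>.\<close>

lemma well_inside_iff:
  assumes f: "f \<in> carrier G" and g: "g \<in> carrier G"
  shows "well_inside G f g \<longleftrightarrow> csupp f \<subseteq> isupp g"
proof
  assume s: "csupp f \<subseteq> isupp g"
  have ex: "\<exists>k r. k \<in> carrier G \<and> r \<in> carrier G \<and> y \<in> supp k \<and> supp r \<subseteq> isupp g \<and> act r ` supp k \<inter> supp k = {}"
    if y: "y \<in> csupp f" for y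
  proof -
    have yY: "y \<in> topspace Y" using y csupp_closed closedin_subset by blast
    obtain k r where kr: "k \<in> carrier G" "r \<in> carrier G" "act k y \<noteq> y" "{y \<in> topspace Y. act r y \<noteq> y} \<subseteq> isupp g"
      "\<forall>z\<in>topspace Y. act k z \<noteq> z \<longrightarrow> act k (act r z) = act r z"
      using displaceable[OF isupp_open, of y g] y s by blast
    have "act r ` supp k \<inter> supp k = {}" using kr(5) by (auto simp: supp_def)
    then show ?thesis using kr yY by (intro exI[of _ k] exI[of _ r]) (auto simp: supp_def)
  qed
  obtain k r where kr: "\<And>y. y \<in> csupp f \<Longrightarrow> k y \<in> carrier G \<and> r y \<in> carrier G \<and> y \<in> supp (k y) \<and>
      supp (r y) \<subseteq> isupp g \<and> act (r y) ` supp (k y) \<inter> supp (k y) = {}"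
    using ex by metis
  have "compactin Y (csupp f)" using compact csupp_closed closedin_compact_space by blast
  moreover have "\<forall>U\<in>(\<lambda>y. supp (k y)) ` csupp f. openin Y U" using kr supp_open by blast
  moreover have "csupp f \<subseteq> \<Union>((\<lambda>y. supp (k y)) ` csupp f)" using kr by blast
  ultimately obtain \<F> where F: "finite \<F>" "\<F> \<subseteq> (\<lambda>y. supp (k y)) ` csupp f" "csupp f \<subseteq> \<Union>\<F>"
    unfolding compactin_def by meson
  then obtain A where A: "A \<subseteq> csupp f" "finite A" "\<F> = (\<lambda>y. supp (k y)) ` A" by (meson finite_subset_image)
  show "well_inside G f g"
    unfolding well_inside_def
  proof (intro exI[of _ "k ` A"] conjI ballI impI)
    show "finite (k ` A)" using A by simp
    show "k ` A \<subseteq> carrier G" using A kr by blast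
    fix k' assume "k' \<in> k ` A"
    then obtain y where y: "y \<in> csupp f" "k' = k y" using A by blast
    have "r y \<in> alg_rist G g" using kr[OF y(1)] alg_rist_iff[OF g, of "r y"] isupp_sub_csupp by blast
    moreover have "rist_disjoint G (r y \<otimes> k' \<otimes> inv r y) k'"
      using kr[OF y(1)] y(2) rist_disjoint_iff[of "r y \<otimes> k y \<otimes> inv r y" "k y"] supp_conj[of "r y" "k y"] by simp
    ultimately show "\<exists>r\<in>carrier G. r \<in> alg_rist G g \<and> rist_disjoint G (r \<otimes> k' \<otimes> inv r) k'"
      using kr[OF y(1)] by blast
  next
    fix h assume h: "h \<in> carrier G" "h \<noteq> \<one> \<and> h \<in> alg_rist G f"
    then obtain x where "x \<in> supp h" "x \<in> csupp f" using supp_ne alg_rist_iff f by blast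
    then obtain y where "y \<in> A" "x \<in> supp (k y)" using F(3) A(3) by auto
    then show "\<exists>k\<in>k ` A. \<not> rist_disjoint G h k"
      using rist_disjoint_iff[OF h(1), of "k y"] kr[of y] A \<open>x \<in> supp h\<close> by blast
  qed
next
  assume "well_inside G f g"
  then obtain K where K: "finite K" "K \<subseteq> carrier G"
     "\<And>k. k \<in> K \<Longrightarrow> \<exists>r\<in>carrier G. r \<in> alg_rist G g \<and> rist_disjoint G (r \<otimes> k \<otimes> inv r) k"
     "\<And>h. h \<in> carrier G \<Longrightarrow> h \<noteq> \<one> \<Longrightarrow> h \<in> alg_rist G f \<Longrightarrow> \<exists>k\<in>K. \<not> rist_disjoint G h k"
    unfolding well_inside_def by meson
  show "csupp f \<subseteq> isupp g"
  proof
    fix y assume y: "y \<in> csupp f"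
    have yY: "y \<in> topspace Y" using y csupp_closed closedin_subset by blast
    \<comment> \<open>Finiteness of \<open>K\<close> makes the union of the closed supports closed;
      an element below \<open>f\<close> supported outside it would miss every support of
      \<open>K\<close>.\<close>
    have "\<exists>k\<in>K. y \<in> csupp k"
    proof (rule ccontr)
      assume n: "\<not> (\<exists>k\<in>K. y \<in> csupp k)"
      let ?U = "topspace Y - \<Union>(csupp ` K)"
      have U: "openin Y ?U" using K(1) csupp_closed by (auto intro!: openin_diff closedin_Union)
      moreover have "y \<in> ?U" using n yY by blast
      ultimately have "?U \<inter> supp f \<noteq> {}"
        using y openin_Int_closure_of_eq_empty[OF U, of "supp f"] unfolding csupp_def by blast
      moreover have "openin Y (?U \<inter> supp f)" using U supp_open f by blast
      ultimately obtain h where h: "h \<in> carrier G" "supp h \<subseteq> ?U \<inter> supp f" "h \<noteq> \<one>" using micro' by metis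
      then have "h \<in> alg_rist G f" using alg_rist_iff f supp_sub_csupp by blast
      then obtain k where "k \<in> K" "\<not> rist_disjoint G h k" using K(4) h by blast
      then have "supp h \<inter> supp k \<noteq> {}" using rist_disjoint_iff[OF h(1)] K(2) by blast
      then show False using h(2) \<open>k \<in> K\<close> supp_sub_csupp by blast
    qed
    then obtain k where k: "k \<in> K" "y \<in> csupp k" by blast
    then have kG: "k \<in> carrier G" using K(2) by blast
    obtain r where r: "r \<in> carrier G" "r \<in> alg_rist G g" "rist_disjoint G (r \<otimes> k \<otimes> inv r) k" using K(3) k by blast
    have sr: "supp r \<subseteq> isupp g"
      unfolding isupp_def using alg_rist_iff[OF g r(1)] r(2) supp_open[OF r(1)] by (simp add: interior_of_maximal)
    have dis: "act r ` supp k \<inter> supp k = {}"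
      using rist_disjoint_iff[of "r \<otimes> k \<otimes> inv r" k] r supp_conj[OF r(1) kG] kG by simp
    show "y \<in> isupp g"
    proof (rule ccontr)
      assume "y \<notin> isupp g"
      then have "act r y = y" using sr yY by (auto simp: supp_def)
      then obtain z where "z \<in> topspace Y" "act k z \<noteq> z" "act k (act r z) \<noteq> act r z"
        using fixed_not_displaced[OF kG r(1), of y] k(2) unfolding csupp_def supp_def by blast
      then have "act r z \<in> act r ` supp k \<inter> supp k" using r(1) by (auto simp: supp_def)
      then show False using dis by blast
    qed
  qed
qed

end

section \<open>The correspondence of points induced by an isomorphism\<close>

locale rubin_pair =
  A: rubin_action G1 Y1 act1 + B: rubin_action G2 Y2 act2 + group_iso G1 G2 \<theta>
  for G1 (structure) and Y1 :: "'y topology" and act1 and G2 (structure) and Y2 :: "'z topology" and act2 and \<theta>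
begin

text \<open>Open neighbourhoods are tested on one side and closed supports on the other. Thus the
  partners of \<open>y\<close> form an intersection of closed sets, and compactness of
  \<open>Y2\<close> replaces any use of filters.\<close>

definition corr :: "'y \<Rightarrow> 'z \<Rightarrow> bool" where
  "corr y z \<longleftrightarrow> z \<in> topspace Y2 \<and> (\<forall>f\<in>carrier G1. y \<in> A.isupp f \<longrightarrow> z \<in> B.csupp (\<theta> f))"

lemma disjoint_iso:
  "f \<in> carrier G1 \<Longrightarrow> g \<in> carrier G1 \<Longrightarrow> B.supp (\<theta> f) \<inter> B.supp (\<theta> g) = {} \<longleftrightarrow> A.supp f \<inter> A.supp g = {}"
  using rist_disjoint_iso[of f g] by (simp add: A.rist_disjoint_iff B.rist_disjoint_iff)

lemma inside_iso:
  "f \<in> carrier G1 \<Longrightarrow> g \<in> carrier G1 \<Longrightarrow> B.csupp (\<theta> f) \<subseteq> B.isupp (\<theta> g) \<longleftrightarrow> A.csupp f \<subseteq> A.isupp g"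
  using well_inside_iso[of f g] by (simp add: A.well_inside_iff B.well_inside_iff)

lemma le_iso:
  "f \<in> carrier G1 \<Longrightarrow> g \<in> carrier G1 \<Longrightarrow> B.supp (\<theta> g) \<subseteq> B.csupp (\<theta> f) \<longleftrightarrow> A.supp g \<subseteq> A.csupp f"
  using alg_rist_iso[of f g] by (simp add: A.alg_rist_iff B.alg_rist_iff)

text \<open>Otherwise some \<open>f\<close> has \<open>y\<close> in its support and support disjoint
  from that of \<open>k\<close>. The images have disjoint supports, so the open set
  \<open>isupp (\<theta> k)\<close> misses \<open>csupp (\<theta> f)\<close>, which contains
  \<open>z\<close>.\<close>

lemma corr_back:
  assumes c: "corr y z" and y: "y \<in> topspace Y1" and k: "k \<in> carrier G1" and z: "z \<in> B.isupp (\<theta> k)"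
  shows "y \<in> A.csupp k"
proof (rule ccontr)
  assume "y \<notin> A.csupp k"
  then have "y \<in> topspace Y1 - A.csupp k" using y by blast
  moreover have "openin Y1 (topspace Y1 - A.csupp k)"
    by (rule openin_diff[OF openin_topspace A.csupp_closed])
  ultimately obtain f where f: "f \<in> carrier G1" "y \<in> A.supp f" "A.supp f \<subseteq> topspace Y1 - A.csupp k"
    using A.local_elt by metis
  then have "A.supp f \<inter> A.supp k = {}" using A.supp_sub_csupp by blast
  then have d: "B.supp (\<theta> f) \<inter> B.supp (\<theta> k) = {}" using disjoint_iso f(1) k by blast
  have "B.supp (\<theta> f) \<inter> B.csupp (\<theta> k) = {}"
    using d openin_Int_closure_of_eq_empty[OF B.supp_open, of "\<theta> f"] f(1) unfolding B.csupp_def by simp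
  then have "B.supp (\<theta> f) \<inter> B.isupp (\<theta> k) = {}" using B.isupp_sub_csupp by blast
  then have "B.isupp (\<theta> k) \<inter> B.csupp (\<theta> f) = {}"
    using openin_Int_closure_of_eq_empty[OF B.isupp_open, of "\<theta> k" "B.supp (\<theta> f)"]
    unfolding B.csupp_def by (simp add: Int_commute)
  moreover have "z \<in> B.csupp (\<theta> f)"
    using c f A.supp_sub_isupp unfolding corr_def by blast
  ultimately show False using z by blast
qed

text \<open>Finitely many neighbourhoods \<open>isupp f\<close> of \<open>y\<close> contain the
  support of one nontrivial \<open>h\<close>; the support of \<open>\<theta> h\<close> is nonempty
  and lies in all the sets \<open>csupp (\<theta> f)\<close>. This is the finite intersection
  property.\<close>

lemma corr_ex:
  assumes y: "y \<in> topspace Y1" obtains z where "corr y z"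
proof -
  let ?F = "(\<lambda>f. B.csupp (\<theta> f)) ` {f \<in> carrier G1. y \<in> A.isupp f}"
  obtain f0 where f0: "f0 \<in> carrier G1" "y \<in> A.supp f0" using A.local_elt[OF openin_topspace y] by blast
  have "\<Inter>\<F> \<noteq> {}" if F: "finite \<F>" "\<F> \<subseteq> ?F" for \<F>
  proof -
    obtain A where A: "A \<subseteq> {f \<in> carrier G1. y \<in> A.isupp f}" "finite A" "\<F> = (\<lambda>f. B.csupp (\<theta> f)) ` A"
      using F by (meson finite_subset_image)
    let ?U = "topspace Y1 \<inter> \<Inter>(A.isupp ` A)"
    have "openin Y1 ?U"
    proof (cases "A = {}")
      case False
      then have "openin Y1 (\<Inter>(A.isupp ` A))" using A(2) A.isupp_open by (intro openin_Inter) auto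
      then show ?thesis by blast
    qed auto
    moreover have "y \<in> ?U" using A y by blast
    ultimately obtain h where h: "h \<in> carrier G1" "A.supp h \<subseteq> ?U" "h \<noteq> \<one>" using A.micro' by (metis empty_iff)
    have "B.supp (\<theta> h) \<noteq> {}" using B.supp_ne[of "\<theta> h"] h one_iff by simp
    moreover have "B.supp (\<theta> h) \<subseteq> B.csupp (\<theta> f)" if f: "f \<in> A" for f
    proof -
      have "f \<in> carrier G1" "A.supp h \<subseteq> A.csupp f" using f A(1) h(2) A.isupp_sub_csupp by blast+
      then show ?thesis using le_iso[of f h] h(1) by blast
    qed
    ultimately show ?thesis unfolding A(3) by blast
  qed
  moreover have "\<forall>C\<in>?F. closedin Y2 C" using B.csupp_closed by blast
  ultimately have "\<Inter>?F \<noteq> {}" using B.compact[unfolded compact_space_fip, rule_format, of ?F] by blast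
  then obtain z where z: "z \<in> \<Inter>?F" by blast
  have "B.csupp (\<theta> f0) \<in> ?F" using f0 A.supp_sub_isupp by blast
  then have "z \<in> B.csupp (\<theta> f0)" using z by blast
  then have "z \<in> topspace Y2" using B.csupp_closed closedin_subset by blast
  then show ?thesis using that[of z] z unfolding corr_def by blast
qed

text \<open>Two nested supports around \<open>z\<close> are chosen in \<open>Y2\<close>. Their
  compact containment transfers to \<open>Y1\<close>, where it turns membership in a closed support,
  which is all that \<open>corr_back\<close> gives, into membership in an open one.\<close>

lemma inside_basis:
  assumes U: "openin Y2 U" and z: "z \<in> U"
  obtains k l where "k \<in> carrier G1" "l \<in> carrier G1" "z \<in> B.isupp (\<theta> k)" "A.csupp k \<subseteq> A.isupp l" "B.csupp (\<theta> l) \<subseteq> U"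
proof -
  have surj: "\<exists>k\<in>carrier G1. k' = \<theta> k" if "k' \<in> carrier G2" for k'
    using bij that unfolding bij_betw_def by blast
  have reg: "regular_space Y2" using B.compact B.haus compact_Hausdorff_imp_regular_space by blast
  have nb: "\<exists>k\<in>carrier G1. z \<in> B.supp (\<theta> k) \<and> B.csupp (\<theta> k) \<subseteq> V" if V: "openin Y2 V" "z \<in> V" for V
  proof -
    obtain W C where W: "openin Y2 W" "closedin Y2 C" "z \<in> W" "W \<subseteq> C" "C \<subseteq> V"
      using reg V unfolding neighbourhood_base_of_closedin[symmetric] neighbourhood_base_of by metis
    obtain k' where k': "k' \<in> carrier G2" "z \<in> B.supp k'" "B.supp k' \<subseteq> W" using B.local_elt[OF W(1,3)] by metis
    have "B.csupp k' \<subseteq> C" unfolding B.csupp_def by (rule closure_of_minimal) (use k' W in auto)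
    then show ?thesis using surj[OF k'(1)] k' W(5) by blast
  qed
  obtain l where l: "l \<in> carrier G1" "z \<in> B.supp (\<theta> l)" "B.csupp (\<theta> l) \<subseteq> U" using nb[OF U z] by blast
  obtain k where k: "k \<in> carrier G1" "z \<in> B.supp (\<theta> k)" "B.csupp (\<theta> k) \<subseteq> B.supp (\<theta> l)"
    using nb[OF B.supp_open l(2)] l(1) by auto
  have "B.csupp (\<theta> k) \<subseteq> B.isupp (\<theta> l)" using k(3) B.supp_sub_isupp[OF closed[OF l(1)]] by (rule order_trans)
  then have "A.csupp k \<subseteq> A.isupp l" using inside_iso k l by blast
  moreover have "z \<in> B.isupp (\<theta> k)" using k(2) B.supp_sub_isupp[OF closed[OF k(1)]] by blast
  ultimately show ?thesis using that k l by blast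
qed

text \<open>The quantifier over all partners of nearby points gives two things at once: uniqueness
  of the partner, with \<open>y' = y\<close>, and continuity of \<open>q\<close>.\<close>

lemma corr_cont:
  assumes c: "corr y z" and y: "y \<in> topspace Y1" and U: "openin Y2 U" and z: "z \<in> U"
  shows "\<exists>V. openin Y1 V \<and> y \<in> V \<and> (\<forall>y'\<in>V. \<forall>z'. corr y' z' \<longrightarrow> z' \<in> U)"
proof -
  obtain k l where kl: "k \<in> carrier G1" "l \<in> carrier G1" "z \<in> B.isupp (\<theta> k)" "A.csupp k \<subseteq> A.isupp l" "B.csupp (\<theta> l) \<subseteq> U"
    using inside_basis[OF U z] by metis
  have "y \<in> A.isupp l" using corr_back[OF c y kl(1,3)] kl(4) by blast
  moreover have "\<forall>y'\<in>A.isupp l. \<forall>z'. corr y' z' \<longrightarrow> z' \<in> U"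
    using kl(2,5) unfolding corr_def by blast
  ultimately show ?thesis using A.isupp_open by blast
qed

lemma corr_unique:
  assumes c: "corr y z" "corr y z'" and y: "y \<in> topspace Y1" shows "z = z'"
proof (rule ccontr)
  assume "z \<noteq> z'"
  moreover have "z \<in> topspace Y2" "z' \<in> topspace Y2" using c by (auto simp: corr_def)
  ultimately obtain U V where "openin Y2 U" "z \<in> U" "z' \<notin> U"
    using B.haus unfolding Hausdorff_space_def disjnt_iff by metis
  then show False using corr_cont[OF c(1) y] c(2) by blast
qed

definition q where "q y = (SOME z. corr y z)"

lemma q: "y \<in> topspace Y1 \<Longrightarrow> corr y (q y)"
  unfolding q_def using corr_ex by (metis someI)

lemma q_cont: "continuous_map Y1 Y2 q"
  unfolding continuous_map_def
proof (intro conjI allI impI)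
  show "q \<in> topspace Y1 \<rightarrow> topspace Y2" using q by (auto simp: corr_def)
  fix U assume U: "openin Y2 U"
  show "openin Y1 {y \<in> topspace Y1. q y \<in> U}"
  proof (subst openin_subopen, intro ballI)
    fix y assume "y \<in> {y \<in> topspace Y1. q y \<in> U}"
    then have y: "y \<in> topspace Y1" "q y \<in> U" by auto
    obtain V where V: "openin Y1 V" "y \<in> V" "\<forall>y'\<in>V. \<forall>z'. corr y' z' \<longrightarrow> z' \<in> U"
      using corr_cont[OF q[OF y(1)] y(1) U y(2)] by blast
    have "V \<subseteq> {y \<in> topspace Y1. q y \<in> U}" using V q openin_subset[OF V(1)] by blast
    then show "\<exists>T. openin Y1 T \<and> y \<in> T \<and> T \<subseteq> {y \<in> topspace Y1. q y \<in> U}" using V by blast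
  qed
qed

end

text \<open>By \<open>corr_back\<close> the correspondence of the inverse isomorphism is the
  converse relation, so uniqueness of partners on both sides makes the two continuous maps inverse
  to each other.\<close>

theorem rubin_homeomorphic:
  assumes "rubin_action G1 Y1 act1" "rubin_action G2 Y2 act2" "\<theta> \<in> iso G1 G2"
  shows "Y1 homeomorphic_space Y2"
proof -
  interpret A: rubin_action G1 Y1 act1 by fact
  interpret B: rubin_action G2 Y2 act2 by fact
  interpret P: rubin_pair G1 Y1 act1 G2 Y2 act2 \<theta>
    by unfold_locales (rule assms(3))
  define \<eta> where "\<eta> = inv_into (carrier G1) \<theta>"
  have "\<eta> \<in> iso G2 G1" unfolding \<eta>_def using A.iso_set_sym assms(3) by blast
  then interpret Q: rubin_pair G2 Y2 act2 G1 Y1 act1 \<eta> by unfold_locales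
  have \<eta>: "\<theta> (\<eta> k) = k" "\<eta> k \<in> carrier G1" if "k \<in> carrier G2" for k
    using that P.bij unfolding \<eta>_def by (auto simp: bij_betw_inv_into_right bij_betw_def inv_into_into)
  have \<eta>': "\<eta> (\<theta> k) = k" if "k \<in> carrier G1" for k
    using that P.bij unfolding \<eta>_def by (simp add: bij_betw_inv_into_left)
  have 1: "Q.corr z y" if "P.corr y z" "y \<in> topspace Y1" for y z
    unfolding Q.corr_def
  proof (intro conjI ballI impI)
    fix k assume k: "k \<in> carrier G2" "z \<in> B.isupp k"
    show "y \<in> A.csupp (\<eta> k)" by (rule P.corr_back[OF that \<eta>(2)[OF k(1)]]) (simp add: \<eta>(1)[OF k(1)] k)
  qed (rule that)
  have 2: "P.corr y z" if "Q.corr z y" "z \<in> topspace Y2" for y z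
    unfolding P.corr_def
  proof (intro conjI ballI impI)
    fix k assume k: "k \<in> carrier G1" "y \<in> A.isupp k"
    show "z \<in> B.csupp (\<theta> k)" by (rule Q.corr_back[OF that P.closed[OF k(1)]]) (simp add: \<eta>'[OF k(1)] k)
  qed (rule that)
  have "Q.q (P.q y) = y" if y: "y \<in> topspace Y1" for y
  proof -
    have c: "Q.corr (P.q y) y" using 1[OF P.q[OF y] y] .
    have "P.q y \<in> topspace Y2" using P.q[OF y] by (simp add: P.corr_def)
    then show ?thesis using Q.corr_unique[OF Q.q c] by blast
  qed
  moreover have "P.q (Q.q z) = z" if z: "z \<in> topspace Y2" for z
  proof -
    have c: "P.corr (Q.q z) z" using 2[OF Q.q[OF z] z] .
    have "Q.q z \<in> topspace Y1" using Q.q[OF z] by (simp add: Q.corr_def)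
    then show ?thesis using P.corr_unique[OF P.q c] by blast
  qed
  ultimately have "homeomorphic_maps Y1 Y2 P.q Q.q"
    unfolding homeomorphic_maps_def using P.q_cont Q.q_cont by blast
  then show ?thesis unfolding homeomorphic_space_def by blast
qed

section \<open>Elements with small support\<close>

text \<open>\<open>t + bump c d t\<close> has slopes \<open>2\<close>, \<open>1\<close>, \<open>1/2\<close> on \<open>[c,c+d]\<close>, \<open>[c+d,c+2d]\<close>, \<open>[c+2d,c+4d]\<close> and is the identity
  elsewhere; it maps \<open>[c+d,c+2d]\<close> onto \<open>[c+2d,c+3d]\<close>.\<close>

definition bump :: "real \<Rightarrow> real \<Rightarrow> real \<Rightarrow> real" where
  "bump c d t = max 0 (min (t - c) (min d ((c + 4 * d - t) / 2)))"

lemma bump_cont: "continuous_on UNIV (bump c d)"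
  unfolding bump_def by (intro continuous_intros) auto

lemma bump_nonneg [simp]: "0 \<le> bump c d t" by (simp add: bump_def)

lemma bump_pos: "d > 0 \<Longrightarrow> c < t \<Longrightarrow> t < c + 4 * d \<Longrightarrow> 0 < bump c d t"
  by (simp add: bump_def)

lemma bump_zero: "d > 0 \<Longrightarrow> t \<le> c \<or> c + 4 * d \<le> t \<Longrightarrow> bump c d t = 0"
  by (auto simp: bump_def)

lemma bump_less: "d > 0 \<Longrightarrow> t < c + 4 * d \<Longrightarrow> t + bump c d t < c + 4 * d"
proof -
  assume a: "d > 0" "t < c + 4 * d"
  define h where "h = (c + 4 * d - t) / 2"
  have "2 * h = c + 4 * d - t" by (simp add: h_def)
  then show ?thesis using a unfolding bump_def h_def[symmetric] max_def min_def by auto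
qed

lemma bump_le: "d > 0 \<Longrightarrow> bump c d t \<le> d" by (simp add: bump_def)

lemma bump_mid: "c + d \<le> t \<Longrightarrow> t \<le> c + 2 * d \<Longrightarrow> d > 0 \<Longrightarrow> bump c d t = d"
  by (auto simp: bump_def max_def min_def)

text \<open>The bump falls with slope at most 1/2, so \<open>t + s * bump c d t\<close> stays
  increasing for every \<open>s\<close> in \<open>[0,1]\<close>; these maps form the isotopy to the
  identity.\<close>

lemma bump_lip: "s \<le> t \<Longrightarrow> d > 0 \<Longrightarrow> bump c d s - bump c d t \<le> (t - s) / 2"
proof -
  assume a: "s \<le> t" "d > 0"
  define h k where "h = (c + 4 * d - s) / 2" and "k = (c + 4 * d - t) / 2"
  have "2 * h = c + 4 * d - s" "2 * k = c + 4 * d - t" by (simp_all add: h_def k_def)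
  then have "2 * (bump c d s - bump c d t) \<le> t - s"
    using a unfolding bump_def h_def[symmetric] k_def[symmetric] max_def min_def by (auto; linarith)
  then show ?thesis by simp
qed

lemma dgerm_affine_at:
  assumes "pow2 l" "dyadic b" "pow2 r" "dyadic c" "a < t0" "t0 < e" "dyadic t0 \<or> l = r \<and> b = c"
    and "\<And>t. a < t \<Longrightarrow> t \<le> t0 \<Longrightarrow> f t = l * t + b" "\<And>t. t0 \<le> t \<Longrightarrow> t < e \<Longrightarrow> f t = r * t + c"
  shows "dgerm f t0"
proof -
  have ev: "\<forall>\<^sub>F t in nhds t0. t \<in> {a<..<e}" using assms by (intro eventually_nhds_in_open) auto
  show ?thesis
  proof (cases "dyadic t0")
    case True
    show ?thesis
    proof (rule dgerm_glue[OF dgerm_affine[OF assms(1,2)] dgerm_affine[OF assms(3,4)] _ True])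
      show "l * t0 + b = r * t0 + c" using assms(5,6) assms(8)[of t0] assms(9)[of t0] by simp
      show "\<forall>\<^sub>F t in nhds t0. f t = (if t \<le> t0 then l * t + b else r * t + c)"
        using ev by eventually_elim (use assms in auto)
    qed
  next
    case False
    then have lr: "l = r" "b = c" using assms by auto
    have "\<forall>\<^sub>F t in nhds t0. l * t + b = f t"
      using ev by eventually_elim (metis assms(8,9) lr greaterThanLessThan_iff linear)
    then show ?thesis using dgerm_cong_imp[OF dgerm_affine[OF assms(1,2)]] by blast
  qed
qed

lemma dgerm_bump:
  assumes c: "dyadic c" and d: "dyadic d" "d > 0"
  shows "dgerm (\<lambda>t. t + bump c d t) t0"
proof -
  have half: "pow2 (1/2)" using pow2_inverse[OF pow2_2] by simp
  have dh: "dyadic (1/2 * (c + 4 * d))"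
    using c d pow2_dyadic[OF half] dyadic_of_int[of 4] by (intro dyadic_mult dyadic_add) auto
  have dc: "dyadic (c + d)" "dyadic (c + 2 * d)" "dyadic (c + 4 * d)" "dyadic (- c)"
    using c d dyadic_of_int[of 2] dyadic_of_int[of 4] by (auto intro!: dyadic_add dyadic_mult)
  have v1: "t + bump c d t = 1 * t + 0" if "t \<le> c" for t using that bump_zero d by simp
  have v2: "t + bump c d t = 2 * t + (- c)" if "c \<le> t" "t \<le> c + d" for t
    using that d unfolding bump_def max_def min_def by (auto split: if_splits)
  have v3: "t + bump c d t = 1 * t + d" if "c + d \<le> t" "t \<le> c + 2 * d" for t
    using bump_mid[of c d t] that d by simp
  have v4: "t + bump c d t = 1/2 * t + 1/2 * (c + 4 * d)" if "c + 2 * d \<le> t" "t \<le> c + 4 * d" for t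
    using that d unfolding bump_def max_def min_def by (auto split: if_splits simp: field_simps)
  have v5: "t + bump c d t = 1 * t + 0" if "c + 4 * d \<le> t" for t using that bump_zero d by simp
  consider "t0 < c" | "t0 = c" | "c < t0" "t0 < c + d" | "t0 = c + d" | "c + d < t0" "t0 < c + 2 * d"
    | "t0 = c + 2 * d" | "c + 2 * d < t0" "t0 < c + 4 * d" | "t0 = c + 4 * d" | "c + 4 * d < t0" by linarith
  then show ?thesis
  proof cases
    case 1 then show ?thesis
      by (intro dgerm_affine_at[of 1 0 1 0 "t0 - 1" t0 c]) (use v1 in auto)
  next
    case 2 then show ?thesis
      by (intro dgerm_affine_at[of 1 0 2 "- c" "t0 - 1" t0 "c + d"]) (use v1 v2 c d dc in auto)
  next
    case 3 then show ?thesis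
      by (intro dgerm_affine_at[of 2 "- c" 2 "- c" c t0 "c + d"]) (use v2 dc in auto)
  next
    case 4 then show ?thesis
      by (intro dgerm_affine_at[of 2 "- c" 1 d c t0 "c + 2 * d"]) (use v2 v3 d dc in auto)
  next
    case 5 then show ?thesis
      by (intro dgerm_affine_at[of 1 d 1 d "c + d" t0 "c + 2 * d"]) (use v3 d in auto)
  next
    case 6 then show ?thesis
      by (intro dgerm_affine_at[of 1 d "1/2" "1/2 * (c + 4 * d)" "c + d" t0 "c + 4 * d"]) (use v3 v4 d dh half dc in auto)
  next
    case 7 then show ?thesis
      by (intro dgerm_affine_at[of "1/2" "1/2 * (c + 4 * d)" "1/2" "1/2 * (c + 4 * d)" "c + 2 * d" t0 "c + 4 * d"])
        (use v4 d dh half in auto)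
  next
    case 8 then show ?thesis
      by (intro dgerm_affine_at[of "1/2" "1/2 * (c + 4 * d)" 1 0 "c + 2 * d" t0 "t0 + 1"]) (use v4 v5 d dh half dc in auto)
  next
    case 9 then show ?thesis
      by (intro dgerm_affine_at[of 1 0 1 0 "c + 4 * d" t0 "t0 + 1"]) (use v5 in auto)
  qed
qed

section \<open>Bump elements of the group\<close>

context stone
begin

text \<open>The representative \<open>(\<phi>\<^sup>n x, t - n)\<close> of \<open>[x,t]\<close> used here has second coordinate in \<open>[c,c+1)\<close>.\<close>

definition disp :: "'a set \<Rightarrow> real \<Rightarrow> real \<Rightarrow> 'a \<Rightarrow> real \<Rightarrow> real" where
  "disp C c d x t = (if it \<lfloor>t - c\<rfloor> x \<in> C then bump c d (t - of_int \<lfloor>t - c\<rfloor>) else 0)"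

lemma disp_inv: "x \<in> topspace X \<Longrightarrow> disp C c d (it m x) (t - of_int m) = disp C c d x t"
proof -
  assume x: "x \<in> topspace X"
  have e: "\<lfloor>t - of_int m - c\<rfloor> = \<lfloor>t - c\<rfloor> - m" by linarith
  have "it (\<lfloor>t - c\<rfloor> - m) (it m x) = it \<lfloor>t - c\<rfloor> x" using it_add[OF x, of "\<lfloor>t - c\<rfloor> - m" m] by simp
  then show ?thesis unfolding disp_def e by simp
qed

text \<open>The formula of the slab \<open>[c + n, c + n + 1)\<close> also holds on the last stretch
  of the preceding slab, where both bumps vanish. These windows are open and overlap, which settles
  continuity and germs at slab boundaries.\<close>

lemma disp_slab:
  assumes d: "d > 0" "4 * d < 1" and t: "c + of_int n - (1 - 4 * d) < t" "t < c + of_int n + 1"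
  shows "disp C c d x t = (if it n x \<in> C then bump c d (t - of_int n) else 0)"
proof (cases "c + of_int n \<le> t")
  case True
  then have "\<lfloor>t - c\<rfloor> = n" using t by linarith
  then show ?thesis by (simp add: disp_def)
next
  case False
  then have e: "\<lfloor>t - c\<rfloor> = n - 1" using t d by linarith
  have "bump c d (t - of_int (n - 1)) = 0" using t d by (intro bump_zero) auto
  moreover have "bump c d (t - of_int n) = 0" using False d by (intro bump_zero) auto
  ultimately show ?thesis unfolding disp_def e by auto
qed

lemma disp_nonneg [simp]: "0 \<le> disp C c d x t" by (simp add: disp_def)

lemma disp_le: "d > 0 \<Longrightarrow> disp C c d x t \<le> d" by (simp add: disp_def bump_le)

lemma disp_lip:
  assumes d: "d > 0" "4 * d < 1" and st: "s \<le> t"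
  shows "disp C c d x s - disp C c d x t \<le> (t - s) / 2"
proof (cases "\<lfloor>s - c\<rfloor> = \<lfloor>t - c\<rfloor>")
  case True
  then show ?thesis using bump_lip[of "s - of_int \<lfloor>s - c\<rfloor>" "t - of_int \<lfloor>s - c\<rfloor>" d c] st d by (auto simp: disp_def)
next
  case False
  let ?n = "\<lfloor>s - c\<rfloor>"
  have "?n \<le> \<lfloor>t - c\<rfloor>" using st by (intro floor_mono) simp
  then have "of_int ?n + 1 \<le> (of_int \<lfloor>t - c\<rfloor> :: real)" using False by linarith
  then have t: "c + of_int ?n + 1 \<le> t" by linarith
  \<comment> \<open>The bump vanishes at the end \<open>c + 1\<close> of the slab, so the decrease
    up to there already bounds its value.\<close>
  have "bump c d (s - of_int ?n) \<le> (c + of_int ?n + 1 - s) / 2"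
    using bump_lip[of "s - of_int ?n" "c + 1" d c] bump_zero[of d "c + 1" c] d st
    by (auto simp: add.commute) linarith
  then have "disp C c d x s \<le> (t - s) / 2" using t st by (auto simp: disp_def)
  then show ?thesis using disp_nonneg[of C c d x t] by linarith
qed

lemma disp_cont:
  assumes C: "openin X C" "closedin X C" and d: "d > 0" "4 * d < 1"
  shows "continuous_map XR euclideanreal (\<lambda>(x, t). disp C c d x t)"
proof (rule continuous_map_locI_eq)
  fix p assume "p \<in> topspace XR"
  then obtain x0 t0 where p: "p = (x0, t0)" "x0 \<in> topspace X" by auto
  let ?n = "\<lfloor>t0 - c\<rfloor>"
  let ?I = "{c + of_int ?n - (1 - 4 * d)<..<c + of_int ?n + 1}"
  let ?f = "\<lambda>x. if it ?n x \<in> C then 1 else (0::real)"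
  have "loc_const X ?f"
    unfolding loc_const_def
  proof
    fix x assume x: "x \<in> topspace X"
    have o: "openin X {x \<in> topspace X. it ?n x \<in> C}" "openin X {x \<in> topspace X. it ?n x \<in> topspace X - C}"
      by (intro openin_continuous_map_preimage[OF it_cont] C openin_diff openin_topspace)+
    show "\<exists>A. openin X A \<and> x \<in> A \<and> (\<forall>x'\<in>A. ?f x' = ?f x)"
    proof (cases "it ?n x \<in> C")
      case True then show ?thesis using o(1) x by (intro exI[of _ "{x \<in> topspace X. it ?n x \<in> C}"]) auto
    next
      case False then show ?thesis using o(2) x it_in by (intro exI[of _ "{x \<in> topspace X. it ?n x \<in> topspace X - C}"]) auto
    qed
  qed
  then have fc: "continuous_map X euclideanreal ?f" by (rule loc_const_continuous_map) auto
  have "continuous_map XR euclideanreal (\<lambda>p. ?f (fst p))"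
    using continuous_map_compose[OF continuous_map_fst fc] by (simp add: o_def)
  moreover have "continuous_map XR euclideanreal (\<lambda>p. bump c d (snd p - of_int ?n))"
  proof -
    have "continuous_map euclideanreal euclideanreal (\<lambda>t. bump c d (t - of_int ?n))"
      using continuous_on_compose2[OF bump_cont, of UNIV "\<lambda>t. t - of_int ?n"] by (simp add: continuous_intros)
    from continuous_map_compose[OF continuous_map_snd this] show ?thesis by (simp add: o_def)
  qed
  ultimately have "continuous_map XR euclideanreal (\<lambda>p. ?f (fst p) * bump c d (snd p - of_int ?n))"
    by (rule continuous_map_real_mult)
  moreover have "openin XR (topspace X \<times> ?I)" by (simp add: openin_prod_Times_iff)
  moreover have "p \<in> topspace X \<times> ?I" using p d by (auto; linarith)
  moreover have "\<forall>z\<in>topspace X \<times> ?I. (\<lambda>(x, t). disp C c d x t) z = ?f (fst z) * bump c d (snd z - of_int ?n)"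
    using disp_slab[OF d] by auto
  ultimately show "\<exists>U g. openin XR U \<and> p \<in> U \<and> continuous_map XR euclideanreal g \<and>
      (\<forall>z\<in>U. (\<lambda>(x, t). disp C c d x t) z = g z)" by blast
qed

text \<open>A product of a quotient map with an identity need not be a quotient map; here it is,
  because \<open>cls\<close> is open. It lets isotopies descend from
  \<open>X \<times> \<real>\<close> to the suspension.\<close>

lemma quot_prod: "quotient_map (prod_topology Z XR) (prod_topology Z Y) (\<lambda>(s, p). (s, cls p))"
proof (rule continuous_open_imp_quotient_map)
  have "continuous_map (prod_topology Z XR) Y (cls \<circ> snd)"
    by (rule continuous_map_compose[OF continuous_map_snd cls_cont])
  then show "continuous_map (prod_topology Z XR) (prod_topology Z Y) (\<lambda>(s, p). (s, cls p))"
    by (simp add: continuous_map_pairwise o_def case_prod_unfold continuous_map_fst)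
  show "open_map (prod_topology Z XR) (prod_topology Z Y) (\<lambda>(s, p). (s, cls p))"
    unfolding open_map_def
  proof (intro allI impI)
    fix W assume W: "openin (prod_topology Z XR) W"
    show "openin (prod_topology Z Y) ((\<lambda>(s, p). (s, cls p)) ` W)"
      unfolding openin_prod_topology_alt
    proof (intro allI impI)
      fix s y assume "(s, y) \<in> (\<lambda>(s, p). (s, cls p)) ` W"
      then obtain p where p: "(s, p) \<in> W" "y = cls p" by auto
      obtain A B where AB: "openin Z A" "openin XR B" "s \<in> A" "p \<in> B" "A \<times> B \<subseteq> W"
        using W p(1) unfolding openin_prod_topology_alt by (metis)
      have "openin Y (cls ` B)" using cls_open AB(2) by (auto simp: open_map_def)
      moreover have "A \<times> cls ` B \<subseteq> (\<lambda>(s, p). (s, cls p)) ` W" using AB(5) by (auto simp: image_iff)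
      ultimately show "\<exists>U V. openin Z U \<and> openin Y V \<and> s \<in> U \<and> y \<in> V \<and> U \<times> V \<subseteq> (\<lambda>(s, p). (s, cls p)) ` W"
        using AB p(2) by blast
    qed
  qed
  show "(\<lambda>(s, p). (s, cls p)) ` topspace (prod_topology Z XR) = topspace (prod_topology Z Y)"
    by (auto simp: topspace_suspension image_iff)
qed

text \<open>The isotopy scales the displacement by \<open>s\<close>. Each stage is increasing along
  flow lines, hence injective, and is onto by the intermediate value theorem; compactness makes it a
  homeomorphism.\<close>

lemma bump_elt:
  assumes C: "openin X C" "closedin X C" and d: "d > 0" "4 * d < 1" "dyadic c" "dyadic d"
  obtains g where "g \<in> T_set X \<phi>" "\<And>x t. x \<in> topspace X \<Longrightarrow> g (cls (x, t)) = cls (x, t + disp C c d x t)"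
proof -
  let ?I = "subtopology euclideanreal {0..1}"
  let ?h = "\<lambda>(s, (x, t)). cls (x, t + s * disp C c d x t)"
  have fst_c: "continuous_map (prod_topology ?I XR) euclideanreal fst"
    by (rule continuous_map_into_fulltopology[OF continuous_map_fst])
  have disp_c: "continuous_map (prod_topology ?I XR) euclideanreal (\<lambda>q. disp C c d (fst (snd q)) (snd (snd q)))"
    using continuous_map_compose[OF continuous_map_snd disp_cont[OF C d(1,2)]] by (simp add: o_def case_prod_unfold)
  have x_c: "continuous_map (prod_topology ?I XR) X (\<lambda>q. fst (snd q))"
    using continuous_map_compose[OF continuous_map_snd continuous_map_fst] by (simp add: o_def)
  have t_c: "continuous_map (prod_topology ?I XR) euclideanreal (\<lambda>q. snd (snd q))"
    using continuous_map_compose[OF continuous_map_snd continuous_map_snd] by (simp add: o_def)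
  have "continuous_map (prod_topology ?I XR) XR (\<lambda>q. (fst (snd q), snd (snd q) + fst q * disp C c d (fst (snd q)) (snd (snd q))))"
    unfolding continuous_map_pairwise o_def fst_conv snd_conv
    by (intro conjI x_c continuous_map_add continuous_map_real_mult t_c fst_c disp_c)
  from continuous_map_compose[OF this cls_cont]
  have h_c: "continuous_map (prod_topology ?I XR) Y ?h" by (simp add: o_def case_prod_unfold)
  have inv: "?h p = ?h q"
    if p: "p \<in> topspace (prod_topology ?I XR)" "q \<in> topspace (prod_topology ?I XR)"
      and eq: "(\<lambda>(s, p). (s, cls p)) p = (\<lambda>(s, p). (s, cls p)) q" for p q
  proof -
    obtain s x t s' x' t' where pq: "p = (s, (x, t))" "q = (s', (x', t'))" by (metis surj_pair)
    then have x: "x \<in> topspace X" "x' \<in> topspace X" "s' = s" "cls (x, t) = cls (x', t')" using p eq by auto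
    then obtain n where n: "x' = it n x" "t' = t - of_int n" using cls_eq_iff by auto
    have "t' + s * disp C c d x' t' = t + s * disp C c d x t - of_int n"
      using disp_inv[OF x(1), of C c d n t] n by simp
    then show ?thesis using cls_it[OF x(1), of n "t + s * disp C c d x t"] n(1)
      by (simp add: pq x(3))
  qed
  have "\<exists>H. continuous_map (prod_topology ?I Y) Y H \<and>
    (\<forall>p\<in>topspace (prod_topology ?I XR). H ((\<lambda>(s, p). (s, cls p)) p) = ?h p)"
  proof (rule quotient_map_lift_exists[OF quot_prod h_c inv])
    fix H assume "continuous_map (prod_topology ?I Y) Y H"
      "\<And>p. p \<in> topspace (prod_topology ?I XR) \<Longrightarrow> H ((\<lambda>(s, p). (s, cls p)) p) = ?h p"
    then show ?thesis by (intro exI[of _ H] conjI ballI)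
  qed
  then obtain H where H: "continuous_map (prod_topology ?I Y) Y H"
    "\<forall>p\<in>topspace (prod_topology ?I XR). H ((\<lambda>(s, p). (s, cls p)) p) = ?h p" by blast
  have Hv: "H (s, cls (x, t)) = cls (x, t + s * disp C c d x t)" if "s \<in> {0..1}" "x \<in> topspace X" for s x t
    using bspec[OF H(2), of "(s, (x, t))"] that by simp
  have hom: "homeomorphic_map Y Y (\<lambda>y. H (s, y))" if s: "s \<in> {0..1}" for s
  proof (rule continuous_imp_homeomorphic_map[OF _ Y_compact Y_haus])
    have "continuous_map Y (prod_topology ?I Y) (\<lambda>y. (s, y))"
      using s by (simp add: continuous_map_pairwise o_def)
    from continuous_map_compose[OF this H(1)] show "continuous_map Y Y (\<lambda>y. H (s, y))" by (simp add: o_def)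
    have lip: "t + s * disp C c d x t < t' + s * disp C c d x t'" if "t < t'" for x t t'
    proof -
      have "s * (disp C c d x t - disp C c d x t') \<le> (t' - t) / 2"
      proof (cases "disp C c d x t - disp C c d x t' \<le> 0")
        case True
        then have "s * (disp C c d x t - disp C c d x t') \<le> 0" using s by (auto simp: mult_le_0_iff)
        also have "0 \<le> (t' - t) / 2" using that by simp
        finally show ?thesis .
      next
        case False
        then have "s * (disp C c d x t - disp C c d x t') \<le> 1 * (disp C c d x t - disp C c d x t')"
          using s by (intro mult_right_mono) auto
        also have "\<dots> \<le> (t' - t) / 2" using disp_lip[OF d(1,2), of t t' C c x] that by simp
        finally show ?thesis .
      qed
      also have "(t' - t) / 2 < t' - t" using that by simp
      finally show ?thesis by (simp add: right_diff_distrib)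
    qed
    show "inj_on (\<lambda>y. H (s, y)) (topspace Y)"
    proof (rule inj_onI)
      fix y y' assume yy: "y \<in> topspace Y" "y' \<in> topspace Y" "H (s, y) = H (s, y')"
      obtain x t where xt: "x \<in> topspace X" "y = cls (x, t)" using yy Y_cases by blast
      obtain x' t' where xt': "x' \<in> topspace X" "y' = cls (x', t')" using yy Y_cases by blast
      have "cls (x, t + s * disp C c d x t) = cls (x', t' + s * disp C c d x' t')"
        using yy(3) Hv[OF s] xt xt' by simp
      then obtain n where n: "x' = it n x" "t' + s * disp C c d x' t' = t + s * disp C c d x t - of_int n"
        using cls_eq_iff[OF xt(1) xt'(1)] by auto
      have "disp C c d x' t' = disp C c d x (t' + of_int n)"
        using disp_inv[OF xt(1), of C c d n "t' + of_int n"] n(1) by simp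
      then have "t' + of_int n + s * disp C c d x (t' + of_int n) = t + s * disp C c d x t" using n(2) by simp
      then have "t' + of_int n = t" using lip[of t "t' + of_int n" x] lip[of "t' + of_int n" t x]
        by (metis less_irrefl linorder_neqE_linordered_idom)
      then show "y = y'" unfolding xt(2) xt'(2) n(1) using cls_it'[OF xt(1), of n t'] by simp
    qed
    show "(\<lambda>y. H (s, y)) ` topspace Y = topspace Y"
    proof
      show "(\<lambda>y. H (s, y)) ` topspace Y \<subseteq> topspace Y"
        using Hv[OF s] by (auto simp: topspace_suspension)
      show "topspace Y \<subseteq> (\<lambda>y. H (s, y)) ` topspace Y"
      proof
        fix y assume "y \<in> topspace Y"
        then obtain x u where xu: "x \<in> topspace X" "y = cls (x, u)" using Y_cases by blast
        have "continuous_map euclideanreal XR (\<lambda>t. (x, t))" using xu by (simp add: continuous_map_pairwise o_def)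
        from continuous_map_compose[OF this disp_cont[OF C d(1,2)]]
        have dc: "continuous_on UNIV (disp C c d x)" by (simp add: o_def)
        \<comment> \<open>The displacement lies between 0 and \<open>d\<close>, which brackets the
          solution.\<close>
        have "\<exists>t. u - d \<le> t \<and> t \<le> u \<and> t + s * disp C c d x t = u"
        proof (rule IVT')
          have "s * disp C c d x (u - d) \<le> 1 * d" using s d(1) disp_le[OF d(1)] by (intro mult_mono) auto
          then show "u - d + s * disp C c d x (u - d) \<le> u" by simp
          show "u \<le> u + s * disp C c d x u" using s by simp
          show "u - d \<le> u" using d by simp
          show "continuous_on {u - d..u} (\<lambda>t. t + s * disp C c d x t)"
            by (intro continuous_intros continuous_on_subset[OF dc]) auto
        qed
        then obtain t where "t + s * disp C c d x t = u" by blast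
        then have "y = H (s, cls (x, t))" using Hv[OF s xu(1)] xu(2) by simp
        then show "y \<in> (\<lambda>y. H (s, y)) ` topspace Y" using xu(1) by auto
      qed
    qed
  qed
  define g where "g = restrict (\<lambda>y. H (1, y)) SY"
  have gv: "g (cls (x, t)) = cls (x, t + disp C c d x t)" if "x \<in> topspace X" for x t
    using Hv[of 1 x t] that by (simp add: g_def)
  have "homotopic_with (homeomorphic_map Y Y) Y Y (\<lambda>y. H (0, y)) (\<lambda>y. H (1, y))"
    unfolding homotopic_with_def by (rule exI[of _ H]) (use H(1) hom in auto)
  then have "homotopic_with (homeomorphic_map Y Y) Y Y id g"
  proof (rule homotopic_with_eq)
    fix y assume y: "y \<in> SY"
    then obtain x t where "x \<in> topspace X" "y = cls (x, t)" using Y_cases by blast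
    then show "id y = H (0, y)" using Hv[of 0 x t] by simp
    show "g y = H (1, y)" using y by (simp add: g_def)
  next
    fix h k :: "('a \<times> real) set \<Rightarrow> ('a \<times> real) set" assume "\<And>y. y \<in> SY \<Longrightarrow> h y = k y"
    then show "homeomorphic_map Y Y h = homeomorphic_map Y Y k" by (metis homeomorphic_map_eq)
  qed
  moreover have "g \<in> Bij SY"
    using hom[of 1] unfolding g_def Bij_def homeomorphic_eq_everything_map
    by (auto simp: bij_betw_def inj_on_def)
  ultimately have "g \<in> H0 X \<phi>" by (simp add: H0_def)
  moreover have "local_form g"
    unfolding local_form_def
  proof (intro ballI allI)
    fix x0 t0 assume x0: "x0 \<in> topspace X"
    let ?n = "\<lfloor>t0 - c\<rfloor>"
    let ?U = "if it ?n x0 \<in> C then {x \<in> topspace X. it ?n x \<in> C} else {x \<in> topspace X. it ?n x \<in> topspace X - C}"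
    let ?f = "\<lambda>t. if it ?n x0 \<in> C then (t + - of_int ?n + bump c d (t + - of_int ?n)) + of_int ?n else t"
    have "openin X {x \<in> topspace X. it ?n x \<in> C}" "openin X {x \<in> topspace X. it ?n x \<in> topspace X - C}"
      by (intro openin_continuous_map_preimage[OF it_cont] C openin_diff openin_topspace)+
    then have "openin X ?U" by simp
    moreover have "x0 \<in> ?U" using x0 it_in by auto
    moreover have "dgerm ?f t0"
    proof (cases "it ?n x0 \<in> C")
      case True
      have "dgerm (\<lambda>t. t + - of_int ?n) t0" by (rule dgerm_shift) (auto intro: dyadic_minus)
      from dgerm_comp[OF dgerm_comp[OF this dgerm_bump[OF d(3,4,1)]] dgerm_shift[OF dyadic_of_int[of ?n]]]
      have "dgerm (\<lambda>t. t + - of_int ?n + bump c d (t + - of_int ?n) + of_int ?n) t0" .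
      then show ?thesis using True by simp
    qed (simp add: dgerm_id)
    moreover have "\<forall>\<^sub>F t in nhds t0. \<forall>x\<in>?U. g (cls (x, t)) = cls (x, ?f t)"
    proof -
      have "\<forall>\<^sub>F t in nhds t0. t \<in> {c + of_int ?n - (1 - 4 * d)<..<c + of_int ?n + 1}"
      proof (intro eventually_nhds_in_open)
        show "t0 \<in> {c + of_int ?n - (1 - 4 * d)<..<c + of_int ?n + 1}"
          unfolding greaterThanLessThan_iff by (intro conjI; use d in linarith)
      qed auto
      then show ?thesis
      proof eventually_elim
        case (elim t)
        then have "disp C c d x t = (if it ?n x \<in> C then bump c d (t - of_int ?n) else 0)" for x
          by (intro disp_slab) (use d in auto)
        then show ?case using gv by (auto split: if_splits)
      qed
    qed
    ultimately show "\<exists>U f. openin X U \<and> x0 \<in> U \<and> dgerm f t0 \<and>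
       (\<forall>\<^sub>F t in nhds t0. \<forall>x\<in>U. g (cls (x, t)) = cls (x, f t))" by blast
  qed
  ultimately show ?thesis using that gv T_set_iff by blast
qed

end

text \<open>A time shift returns a point to itself only if it is an integer. Near any base value
  \<open>a\<close> this happens at most at \<open>a\<close>, so a germ of slope other than 1 moves
  all points close to, but different from, its centre.\<close>

lemma add_not_Ints_near:
  fixes a :: real
  obtains e where "e > 0" "\<And>u. u \<noteq> 0 \<Longrightarrow> \<bar>u\<bar> < e \<Longrightarrow> a + u \<notin> \<int>"
proof (cases "a \<in> \<int>")
  case True
  have "a + u \<notin> \<int>" if "u \<noteq> 0" "\<bar>u\<bar> < 1" for u
  proof
    assume "a + u \<in> \<int>"
    then have "a + u - a \<in> \<int>" using True by (rule Ints_diff)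
    then obtain n where "u = of_int n" by (auto elim: Ints_cases)
    then show False using that by auto
  qed
  then show ?thesis using that[of 1] by auto
next
  case False
  define e where "e = min (a - of_int \<lfloor>a\<rfloor>) (of_int \<lfloor>a\<rfloor> + 1 - a)"
  have "a \<noteq> of_int \<lfloor>a\<rfloor>" using False by (metis Ints_of_int)
  then have "e > 0" unfolding e_def by linarith
  moreover have "a + u \<notin> \<int>" if "\<bar>u\<bar> < e" for u
  proof
    assume "a + u \<in> \<int>"
    then obtain n where n: "a + u = of_int n" by (auto elim: Ints_cases)
    then have "of_int \<lfloor>a\<rfloor> < (of_int n :: real)" "(of_int n :: real) < of_int \<lfloor>a\<rfloor> + 1"
      using that unfolding e_def by linarith+
    then have "\<lfloor>a\<rfloor> < n" "n < \<lfloor>a\<rfloor> + 1" by linarith+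
    then show False by simp
  qed
  ultimately show ?thesis using that by blast
qed

section \<open>The reconstruction axioms for \<open>T_group\<close>\<close>

context stone
begin

lemma bump_elt_values:
  assumes d: "d > 0" "4 * d < 1" and g: "\<And>x t. x \<in> topspace X \<Longrightarrow> g (cls (x, t)) = cls (x, t + disp C c d x t)"
    and x: "x \<in> topspace X" and t: "c \<le> t" "t < c + 1"
  shows "g (cls (x, t)) = cls (x, t + (if x \<in> C then bump c d t else 0))"
    and "g (cls (x, t)) = cls (x, t) \<longleftrightarrow> \<not> (x \<in> C \<and> c < t \<and> t < c + 4 * d)"
proof -
  have "disp C c d x t = (if x \<in> C then bump c d t else 0)"
    using disp_slab[OF d, of c 0 t C x] t d by simp
  then show 1: "g (cls (x, t)) = cls (x, t + (if x \<in> C then bump c d t else 0))" using g[OF x] by simp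
  have b: "bump c d t \<noteq> 0 \<longleftrightarrow> c < t \<and> t < c + 4 * d"
    using bump_pos[of d c t] bump_zero[of d t c] d by force
  have "cls (x, t + bump c d t) = cls (x, t) \<longleftrightarrow> bump c d t = 0"
    using cls_eq_close(2)[OF x x, of "t + bump c d t" t] bump_le[OF d(1), of c t] d by auto
  then show "g (cls (x, t)) = cls (x, t) \<longleftrightarrow> \<not> (x \<in> C \<and> c < t \<and> t < c + 4 * d)"
    unfolding 1 using b by auto
qed

lemma bump_supp:
  assumes d: "d > 0" "4 * d < 1" and g: "\<And>x t. x \<in> topspace X \<Longrightarrow> g (cls (x, t)) = cls (x, t + disp C c d x t)"
  shows "{y \<in> topspace Y. g y \<noteq> y} \<subseteq> cls ` (C \<times> {c<..<c + 4 * d})"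
proof
  fix y assume y: "y \<in> {y \<in> topspace Y. g y \<noteq> y}"
  then obtain x t where xt: "x \<in> topspace X" "y = cls (x, t)" "c \<le> t" "t < c + 1" using Y_cases_near[of y c] by blast
  then have "x \<in> C \<and> c < t \<and> t < c + 4 * d" using bump_elt_values(2)[OF d g xt(1,3,4)] y by blast
  then show "y \<in> cls ` (C \<times> {c<..<c + 4 * d})" using xt by auto
qed

text \<open>The time \<open>t0\<close> is put into the second quarter of the bump interval, where
  \<open>bump c d\<close> has its full height \<open>d\<close> and acts as a translation.\<close>

lemma small_chart:
  assumes U: "openin Y U" and y: "y \<in> U"
  obtains x0 t0 C c d where "openin X C" "closedin X C" "x0 \<in> C" "y = cls (x0, t0)" "d > 0" "4 * d < 1"
    "dyadic c" "dyadic d" "c + d < t0" "t0 < c + 2 * d" "cls ` (C \<times> {c<..<c + 4 * d}) \<subseteq> U"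
proof -
  have "y \<in> topspace Y" using U y openin_subset by blast
  then obtain x0 t0 where xt: "x0 \<in> topspace X" "y = cls (x0, t0)" using Y_cases by blast
  obtain C e where C: "openin X C" "closedin X C" "x0 \<in> C" "e > 0" "cls ` (C \<times> {t0 - e<..<t0 + e}) \<subseteq> U"
    using Y_box_basis[OF U _ xt(1), of t0] y xt(2) by blast
  obtain d where d: "dyadic d" "0 < d" "d < min e 1 / 4" using dyadic_dense[of 0 "min e 1 / 4"] C(4) by auto
  obtain c where c: "dyadic c" "t0 - 2 * d < c" "c < t0 - d" using dyadic_dense[of "t0 - 2 * d" "t0 - d"] d by auto
  have d4: "4 * d < e" "4 * d < 1" using d(3) by (simp_all add: min_def split: if_splits)
  have "{c<..<c + 4 * d} \<subseteq> {t0 - e<..<t0 + e}"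
  proof
    fix t assume "t \<in> {c<..<c + 4 * d}"
    then show "t \<in> {t0 - e<..<t0 + e}" using c d4 d(2) unfolding greaterThanLessThan_iff by linarith
  qed
  then have "cls ` (C \<times> {c<..<c + 4 * d}) \<subseteq> U" using C(5) by blast
  moreover have "c + d < t0" "t0 < c + 2 * d" using c by linarith+
  ultimately show ?thesis using that[OF C(1-3) xt(2) d(2) d4(2) c(1) d(1)] by blast
qed

lemma T_pow:
  assumes g: "g \<in> T_set X \<phi>" and y: "y \<in> topspace Y"
  shows "(g [^]\<^bsub>T_group X \<phi>\<^esub> (n::nat)) y = (g ^^ n) y \<and> (g ^^ n) y \<in> topspace Y"
  using y
proof (induction n arbitrary: y)
  case 0
  then show ?case by (simp add: T_one)
next
  case (Suc n)
  interpret G: group "T_group X \<phi>" by (rule T_group)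
  have "g y \<in> topspace Y" using homeomorphic_imp_surjective_map[OF T_homeo[OF g]] Suc.prems by blast
  moreover have "g [^]\<^bsub>T_group X \<phi>\<^esub> n \<in> T_set X \<phi>" using G.nat_pow_closed[of g n] g by simp
  ultimately show ?case using Suc g by (simp add: T_mult compose_def funpow_swap1)
qed

text \<open>Under a bump element the time of \<open>y\<close> increases strictly and stays below
  \<open>c + 4 * d\<close>. All these times lie within less than 1 of each other, so the twelfth
  iterate is a different point.\<close>

lemma T_micro:
  assumes U: "openin Y U" "U \<noteq> {}"
  shows "\<exists>g\<in>T_set X \<phi>. {y \<in> topspace Y. g y \<noteq> y} \<subseteq> U \<and> g [^]\<^bsub>T_group X \<phi>\<^esub> (12::nat) \<noteq> \<one>\<^bsub>T_group X \<phi>\<^esub>"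
proof -
  obtain y where "y \<in> U" using U by blast
  then obtain x0 t0 C c d where C: "openin X C" "closedin X C" "x0 \<in> C" "y = cls (x0, t0)" "d > 0" "4 * d < 1"
    "dyadic c" "dyadic d" "c + d < t0" "t0 < c + 2 * d" "cls ` (C \<times> {c<..<c + 4 * d}) \<subseteq> U"
    using small_chart[OF U(1)] by metis
  obtain g where g: "g \<in> T_set X \<phi>" "\<And>x t. x \<in> topspace X \<Longrightarrow> g (cls (x, t)) = cls (x, t + disp C c d x t)"
    using bump_elt[OF C(1,2,5,6,7,8)] by metis
  have x0: "x0 \<in> topspace X" using C(1,3) openin_subset by blast
  have "\<exists>t. (g ^^ n) y = cls (x0, t) \<and> t0 \<le> t \<and> t < c + 4 * d \<and> (n > 0 \<longrightarrow> t0 < t)" for n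
  proof (induction n)
    case 0
    then show ?case using C by (intro exI[of _ t0]) auto
  next
    case (Suc n)
    then obtain t where t: "(g ^^ n) y = cls (x0, t)" "t0 \<le> t" "t < c + 4 * d" by blast
    have "(g ^^ Suc n) y = cls (x0, t + bump c d t)"
      using bump_elt_values(1)[OF C(5,6) g(2) x0, of t] t C by simp
    moreover have "0 < bump c d t" "t + bump c d t < c + 4 * d"
      using bump_pos[of d c t] bump_less[of d t c] t C by auto
    ultimately show ?case using t(2) by (intro exI[of _ "t + bump c d t"]) auto
  qed
  from this[of 12] obtain t where t: "(g ^^ 12) y = cls (x0, t)" "t0 < t" "t < c + 4 * d" by auto
  have "cls (x0, t) \<noteq> cls (x0, t0)" using cls_eq_close(2)[OF x0 x0, of t t0] t C by auto
  moreover have "y \<in> topspace Y" using C(4) x0 by simp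
  ultimately have "(g [^]\<^bsub>T_group X \<phi>\<^esub> (12::nat)) y \<noteq> \<one>\<^bsub>T_group X \<phi>\<^esub> y"
    using T_pow[OF g(1), of y 12] t(1) C(4) by (simp add: T_one)
  then have "g [^]\<^bsub>T_group X \<phi>\<^esub> (12::nat) \<noteq> \<one>\<^bsub>T_group X \<phi>\<^esub>" by metis
  moreover have "{y \<in> topspace Y. g y \<noteq> y} \<subseteq> U" using bump_supp[OF C(5,6) g(2)] C(11) by blast
  ultimately show ?thesis using g(1) by blast
qed

text \<open>\<open>k\<close> is a bump over exactly the second quarter of the interval of
  \<open>r\<close>, hence the parameter \<open>d / 4\<close>; \<open>r\<close> translates that
  quarter by \<open>d\<close> onto the third, where \<open>k\<close> is the identity.\<close>

lemma T_displaceable: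
  assumes U: "openin Y U" "y \<in> U"
  shows "\<exists>k\<in>T_set X \<phi>. \<exists>r\<in>T_set X \<phi>. k y \<noteq> y \<and> {y \<in> topspace Y. r y \<noteq> y} \<subseteq> U \<and>
      (\<forall>z\<in>topspace Y. k z \<noteq> z \<longrightarrow> k (r z) = r z)"
proof -
  obtain x0 t0 C c d where C: "openin X C" "closedin X C" "x0 \<in> C" "y = cls (x0, t0)" "d > 0" "4 * d < 1"
    "dyadic c" "dyadic d" "c + d < t0" "t0 < c + 2 * d" "cls ` (C \<times> {c<..<c + 4 * d}) \<subseteq> U"
    using small_chart[OF U] by metis
  have x0: "x0 \<in> topspace X" using C(1,3) openin_subset by blast
  obtain r where r: "r \<in> T_set X \<phi>" "\<And>x t. x \<in> topspace X \<Longrightarrow> r (cls (x, t)) = cls (x, t + disp C c d x t)"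
    using bump_elt[OF C(1,2,5,6,7,8)] by metis
  have d': "d / 4 > 0" "4 * (d / 4) < 1" "dyadic (c + d)" "dyadic (d / 4)"
    using C pow2_dyadic[OF pow2_inverse[OF pow2_power[of 2]]] dyadic_mult[of "1/4" d] by auto
  obtain k where k: "k \<in> T_set X \<phi>" "\<And>x t. x \<in> topspace X \<Longrightarrow> k (cls (x, t)) = cls (x, t + disp C (c + d) (d / 4) x t)"
    using bump_elt[OF C(1,2) d'] by metis
  have "k y \<noteq> y" using bump_elt_values(2)[OF d'(1,2) k(2) x0, of t0] C by simp
  moreover have "{y \<in> topspace Y. r y \<noteq> y} \<subseteq> U" using bump_supp[OF C(5,6) r(2)] C(11) by blast
  moreover have "k (r z) = r z" if z: "z \<in> topspace Y" "k z \<noteq> z" for z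
  proof -
    have "z \<in> cls ` (C \<times> {c + d<..<c + d + 4 * (d / 4)})" using bump_supp[OF d'(1,2) k(2)] z by blast
    then obtain x t where xt: "x \<in> C" "z = cls (x, t)" "c + d < t" "t < c + 2 * d" by auto
    have x: "x \<in> topspace X" using xt(1) C(1) openin_subset by blast
    have "r z = cls (x, t + d)"
      using bump_elt_values(1)[OF C(5,6) r(2) x, of t] xt C bump_mid[of c d t] by simp
    moreover have "k (cls (x, t + d)) = cls (x, t + d)"
      using bump_elt_values(2)[OF d'(1,2) k(2) x, of "t + d"] xt C by simp
    ultimately show ?thesis by simp
  qed
  ultimately show ?thesis using k(1) r(1) by blast
qed

text \<open>An orbit point in \<open>W\<close> is fixed by \<open>it m\<close>; powers of
  \<open>\<phi>\<close> commute, so the whole dense orbit is fixed, and the fixed set is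
  closed.\<close>

lemma fix_dense:
  assumes dense: "has_dense_orbit X \<phi>" and W: "openin X W" "W \<noteq> {}" "\<forall>x\<in>W. it m x = x"
    and x: "x \<in> topspace X"
  shows "it m x = x"
proof -
  obtain z where z: "z \<in> topspace X" "X closure_of (range (\<lambda>n. it n z)) = topspace X"
    using dense unfolding has_dense_orbit_def by blast
  have "W \<inter> X closure_of (range (\<lambda>n. it n z)) \<noteq> {}" using z(2) W openin_subset by blast
  then obtain j where "it j z \<in> W" using openin_Int_closure_of_eq_empty[OF W(1)] by blast
  then have "it m (it j z) = it j z" using W(3) by blast
  then have "it j (it m z) = it j z" using it_add[OF z(1), of m j] it_add[OF z(1), of j m] by (simp add: add.commute)
  then have mz: "it m z = z" using it_inj[of "it m z" z j] z(1) it_in by blast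
  have "it m (it n z) = it n z" for n
    using it_add[OF z(1), of m n] it_add[OF z(1), of n m] mz by (simp add: add.commute)
  then have "range (\<lambda>n. it n z) \<subseteq> {x \<in> topspace X. it m x = x}" using it_in[OF z(1)] by blast
  moreover have "closedin X {x \<in> topspace X. it m x = x}"
    using closedin_continuous_maps_eq[OF haus it_cont continuous_map_id] by simp
  ultimately have "X closure_of (range (\<lambda>n. it n z)) \<subseteq> {x \<in> topspace X. it m x = x}"
    by (rule closure_of_minimal)
  then show ?thesis using z(2) x by blast
qed

text \<open>Near \<open>y\<close>, on at least one side along the flow, \<open>k\<close> is not the identity. If it is an affine map other than
  an integer translation there, it moves all nearby points of that side; if it is the translation by \<open>m\<close> with
  \<open>\<phi>\<^sup>m \<noteq> id\<close>, it moves \<open>[x,t]\<close> unless \<open>\<phi>\<^sup>m x = x\<close>, and such \<open>x\<close> are nowhere dense. As \<open>r\<close> preserves the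
  sides of \<open>y\<close>, suitable points of the moved side close to \<open>y\<close> are sent to that side.\<close>

lemma T_fixed_not_displaced:
  assumes dense: "has_dense_orbit X \<phi>" and k: "k \<in> T_set X \<phi>" and r: "r \<in> T_set X \<phi>"
    and y: "y \<in> Y closure_of {y \<in> topspace Y. k y \<noteq> y}" and ry: "r y = y"
  shows "\<exists>z\<in>topspace Y. k z \<noteq> z \<and> k (r z) \<noteq> r z"
proof -
  have yY: "y \<in> topspace Y" using subsetD[OF closure_of_subset_topspace y] .
  then obtain x0 t0 where xt: "x0 \<in> topspace X" "y = cls (x0, t0)" using Y_cases by blast
  have "local_form k" "local_form r" using k r T_set_iff by blast+
  obtain C f where C: "openin X C" "x0 \<in> C" "C \<subseteq> topspace X" "dgerm f t0"
    "\<forall>\<^sub>F t in nhds t0. \<forall>x\<in>C. k (cls (x, t)) = cls (x, f t)" by (rule local_formE[OF \<open>local_form k\<close> xt(1)])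
  obtain C2 f2 where C2: "openin X C2" "x0 \<in> C2" "C2 \<subseteq> topspace X" "dgerm f2 t0"
    "\<forall>\<^sub>F t in nhds t0. \<forall>x\<in>C2. r (cls (x, t)) = cls (x, f2 t)" by (rule local_formE[OF \<open>local_form r\<close> xt(1)])
  obtain l l' where l: "l > 0" "l' > 0" "\<forall>\<^sub>F t in nhds t0. f t = aff2 (f t0) l l' t0 t" using C(4) by (rule dgermE)
  obtain p p' where p: "p > 0" "p' > 0" "\<forall>\<^sub>F t in nhds t0. f2 t = aff2 (f2 t0) p p' t0 t" using C2(4) by (rule dgermE)
  have "\<forall>\<^sub>F t in nhds t0. (\<forall>x\<in>C. k (cls (x, t)) = cls (x, aff2 (f t0) l l' t0 t)) \<and>
     (\<forall>x\<in>C2. r (cls (x, t)) = cls (x, aff2 (f2 t0) p p' t0 t))"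
    using C(5) C2(5) l(3) p(3) by eventually_elim simp
  then obtain e where e: "e > 0" "\<And>t x. \<bar>t - t0\<bar> < e \<Longrightarrow> x \<in> C \<Longrightarrow> k (cls (x, t)) = cls (x, aff2 (f t0) l l' t0 t)"
     "\<And>t x. \<bar>t - t0\<bar> < e \<Longrightarrow> x \<in> C2 \<Longrightarrow> r (cls (x, t)) = cls (x, aff2 (f2 t0) p p' t0 t)"
    unfolding eventually_nhds_metric dist_real_def by blast
  let ?v = "f t0"
  \<comment> \<open>On a side where the germ of \<open>k\<close> has slope \<open>\<rho>\<close>,
    this says that \<open>k\<close> acts there as the identity: a translation of time by
    \<open>n\<close> is undone by \<open>\<phi>^n\<close>.\<close>
  define trivial where "trivial \<rho> \<longleftrightarrow> \<rho> = (1::real) \<and> (\<exists>n. ?v - t0 = of_int n \<and> (\<forall>x\<in>topspace X. it n x = x))" for \<rho>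
  \<comment> \<open>\<open>\<sigma>\<close> selects a side of \<open>t0\<close>, with slopes
    \<open>\<rho>\<close> of \<open>k\<close> and \<open>\<pi>\<close> of \<open>r\<close>. If both
    sides were trivial, \<open>k\<close> would be the identity on a box around \<open>y\<close>,
    against the choice of \<open>y\<close> in the closed support.\<close>
  have "\<exists>\<sigma> \<rho> \<pi>. \<not> trivial \<rho> \<and> \<sigma> \<in> {-1, 1} \<and> \<rho> > 0 \<and> \<pi> > 0 \<and>
      (\<forall>s>0. aff2 ?v l l' t0 (t0 + \<sigma> * s) = ?v + \<sigma> * (\<rho> * s)) \<and>
      (\<forall>s>0. aff2 (f2 t0) p p' t0 (t0 + \<sigma> * s) = f2 t0 + \<sigma> * (\<pi> * s))"
  proof (cases "trivial l")
    case False
    then show ?thesis using l p by (intro exI[of _ "-1"] exI[of _ l] exI[of _ p]) (simp add: aff2_def)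
  next
    case True
    then obtain n where n: "l = 1" "?v - t0 = of_int n" "\<forall>x\<in>topspace X. it n x = x" by (auto simp: trivial_def)
    have "\<not> trivial l'"
    proof
      assume "trivial l'"
      then have l'1: "l' = 1" by (simp add: trivial_def)
      have fixed: "k (cls (x, t)) = cls (x, t)" if "x \<in> C" "\<bar>t - t0\<bar> < e" for x t
      proof -
        have "?v = t0 + of_int n" using n(2) by simp
        then have "k (cls (x, t)) = cls (x, t + of_int n)" using e(2)[OF that(2,1)] n(1) l'1
          by (simp add: aff2_def add.commute)
        also have "\<dots> = cls (it n x, t)" using cls_it' that C by auto
        finally show ?thesis using n(3) that C by auto
      qed
      let ?B = "cls ` (C \<times> {t0 - e<..<t0 + e})"
      have B: "openin Y ?B" using C(1) by (intro cls_box_open) auto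
      have "k z = z" if zB: "z \<in> ?B" for z
      proof -
        obtain x t where "x \<in> C" "z = cls (x, t)" "t0 - e < t" "t < t0 + e" using zB by auto
        moreover from this have "\<bar>t - t0\<bar> < e" by linarith
        ultimately show ?thesis using fixed by simp
      qed
      then have "?B \<inter> {y \<in> topspace Y. k y \<noteq> y} = {}" by auto
      then have "?B \<inter> Y closure_of {y \<in> topspace Y. k y \<noteq> y} = {}"
        using openin_Int_closure_of_eq_empty[OF B] by simp
      moreover have "y \<in> ?B" using xt C e(1) by auto
      ultimately show False using y by auto
    qed
    then show ?thesis using l p by (intro exI[of _ "1"] exI[of _ l'] exI[of _ p']) (simp add: aff2_def)
  qed
  then obtain \<sigma> \<rho> \<pi> where \<sigma>: "\<not> trivial \<rho>" "\<sigma> = -1 \<or> \<sigma> = 1" "\<rho> > 0" "\<pi> > 0"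
      "\<And>s. s > 0 \<Longrightarrow> aff2 ?v l l' t0 (t0 + \<sigma> * s) = ?v + \<sigma> * (\<rho> * s)"
      "\<And>s. s > 0 \<Longrightarrow> aff2 (f2 t0) p p' t0 (t0 + \<sigma> * s) = f2 t0 + \<sigma> * (\<pi> * s)" by blast
  have abs\<sigma>: "\<bar>\<sigma> * u\<bar> = \<bar>u\<bar>" for u using \<sigma>(2) by (auto simp: abs_mult)
  have "cls (x0, t0) = cls (x0, f2 t0)"
    using e(3)[of t0 x0] e(1) C2(2) ry xt(2) by simp
  \<comment> \<open>\<open>r\<close> fixes \<open>y\<close> only as a class: its germ may shift the
    time by an integer which a power of \<open>\<phi>\<close> fixing \<open>x0\<close>
    absorbs.\<close>
  then obtain n where n: "x0 = it n x0" "f2 t0 = t0 - of_int n" using cls_eq_iff[OF xt(1) xt(1)] by auto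
  have n': "it (- n) x0 = x0" using it_inverse(1)[OF xt(1), of n] n(1) by simp
  \<comment> \<open>After \<open>r\<close> the transversal coordinate is \<open>it (- n) x\<close>,
    so it has to lie in the transversal \<open>C\<close> of \<open>k\<close> as well.\<close>
  let ?W = "C \<inter> C2 \<inter> {x \<in> topspace X. it (- n) x \<in> C}"
  have W: "openin X ?W" using openin_continuous_map_preimage[OF it_cont C(1)] C(1) C2(1) by blast
  have x0W: "x0 \<in> ?W" using C C2 xt n' by auto
  \<comment> \<open>If \<open>k\<close> translates this side by an integer \<open>m\<close>, a point
    is moved only when \<open>it m\<close> moves its transversal coordinate; by
    \<open>fix_dense\<close> such coordinates occur in every nonempty open set.\<close>
  obtain x1 where x1: "x1 \<in> ?W" "\<And>m. \<rho> = 1 \<Longrightarrow> ?v - t0 = of_int m \<Longrightarrow> it m x1 \<noteq> x1"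
  proof (cases "\<rho> = 1 \<and> (\<exists>m. ?v - t0 = of_int m)")
    case True
    then obtain m where m: "?v - t0 = of_int m" by blast
    have "\<exists>x\<in>?W. it m x \<noteq> x"
    proof (rule ccontr)
      assume "\<not> ?thesis"
      then have "it m x = x" if "x \<in> topspace X" for x using fix_dense[OF dense W] x0W that by blast
      then show False using \<sigma>(1) True m unfolding trivial_def by blast
    qed
    then show ?thesis using that m by auto
  qed (use that x0W in blast)
  obtain e' where e': "e' > 0" "\<And>u. u \<noteq> 0 \<Longrightarrow> \<bar>u\<bar> < e' \<Longrightarrow> (?v - t0) + u \<notin> \<int>"
    using add_not_Ints_near by metis
  have moved: "k (cls (x, t0 + \<sigma> * s)) \<noteq> cls (x, t0 + \<sigma> * s)"
    if x: "x \<in> C" "\<And>m. \<rho> = 1 \<Longrightarrow> ?v - t0 = of_int m \<Longrightarrow> it m x \<noteq> x"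
      and s: "0 < s" "s < e" "\<bar>\<rho> - 1\<bar> * s < e'" for x s
  proof
    have xX: "x \<in> topspace X" using x(1) C by blast
    assume "k (cls (x, t0 + \<sigma> * s)) = cls (x, t0 + \<sigma> * s)"
    moreover have "k (cls (x, t0 + \<sigma> * s)) = cls (x, ?v + \<sigma> * (\<rho> * s))"
      using e(2)[of "t0 + \<sigma> * s" x] x(1) s \<sigma>(5) abs\<sigma> by simp
    ultimately obtain m where m: "x = it m x" "t0 + \<sigma> * s = ?v + \<sigma> * (\<rho> * s) - of_int m"
      using cls_eq_iff[OF xX xX] by metis
    then have eq: "(?v - t0) + \<sigma> * ((\<rho> - 1) * s) = of_int m" by (simp add: algebra_simps)
    show False
    proof (cases "\<rho> = 1")
      case True
      then show False using x(2)[of m] eq m(1) by simp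
    next
      case False
      have "\<sigma> * ((\<rho> - 1) * s) \<noteq> 0" using False s \<sigma>(2) by auto
      moreover have "\<bar>\<sigma> * ((\<rho> - 1) * s)\<bar> < e'" using s unfolding abs\<sigma> by (simp add: abs_mult)
      ultimately have "(?v - t0) + \<sigma> * ((\<rho> - 1) * s) \<notin> \<int>" by (rule e'(2))
      then show False using eq by simp
    qed
  qed
  \<comment> \<open>\<open>B\<close> dominates 1, \<open>\<pi>\<close>,
    \<open>\<bar>\<rho> - 1\<bar>\<close> and \<open>\<bar>\<rho> - 1\<bar> * \<pi>\<close>, so one
    choice of \<open>s\<close> meets the bounds of \<open>moved\<close> for \<open>s\<close> and for
    \<open>\<pi> * s\<close>.\<close>
  define B where "B = (1 + \<bar>\<rho> - 1\<bar>) * (1 + \<pi>)"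
  define s where "s = min e e' / (2 * B)"
  have B: "B > 0" "1 \<le> B" "\<pi> \<le> B" "\<bar>\<rho> - 1\<bar> \<le> B" "\<bar>\<rho> - 1\<bar> * \<pi> \<le> B"
    using \<sigma>(4) unfolding B_def by (simp_all add: algebra_simps add_pos_nonneg)
  have s0: "s > 0" using e(1) e'(1) B(1) by (simp add: s_def)
  have "B * s = min e e' / 2" using B(1) by (simp add: s_def)
  moreover have "min e e' > 0" using e(1) e'(1) by simp
  ultimately have Bs: "B * s < min e e'" by linarith
  have bound: "a * s < min e e'" if "a \<le> B" for a
    using mult_right_mono[OF that, of s] s0 Bs by linarith
  have s: "s < e" "\<bar>\<rho> - 1\<bar> * s < e'" "\<pi> * s < e" "\<bar>\<rho> - 1\<bar> * (\<pi> * s) < e'"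
    using bound[of 1] bound[of \<pi>] bound[of "\<bar>\<rho> - 1\<bar>"] bound[of "\<bar>\<rho> - 1\<bar> * \<pi>"] B by (simp_all add: mult.assoc)
  have x1X: "x1 \<in> topspace X" using x1(1) by blast
  define z where "z = cls (x1, t0 + \<sigma> * s)"
  have "k z \<noteq> z" unfolding z_def using moved[of x1 s] x1 s0 s by blast
  moreover have "r z = cls (it (- n) x1, t0 + \<sigma> * (\<pi> * s))"
  proof -
    have "r z = cls (x1, t0 - of_int n + \<sigma> * (\<pi> * s))"
      unfolding z_def using e(3)[of "t0 + \<sigma> * s" x1] x1(1) s s0 \<sigma>(6)[OF s0] abs\<sigma> n(2) by simp
    then show ?thesis using cls_it'[OF x1X, of "- n" "t0 + \<sigma> * (\<pi> * s)"] by (simp add: algebra_simps)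
  qed
  moreover have "k (cls (it (- n) x1, t0 + \<sigma> * (\<pi> * s))) \<noteq> cls (it (- n) x1, t0 + \<sigma> * (\<pi> * s))"
  proof (rule moved)
    show "it (- n) x1 \<in> C" using x1(1) by blast
    fix m assume m: "\<rho> = 1" "?v - t0 = of_int m"
    show "it m (it (- n) x1) \<noteq> it (- n) x1"
    proof
      assume "it m (it (- n) x1) = it (- n) x1"
      then have "it (- n) (it m x1) = it (- n) x1"
        using it_add[OF x1X, of m "- n"] it_add[OF x1X, of "- n" m] by (simp add: add.commute)
      then show False using it_inj[OF it_in[OF x1X] x1X] x1(2) m by blast
    qed
  qed (use s s0 \<sigma>(4) in auto)
  ultimately show ?thesis unfolding z_def using x1X by auto
qed

lemma T_rubin_action:
  assumes dense: "has_dense_orbit X \<phi>"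
  shows "rubin_action (T_group X \<phi>) Y (\<lambda>g. g)"
proof -
  interpret G: group "T_group X \<phi>" by (rule T_group)
  show ?thesis
  proof (unfold_locales, goal_cases)
    case 1 show ?case by (rule Y_compact)
  next
    case 2 show ?case by (rule Y_haus)
  next
    case (3 g) then show ?case using T_homeo by simp
  next
    case (4 g h y) then show ?case by (simp add: T_mult compose_def)
  next
    case (5 g)
    have "g = (\<lambda>y\<in>SY. y)"
      by (rule extensionalityI[of _ SY]) (use 5 T_ext in auto)
    then show ?case by (simp add: T_one)
  next
    case (6 U) then show ?case using T_micro by simp
  next
    case (7 k r y) then show ?case using T_fixed_not_displaced[OF dense] by simp
  next
    case (8 U y) then show ?case using T_displaceable by simp
  qed
qed

end

lemma T_iso_homeomorphic:
  assumes "stone X1 \<phi>1" "stone X2 \<phi>2" "has_dense_orbit X1 \<phi>1" "has_dense_orbit X2 \<phi>2"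
    and "T_group X1 \<phi>1 \<cong> T_group X2 \<phi>2"
  shows "suspension X1 \<phi>1 homeomorphic_space suspension X2 \<phi>2"
  using assms rubin_homeomorphic[OF stone.T_rubin_action stone.T_rubin_action] unfolding is_iso_def by blast

section \<open>Lifting maps between suspensions to the flow lines\<close>

text \<open>The covering of the circle with period 1, matching the integer action on time;
  \<open>turn\<close> is its inverse branch with values in the half-open interval from -1/2 to
  1/2.\<close>

definition turn_cis :: "real \<Rightarrow> complex" where "turn_cis t = cis (2 * pi * t)"

definition turn :: "complex \<Rightarrow> real" where "turn z = Arg z / (2 * pi)"

lemma turn_cis_add: "turn_cis (s + t) = turn_cis s * turn_cis t"
  by (simp add: turn_cis_def cis_mult distrib_left)

lemma turn_cis_cnj: "cnj (turn_cis t) = turn_cis (- t)"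
  by (simp add: turn_cis_def cis_cnj)

lemma norm_1_cnj: "norm z = 1 \<Longrightarrow> z * cnj z = 1"
  using complex_norm_square[of z] by simp

lemma turn_cis_diff: "turn_cis (s - t) = turn_cis s * cnj (turn_cis t)"
  using turn_cis_add[of s "- t"] by (simp add: turn_cis_cnj)

lemma turn_cis_norm [simp]: "norm (turn_cis t) = 1" by (simp add: turn_cis_def)

lemma turn_cis_0 [simp]: "turn_cis 0 = 1" by (simp add: turn_cis_def)

lemma turn_cis_int [simp]: "turn_cis (of_int n) = 1"
  unfolding turn_cis_def using cis_multiple_2pi[of "of_int n"] by (simp add: mult.commute mult.left_commute)

lemma turn_cis_eq: "turn_cis s = turn_cis t \<longleftrightarrow> (\<exists>n::int. t = s - of_int n)"
proof
  assume "turn_cis s = turn_cis t"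
  then have "exp (\<i> * of_real (2 * pi * s)) = exp (\<i> * of_real (2 * pi * t))"
    by (simp add: turn_cis_def cis_conv_exp)
  then obtain n :: int where "\<i> * of_real (2 * pi * s) = \<i> * of_real (2 * pi * t) + (of_int (2 * n) * pi) * \<i>"
    unfolding exp_eq by blast
  from arg_cong[OF this, of Im] have "2 * pi * s = 2 * pi * t + of_int (2 * n) * pi" by simp
  then have "(2 * pi) * s = (2 * pi) * (t + of_int n)" by (simp add: algebra_simps)
  then have "s = t + of_int n" using pi_neq_zero by (metis mult_cancel_left mult_eq_0_iff zero_neq_numeral)
  then show "\<exists>n::int. t = s - of_int n" by (intro exI[of _ n]) simp
next
  assume "\<exists>n::int. t = s - of_int n"
  then obtain n :: int where "s = t + of_int n" by (auto simp: algebra_simps)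
  then show "turn_cis s = turn_cis t" by (simp add: turn_cis_add)
qed

lemma turn_turn_cis: "\<bar>s\<bar> < 1/2 \<Longrightarrow> turn (turn_cis s) = s"
proof -
  assume s: "\<bar>s\<bar> < 1/2"
  have "pi * (2 * s) < pi * 1" "pi * (-1) < pi * (2 * s)" using s by (intro mult_strict_left_mono; simp add: abs_less_iff)+
  then have "2 * pi * s \<in> {-pi<..pi}" by (simp add: algebra_simps)
  then show ?thesis by (simp add: turn_def turn_cis_def Arg_cis)
qed

lemma turn_cis_turn: "norm z = 1 \<Longrightarrow> turn_cis (turn z) = z"
proof -
  assume z: "norm z = 1"
  then have "z \<noteq> 0" by auto
  then have "cis (Arg z) = z" using z by (simp add: cis_Arg sgn_eq)
  then show ?thesis by (simp add: turn_def turn_cis_def)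
qed

lemma turn_cis_quarter: "\<bar>s\<bar> = 1/4 \<Longrightarrow> Re (turn_cis s) = 0"
proof -
  assume "\<bar>s\<bar> = 1/4"
  then have "s = 1/4 \<or> s = - (1/4)" by linarith
  then have "2 * pi * s = pi / 2 \<or> 2 * pi * s = - (pi / 2)" by auto
  then have "cos (2 * pi * s) = 0" by (elim disjE) (simp_all only: cos_minus cos_pi_half)
  then show ?thesis by (simp add: turn_cis_def)
qed

lemma turn_cis_cont: "continuous_on UNIV turn_cis"
  unfolding turn_cis_def by (intro continuous_intros)

lemma continuous_map_turn:
  assumes f: "continuous_map Z euclidean f" and pos: "\<And>z. z \<in> topspace Z \<Longrightarrow> Re (f z) > 0"
  shows "continuous_map Z euclideanreal (\<lambda>z. turn (f z))"
proof -
  let ?S = "{w::complex. Re w > 0}"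
  have "continuous_on ?S Arg"
  proof (rule continuous_at_imp_continuous_on, rule ballI)
    fix w :: complex assume "w \<in> ?S"
    then have "w \<notin> \<real>\<^sub>\<le>\<^sub>0" by (auto simp: complex_nonpos_Reals_iff)
    then show "isCont Arg w" by (rule continuous_at_Arg)
  qed
  then have "continuous_on ?S turn"
    unfolding turn_def by (rule continuous_on_divide) (auto intro: continuous_intros)
  then have "continuous_map (top_of_set ?S) euclideanreal turn" by simp
  moreover have "continuous_map Z (top_of_set ?S) f" using f pos by (auto simp: continuous_map_in_subtopology)
  ultimately show ?thesis using continuous_map_compose[of Z "top_of_set ?S" f euclideanreal turn] by (simp add: o_def)
qed

lemma continuous_map_complex_mult:
  fixes f g :: "'a \<Rightarrow> complex"
  shows "continuous_map Z euclidean f \<Longrightarrow> continuous_map Z euclidean g \<Longrightarrow> continuous_map Z euclidean (\<lambda>z. f z * g z)"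
  by (simp add: continuous_map_atin tendsto_mult)

lemma continuous_map_complex_cnj:
  fixes f :: "'a \<Rightarrow> complex"
  assumes "continuous_map Z euclidean f" shows "continuous_map Z euclidean (\<lambda>z. cnj (f z))"
proof -
  have "continuous_on UNIV cnj" by (intro continuous_intros)
  then have "continuous_map euclidean euclidean cnj" by simp
  from continuous_map_compose[OF assms this] show ?thesis by (simp add: o_def)
qed

lemma openin_Re_pos:
  fixes f :: "'a \<Rightarrow> complex"
  assumes "continuous_map Z euclidean f" shows "openin Z {z \<in> topspace Z. Re (f z) > 0}"
proof -
  have "open {w. Re w > 0}" by (rule open_halfspace_Re_gt)
  then show ?thesis using openin_continuous_map_preimage[OF assms, of "{w. Re w > 0}"] by simp
qed

text \<open>Where \<open>\<bar>D\<bar>\<close> equals 1/4, \<open>turn_cis\<close> is purely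
  imaginary; with positive real part throughout, the connected range of \<open>\<bar>D\<bar>\<close>
  cannot pass 1/4.\<close>

lemma abs_less_quarter_connected:
  fixes D :: "real \<Rightarrow> real"
  assumes D: "continuous_on {-N..N} D" and D0: "\<bar>D 0\<bar> < 1/4" and t: "t \<in> {-N..N}"
    and nq: "\<And>s. s \<in> {-N..N} \<Longrightarrow> Re (turn_cis (D s)) > 0"
  shows "\<bar>D t\<bar> < 1/4"
proof (rule ccontr)
  assume "\<not> ?thesis"
  then have "1/4 \<le> \<bar>D t\<bar>" by simp
  have "connected ((\<lambda>s. \<bar>D s\<bar>) ` {-N..N})"
    by (intro connected_continuous_image continuous_intros D) simp
  moreover have "0 \<in> {-N..N}" using t by auto
  ultimately have "1/4 \<in> (\<lambda>s. \<bar>D s\<bar>) ` {-N..N}"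
    using D0 \<open>1/4 \<le> \<bar>D t\<bar>\<close> t unfolding connected_iff_interval
    by (meson imageI less_imp_le)
  then obtain s where "s \<in> {-N..N}" "\<bar>D s\<bar> = 1/4" by auto
  then show False using nq turn_cis_quarter by fastforce
qed

section \<open>Lifting circle-valued maps along flow lines\<close>

context stone
begin

text \<open>Time modulo 1 is well defined on the suspension and maps it to the circle.\<close>

lemma phase:
  obtains \<rho> where "continuous_map Y euclidean \<rho>" "\<And>x t. x \<in> topspace X \<Longrightarrow> \<rho> (cls (x, t)) = turn_cis t"
proof -
  have c: "continuous_map XR euclidean (\<lambda>p. turn_cis (snd p))"
  proof -
    have "continuous_map euclideanreal euclidean turn_cis" using turn_cis_cont by simp
    from continuous_map_compose[OF continuous_map_snd this] show ?thesis by (simp add: o_def)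
  qed
  have inv: "turn_cis (snd (it n x, t - of_int n)) = turn_cis (snd (x, t))" for n x t
    using turn_cis_eq[of t "t - of_int n"] by auto
  show ?thesis by (rule descend[OF c inv]) (use that in auto)
qed

lemma line_cont: "x \<in> topspace X \<Longrightarrow> continuous_map euclideanreal XR (\<lambda>t. (x, t))"
  by (simp add: continuous_map_pairwise o_def)

text \<open>Each line \<open>{x} \<times> \<real>\<close> is lifted separately. Lifts along nearby lines stay within \<open>1/4\<close> of each
  other on compact intervals, so they differ by a principal value, which is continuous.\<close>

lemma circle_lift:
  assumes w: "continuous_map XR euclidean w" and norm: "\<And>x t. x \<in> topspace X \<Longrightarrow> norm (w (x, t)) = 1"
  obtains H where "continuous_map XR euclideanreal (\<lambda>(x, t). H x t)"
    "\<And>x t. x \<in> topspace X \<Longrightarrow> turn_cis (H x t) = w (x, t)"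
proof -
  let ?w0 = "\<lambda>x. w (x, 0)"
  have w0: "continuous_map X euclidean ?w0"
  proof -
    have "continuous_map X XR (\<lambda>x. (x, 0))" by (simp add: continuous_map_pairwise o_def)
    from continuous_map_compose[OF this w] show ?thesis by (simp add: o_def)
  qed
  have const: "continuous_map X euclidean (\<lambda>x. c)" for c :: complex by simp
  have "\<exists>v W. openin X W \<and> x \<in> W \<and> (\<forall>x'\<in>W. Re (?w0 x' * cnj (turn_cis v)) > 0)" if x: "x \<in> topspace X" for x
  proof -
    let ?v = "turn (?w0 x)"
    let ?W = "{x' \<in> topspace X. Re (?w0 x' * cnj (turn_cis ?v)) > 0}"
    have "openin X ?W" by (intro openin_Re_pos continuous_map_complex_mult w0 const)
    moreover have "Re (?w0 x * cnj (turn_cis ?v)) > 0"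
      unfolding turn_cis_turn[OF norm[OF x]] norm_1_cnj[OF norm[OF x]] by simp
    then have "x \<in> ?W" using x by blast
    ultimately show ?thesis by (intro exI[of _ ?v] exI[of _ ?W]) auto
  qed
  then obtain a where a: "loc_const X a" "\<And>x. x \<in> topspace X \<Longrightarrow> Re (?w0 x * cnj (turn_cis (a x))) > 0"
    by (rule selection[of "\<lambda>x v. Re (?w0 x * cnj (turn_cis v)) > 0"]) auto
  \<comment> \<open>A continuous logarithm of \<open>w\<close> at time 0, where the line lifts will
    start: the locally constant approximation \<open>a\<close> picks the branch, and the principal
    value corrects it.\<close>
  define u where "u x = a x + turn (?w0 x * cnj (turn_cis (a x)))" for x
  have uw: "turn_cis (u x) = ?w0 x" if x: "x \<in> topspace X" for x
  proof -
    have "norm (?w0 x * cnj (turn_cis (a x))) = 1" using norm[OF x] by (simp add: norm_mult)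
    then have "turn_cis (u x) = turn_cis (a x) * (?w0 x * cnj (turn_cis (a x)))"
      by (simp add: u_def turn_cis_add turn_cis_turn)
    also have "\<dots> = ?w0 x * (turn_cis (a x) * cnj (turn_cis (a x)))" by simp
    also have "turn_cis (a x) * cnj (turn_cis (a x)) = 1" by (simp add: turn_cis_diff[symmetric])
    finally show ?thesis by simp
  qed
  have u: "continuous_map X euclideanreal u"
  proof (rule continuous_map_locI)
    fix x assume x: "x \<in> topspace X"
    then obtain C where C: "openin X C" "x \<in> C" "\<forall>x'\<in>C. a x' = a x" using a(1) unfolding loc_const_def by blast
    have "continuous_map (subtopology X C) euclideanreal (\<lambda>z. turn (?w0 z * cnj (turn_cis (a x))))"
    proof (rule continuous_map_turn)
      show "continuous_map (subtopology X C) euclidean (\<lambda>z. ?w0 z * cnj (turn_cis (a x)))"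
        by (intro continuous_map_from_subtopology continuous_map_complex_mult w0 const)
      show "Re (?w0 z * cnj (turn_cis (a x))) > 0" if "z \<in> topspace (subtopology X C)" for z
        using a(2)[of z] C(3) that by auto
    qed
    then have "continuous_map (subtopology X C) euclideanreal (\<lambda>z. a x + turn (?w0 z * cnj (turn_cis (a x))))"
      by (intro continuous_map_add) auto
    then have "continuous_map (subtopology X C) euclideanreal u"
    proof (rule continuous_map_eq)
      fix z assume "z \<in> topspace (subtopology X C)"
      then have "a z = a x" using C(3) by simp
      then show "a x + turn (?w0 z * cnj (turn_cis (a x))) = u z" by (simp only: u_def)
    qed
    then show "\<exists>U. openin X U \<and> x \<in> U \<and> continuous_map (subtopology X U) euclideanreal u"
      using C(1,2) by (intro exI[of _ C] conjI)
  qed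
  have "\<exists>h. continuous_on UNIV h \<and> h 0 = u x \<and> (\<forall>t. turn_cis (h t) = w (x, t))" if x: "x \<in> topspace X" for x
  proof -
    from continuous_map_compose[OF line_cont[OF x] w] have wc: "continuous_on UNIV (\<lambda>t. w (x, t))" by (simp add: o_def)
    have ne: "w (x, t) \<noteq> 0" for t using norm[OF x, of t] by auto
    \<comment> \<open>The line is contractible, so \<open>w (x, _)\<close> has a complex logarithm;
      its rescaled imaginary part is then shifted to start at \<open>u x\<close>.\<close>
    have "contractible (UNIV :: real set)" by (rule contractible_UNIV)
    then obtain g where g: "continuous_on UNIV g" "\<And>t. w (x, t) = exp (g t)"
      using continuous_logarithm_on_contractible[OF wc] ne by auto
    define h where "h t = Im (g t) / (2 * pi)" for t
    have hw: "turn_cis (h t) = w (x, t)" for t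
    proof -
      have "norm (exp (g t)) = 1" using norm[OF x, of t] g(2)[of t] by simp
      then have "Re (g t) = 0" by simp
      then have "exp (g t) = cis (Im (g t))" by (simp add: exp_eq_polar)
      then show ?thesis using g(2)[of t] by (simp add: h_def turn_cis_def)
    qed
    have hc: "continuous_on UNIV h" unfolding h_def by (intro continuous_intros g(1)) auto
    have "turn_cis (h t - h 0 + u x) = w (x, t)" for t
    proof -
      have "turn_cis (h t - h 0 + u x) = w (x, t) * (w (x, 0) * cnj (w (x, 0)))"
        using uw[OF x] hw by (simp add: turn_cis_add turn_cis_diff)
      then show ?thesis using norm_1_cnj[OF norm[OF x, of 0]] by simp
    qed
    moreover have "continuous_on UNIV (\<lambda>t. h t - h 0 + u x)" by (intro continuous_intros hc)
    ultimately show ?thesis by (intro exI[of _ "\<lambda>t. h t - h 0 + u x"]) auto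
  qed
  then obtain H where H: "\<And>x. x \<in> topspace X \<Longrightarrow> continuous_on UNIV (H x) \<and> H x 0 = u x \<and> (\<forall>t. turn_cis (H x t) = w (x, t))"
    by metis
  have "continuous_map XR euclideanreal (\<lambda>(x, t). H x t)"
  proof (rule continuous_map_locI)
    fix p assume "p \<in> topspace XR"
    then obtain x0 t0 where p: "p = (x0, t0)" "x0 \<in> topspace X" by auto
    define N where "N = \<bar>t0\<bar> + 1"
    let ?f = "\<lambda>p. w p * cnj (w (x0, snd p))"
    have x0c: "continuous_map XR euclidean (\<lambda>p. w (x0, snd p))"
      using continuous_map_compose[OF continuous_map_compose[OF continuous_map_snd line_cont[OF p(2)]] w] by (simp add: o_def)
    have fc: "continuous_map XR euclidean ?f"
      by (intro continuous_map_complex_mult continuous_map_complex_cnj w x0c)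
    let ?O = "{p \<in> topspace XR. Re (?f p) > 0}"
    have "openin XR ?O" by (rule openin_Re_pos[OF fc])
    moreover have "{x0} \<times> {-N..N} \<subseteq> ?O"
    proof -
      have pos: "Re (?f (x0, t)) > 0" for t using norm_1_cnj[OF norm[OF p(2), of t]] by simp
      show ?thesis
      proof
        fix z assume "z \<in> {x0} \<times> {-N..N}"
        then obtain t where "z = (x0, t)" by auto
        then show "z \<in> ?O" using pos[of t] p(2) by simp
      qed
    qed
    moreover have "compactin euclideanreal {-N..N}" by simp
    \<comment> \<open>By the tube lemma, one neighbourhood of \<open>x0\<close> serves all times in
      \<open>[-N, N]\<close>.\<close>
    ultimately obtain U V where UV: "openin X U" "x0 \<in> U" "{-N..N} \<subseteq> V" "U \<times> V \<subseteq> ?O"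
      using tube_lemma_right[of X euclideanreal ?O "{-N..N}" x0] p(2) by blast
    let ?C = "U \<inter> {x \<in> topspace X. u x \<in> {u x0 - 1/4<..<u x0 + 1/4}}"
    have C: "openin X ?C" using UV(1) openin_continuous_map_preimage[OF u, of "{u x0 - 1/4<..<u x0 + 1/4}"] by auto
    have close: "\<bar>H x t - H x0 t\<bar> < 1/4" if x: "x \<in> ?C" and t: "t \<in> {-N..N}" for x t
    proof (rule abs_less_quarter_connected[where D = "\<lambda>t. H x t - H x0 t", OF _ _ t])
      have xX: "x \<in> topspace X" using x by blast
      show "continuous_on {-N..N} (\<lambda>t. H x t - H x0 t)"
        using H[OF xX] H[OF p(2)] by (intro continuous_intros) (auto intro: continuous_on_subset)
      have "u x \<in> {u x0 - 1/4<..<u x0 + 1/4}" using x by blast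
      then show "\<bar>H x 0 - H x0 0\<bar> < 1/4" using H[OF xX] H[OF p(2)] unfolding greaterThanLessThan_iff by linarith
      fix s assume "s \<in> {-N..N}"
      then have "(x, s) \<in> ?O" using UV x by blast
      then show "Re (turn_cis (H x s - H x0 s)) > 0" using H[OF xX] H[OF p(2)] by (simp add: turn_cis_diff)
    qed
    let ?S = "?C \<times> {-N<..<N}"
    have Sopen: "openin XR ?S" using C by (simp add: openin_prod_Times_iff)
    have "{-N<..<N} \<subseteq> V" using UV(3) by (auto simp: subset_iff)
    then have SO: "?S \<subseteq> ?O" using UV(4) by blast
    have H0c: "continuous_map XR euclideanreal (\<lambda>p. H x0 (snd p))"
    proof -
      have "continuous_map euclideanreal euclideanreal (H x0)" using H[OF p(2)] by simp
      from continuous_map_compose[OF continuous_map_snd this] show ?thesis by (simp add: o_def)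
    qed
    have "continuous_map (subtopology XR ?S) euclideanreal (\<lambda>p. H x0 (snd p) + turn (?f p))"
    proof (intro continuous_map_add continuous_map_turn continuous_map_from_subtopology fc H0c)
      fix z assume "z \<in> topspace (subtopology XR ?S)"
      then show "Re (?f z) > 0" using SO by auto
    qed
    then have "continuous_map (subtopology XR ?S) euclideanreal (\<lambda>(x, t). H x t)"
    proof (rule continuous_map_eq)
      fix z assume "z \<in> topspace (subtopology XR ?S)"
      then obtain x t where z: "z = (x, t)" "x \<in> ?C" "t \<in> {-N..N}" by auto
      then have xX: "x \<in> topspace X" by blast
      have "?f z = turn_cis (H x t - H x0 t)" using H[OF xX] H[OF p(2)] by (simp add: z turn_cis_diff)
      then show "H x0 (snd z) + turn (?f z) = (\<lambda>(x, t). H x t) z"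
        using close[OF z(2,3)] turn_turn_cis[of "H x t - H x0 t"] by (simp add: z)
    qed
    moreover have "p \<in> ?S" using p UV(2) by (auto simp: N_def)
    ultimately show "\<exists>U. openin XR U \<and> p \<in> U \<and> continuous_map (subtopology XR U) euclideanreal (\<lambda>(x, t). H x t)"
      using Sopen by blast
  qed
  then show ?thesis using that H by blast
qed

end

section \<open>Lifts of maps between suspensions\<close>

locale stone_map =
  A: stone X1 \<phi>1 + B: stone X2 \<phi>2
  for X1 :: "'a topology" and \<phi>1 and X2 :: "'b topology" and \<phi>2 +
  fixes q
  assumes q_cont: "continuous_map A.Y B.Y q"
begin

definition flow_lift :: "('a \<Rightarrow> 'b) \<Rightarrow> ('a \<Rightarrow> real \<Rightarrow> real) \<Rightarrow> bool" where
  "flow_lift \<psi> H \<longleftrightarrow> continuous_map X1 X2 \<psi> \<and> continuous_map A.XR euclideanreal (\<lambda>(x, t). H x t) \<and>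
     (\<forall>x\<in>topspace X1. \<forall>t. q (A.cls (x, t)) = B.cls (\<psi> x, H x t))"

text \<open>Time is lifted first, as the phase of the image point. A lifted time singles out one
  representative, hence a transversal coordinate, and this coordinate is continuous along the line
  in a totally disconnected space, so it does not depend on \<open>t\<close>.\<close>

lemma flow_lift_exists: obtains \<psi> H where "flow_lift \<psi> H"
proof -
  obtain \<rho> where \<rho>: "continuous_map B.Y euclidean \<rho>" "\<And>x t. x \<in> topspace X2 \<Longrightarrow> \<rho> (B.cls (x, t)) = turn_cis t"
    using B.phase by blast
  have qc: "continuous_map A.XR B.Y (\<lambda>p. q (A.cls p))"
    using continuous_map_compose[OF A.cls_cont q_cont] by (simp add: o_def)
  have qin: "q (A.cls (x, t)) \<in> topspace B.Y" if "x \<in> topspace X1" for x t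
    using q_cont A.cls_in[OF that] by (auto simp: continuous_map_def)
  let ?w = "\<lambda>p. \<rho> (q (A.cls p))"
  have wc: "continuous_map A.XR euclidean ?w" using continuous_map_compose[OF qc \<rho>(1)] by (simp add: o_def)
  have wn: "norm (?w (x, t)) = 1" if "x \<in> topspace X1" for x t
    using qin[OF that, of t] \<rho>(2) by (metis B.Y_cases turn_cis_norm)
  obtain H where H: "continuous_map A.XR euclideanreal (\<lambda>(x, t). H x t)"
    "\<And>x t. x \<in> topspace X1 \<Longrightarrow> turn_cis (H x t) = ?w (x, t)"
    using A.circle_lift[OF wc wn] by blast
  have ex: "\<exists>z\<in>topspace X2. q (A.cls (x, t)) = B.cls (z, H x t)" if x: "x \<in> topspace X1" for x t
  proof -
    obtain z s where z: "z \<in> topspace X2" "q (A.cls (x, t)) = B.cls (z, s)" using qin[OF x] B.Y_cases by metis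
    then have "turn_cis s = turn_cis (H x t)" using H(2)[OF x] \<rho>(2) by simp
    then obtain n where "H x t = s - of_int n" using turn_cis_eq by blast
    then show ?thesis using z B.cls_it[of z n s] B.it_in by metis
  qed
  then obtain P where P: "\<And>x t. x \<in> topspace X1 \<Longrightarrow> P x t \<in> topspace X2 \<and> q (A.cls (x, t)) = B.cls (P x t, H x t)"
    by metis
  have Pc: "continuous_map A.XR X2 (\<lambda>(x, t). P x t)"
    unfolding continuous_map_def
  proof (intro conjI allI impI)
    show "(\<lambda>(x, t). P x t) \<in> topspace A.XR \<rightarrow> topspace X2" using P by auto
    fix U assume U: "openin X2 U"
    show "openin A.XR {p \<in> topspace A.XR. (\<lambda>(x, t). P x t) p \<in> U}"
    proof (subst openin_subopen, intro ballI)
      fix p assume "p \<in> {p \<in> topspace A.XR. (\<lambda>(x, t). P x t) p \<in> U}"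
      then obtain x0 t0 where p: "p = (x0, t0)" "x0 \<in> topspace X1" "P x0 t0 \<in> U" by auto
      let ?J = "{H x0 t0 - 1/4<..<H x0 t0 + 1/4}"
      let ?V = "B.cls ` (U \<times> ?J)"
      let ?T = "{p \<in> topspace A.XR. q (A.cls p) \<in> ?V} \<inter> {p \<in> topspace A.XR. (\<lambda>(x, t). H x t) p \<in> ?J}"
      have "openin B.Y ?V" using U by (intro B.cls_box_open) auto
      then have "openin A.XR ?T"
        by (intro openin_Int openin_continuous_map_preimage[OF qc] openin_continuous_map_preimage[OF H(1)]) auto
      moreover have "p \<in> ?T" using p P[OF p(2), of t0] by auto
      moreover have "?T \<subseteq> {p \<in> topspace A.XR. (\<lambda>(x, t). P x t) p \<in> U}"
      proof
        fix p' assume p': "p' \<in> ?T"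
        then obtain x t where xt: "p' = (x, t)" "x \<in> topspace X1" by auto
        then obtain z s where z: "z \<in> U" "s \<in> ?J" "q (A.cls (x, t)) = B.cls (z, s)" "H x t \<in> ?J" using p' by auto
        have "\<bar>s - H x t\<bar> < 1" using z(2,4) unfolding greaterThanLessThan_iff by linarith
        moreover have "B.cls (z, s) = B.cls (P x t, H x t)" "z \<in> topspace X2" using P[OF xt(2), of t] z U openin_subset by auto
        ultimately have "P x t = z" using B.cls_eq_close(1) P[OF xt(2)] by blast
        then show "p' \<in> {p \<in> topspace A.XR. (\<lambda>(x, t). P x t) p \<in> U}" using xt z by auto
      qed
      ultimately show "\<exists>T. openin A.XR T \<and> p \<in> T \<and> T \<subseteq> {p \<in> topspace A.XR. (\<lambda>(x, t). P x t) p \<in> U}" by blast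
    qed
  qed
  have Pconst: "P x t = P x 0" if x: "x \<in> topspace X1" for x t
  proof -
    have "continuous_map euclideanreal X2 (P x)"
      using continuous_map_compose[OF A.line_cont[OF x] Pc] by (simp add: o_def)
    moreover have "connectedin euclideanreal UNIV" by simp
    ultimately have "connectedin X2 (range (P x))" using connectedin_continuous_map_image by blast
    then obtain a where "range (P x) \<subseteq> {a}" using B.td unfolding totally_disconnected_space_def by blast
    then show ?thesis by (metis rangeI singletonD subsetD)
  qed
  define \<psi> where "\<psi> x = P x 0" for x
  have "continuous_map X1 A.XR (\<lambda>x. (x, 0))" by (simp add: continuous_map_pairwise o_def)
  from continuous_map_compose[OF this Pc] have "continuous_map X1 X2 \<psi>" by (simp add: o_def \<psi>_def[abs_def])
  moreover have "q (A.cls (x, t)) = B.cls (\<psi> x, H x t)" if "x \<in> topspace X1" for x t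
    using P[OF that, of t] Pconst[OF that, of t] by (simp add: \<psi>_def)
  ultimately have "flow_lift \<psi> H" using H(1) by (simp add: flow_lift_def)
  then show ?thesis using that by blast
qed

lemma flow_lift_in: "flow_lift \<psi> H \<Longrightarrow> x \<in> topspace X1 \<Longrightarrow> \<psi> x \<in> topspace X2"
  by (auto simp: flow_lift_def continuous_map_def)

lemma flow_lift_line_cont: "flow_lift \<psi> H \<Longrightarrow> x \<in> topspace X1 \<Longrightarrow> continuous_on UNIV (H x)"
  using continuous_map_compose[OF A.line_cont[of x], of euclideanreal "\<lambda>(x, t). H x t"]
  by (simp add: flow_lift_def o_def)

lemma flow_lift_at_cont: "flow_lift \<psi> H \<Longrightarrow> continuous_map X1 euclideanreal (\<lambda>x. H x t)"
proof -
  assume l: "flow_lift \<psi> H"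
  have "continuous_map X1 A.XR (\<lambda>x. (x, t))" by (simp add: continuous_map_pairwise o_def)
  from continuous_map_compose[OF this, of euclideanreal "\<lambda>(x, t). H x t"] l
  show ?thesis by (simp add: flow_lift_def o_def)
qed

lemma flow_lift_equivariant:
  assumes l: "flow_lift \<psi> H" and x: "x \<in> topspace X1"
  obtains m :: int where "\<psi> (A.it n x) = B.it m (\<psi> x)" "\<And>t. H (A.it n x) (t - of_int n) = H x t - of_int m"
proof -
  have ex: "\<exists>m. \<psi> (A.it n x) = B.it m (\<psi> x) \<and> H (A.it n x) (t - of_int n) = H x t - of_int m" for t
  proof -
    have "B.cls (\<psi> x, H x t) = B.cls (\<psi> (A.it n x), H (A.it n x) (t - of_int n))"
      using l x A.it_in[OF x, of n] A.cls_it[OF x, of n t] unfolding flow_lift_def by metis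
    then show ?thesis using B.cls_eq_iff[OF flow_lift_in[OF l x] flow_lift_in[OF l A.it_in[OF x]]] by auto
  qed
  \<comment> \<open>The value of \<open>m\<close> found at time \<open>t\<close>; it is continuous
    and integer-valued, hence constant.\<close>
  define D where "D t = H x t - H (A.it n x) (t - of_int n)" for t
  have Dint: "D t \<in> \<int>" for t using ex[of t] unfolding D_def by auto
  have "continuous_on UNIV D"
    unfolding D_def
    by (intro continuous_intros flow_lift_line_cont[OF l x]
        continuous_on_compose2[OF flow_lift_line_cont[OF l A.it_in[OF x, of n]], of UNIV "\<lambda>t. t - of_int n"]) auto
  then have const: "D t = D 0" for t using int_valued_continuous_const Dint by blast
  obtain m where m: "\<psi> (A.it n x) = B.it m (\<psi> x)" "H (A.it n x) (0 - of_int n) = H x 0 - of_int m" using ex[of 0] by blast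
  have "H (A.it n x) (t - of_int n) = H x t - of_int m" for t
    using const[of t] m(2) unfolding D_def by simp
  then show ?thesis using that m(1) by blast
qed

end

section \<open>Monotone lifts, orientation and flow equivalence\<close>

locale stone_homeo = stone_map +
  assumes q_homeo: "homeomorphic_map A.Y B.Y q"
begin

lemma q_inverse: obtains r where "stone_homeo X2 \<phi>2 X1 \<phi>1 r"
  "\<And>y. y \<in> topspace A.Y \<Longrightarrow> r (q y) = y" "\<And>z. z \<in> topspace B.Y \<Longrightarrow> q (r z) = z"
proof -
  obtain r where r: "homeomorphic_maps A.Y B.Y q r" using q_homeo homeomorphic_map_maps by blast
  then have "homeomorphic_map B.Y A.Y r" using homeomorphic_maps_map by blast
  then have "stone_homeo X2 \<phi>2 X1 \<phi>1 r"
    by unfold_locales (simp_all add: homeomorphic_imp_continuous_map)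
  moreover have "r (q y) = y" if "y \<in> topspace A.Y" for y using r that by (simp add: homeomorphic_maps_def)
  moreover have "q (r z) = z" if "z \<in> topspace B.Y" for z using r that by (simp add: homeomorphic_maps_def)
  ultimately show ?thesis using that by blast
qed

lemma flow_lift_inverse:
  assumes l: "flow_lift \<psi> H" and l': "stone_map.flow_lift X2 \<phi>2 X1 \<phi>1 r \<psi>' H'" and sh: "stone_homeo X2 \<phi>2 X1 \<phi>1 r"
    and r: "\<And>y. y \<in> topspace A.Y \<Longrightarrow> r (q y) = y" and x: "x \<in> topspace X1"
  shows "\<exists>n::int. \<psi>' (\<psi> x) = A.it n x \<and> (\<forall>t. H' (\<psi> x) (H x t) = t - of_int n)"
proof -
  interpret R: stone_homeo X2 \<phi>2 X1 \<phi>1 r by fact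
  have px: "\<psi> x \<in> topspace X2" by (rule flow_lift_in[OF l x])
  have ppx: "\<psi>' (\<psi> x) \<in> topspace X1" by (rule R.flow_lift_in[OF l' px])
  have ex: "\<exists>n. \<psi>' (\<psi> x) = A.it n x \<and> H' (\<psi> x) (H x t) = t - of_int n" for t
  proof -
    have "A.cls (x, t) = r (q (A.cls (x, t)))" using r x by simp
    also have "\<dots> = r (B.cls (\<psi> x, H x t))" using l x by (simp add: flow_lift_def)
    also have "\<dots> = A.cls (\<psi>' (\<psi> x), H' (\<psi> x) (H x t))" using l' px by (simp add: R.flow_lift_def)
    finally show ?thesis using A.cls_eq_iff[OF x ppx] by blast
  qed
  define D where "D t = t - H' (\<psi> x) (H x t)" for t
  have Dint: "D t \<in> \<int>" for t using ex[of t] unfolding D_def by auto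
  have "continuous_on UNIV D"
    unfolding D_def
    by (intro continuous_intros continuous_on_compose2[OF R.flow_lift_line_cont[OF l' px] flow_lift_line_cont[OF l x]]) auto
  then have const: "D t = D 0" for t using int_valued_continuous_const Dint by blast
  obtain n where n: "\<psi>' (\<psi> x) = A.it n x" "H' (\<psi> x) (H x 0) = 0 - of_int n" using ex[of 0] by blast
  have "H' (\<psi> x) (H x t) = t - of_int n" for t using const[of t] n(2) unfolding D_def by simp
  then show ?thesis using n(1) by blast
qed

text \<open>Lifts of \<open>q\<close> and of its inverse compose, in both orders, to integer
  translations. One order gives injectivity, the other surjectivity.\<close>

lemma flow_lift_bij:
  assumes l: "flow_lift \<psi> H" and x: "x \<in> topspace X1"
  shows "bij (H x)"
proof -
  obtain r where r: "stone_homeo X2 \<phi>2 X1 \<phi>1 r"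
    "\<And>y. y \<in> topspace A.Y \<Longrightarrow> r (q y) = y" "\<And>z. z \<in> topspace B.Y \<Longrightarrow> q (r z) = z" using q_inverse by blast
  interpret R: stone_homeo X2 \<phi>2 X1 \<phi>1 r by fact
  obtain \<psi>' H' where l': "R.flow_lift \<psi>' H'" using R.flow_lift_exists by blast
  obtain n where n: "\<psi>' (\<psi> x) = A.it n x" "\<And>t. H' (\<psi> x) (H x t) = t - of_int n"
    using flow_lift_inverse[OF l l' r(1,2) x] by auto
  have "inj (H x)"
  proof (rule injI)
    fix s t assume "H x s = H x t"
    then have "s - of_int n = t - of_int n" using n(2) by metis
    then show "s = t" by simp
  qed
  moreover have "surj (H x)"
  proof -
    have px: "\<psi> x \<in> topspace X2" by (rule flow_lift_in[OF l x])
    have sh: "stone_homeo X1 \<phi>1 X2 \<phi>2 q" by unfold_locales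
    obtain k where k: "\<psi> (\<psi>' (\<psi> x)) = B.it k (\<psi> x)" "\<And>s. H (\<psi>' (\<psi> x)) (H' (\<psi> x) s) = s - of_int k"
      using R.flow_lift_inverse[OF l' l sh r(3) px] by auto
    obtain m where m: "\<psi> (A.it n x) = B.it m (\<psi> x)" "\<And>t. H (A.it n x) (t - of_int n) = H x t - of_int m"
      using flow_lift_equivariant[OF l x, of n] by blast
    \<comment> \<open>The second composite runs over the line of \<open>it n x\<close>; equivariance
      brings it back to the line of \<open>x\<close>, at the cost of the integers \<open>m\<close>
      and \<open>n\<close>.\<close>
    have "H x (H' (\<psi> x) (s - of_int m + of_int k) + of_int n) = s" for s
      using k(2)[of "s - of_int m + of_int k"] m(2)[of "H' (\<psi> x) (s - of_int m + of_int k) + of_int n"] n(1) by simp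
    then show ?thesis by (rule surjI)
  qed
  ultimately show ?thesis by (rule bijI)
qed

lemma flow_lift_mono:
  assumes l: "flow_lift \<psi> H" and x: "x \<in> topspace X1"
  shows "strict_mono (H x) \<or> strict_antimono_on UNIV (H x)"
  using injective_eq_monotone_map[of UNIV "H x"] flow_lift_line_cont[OF l x] flow_lift_bij[OF l x]
  by (simp add: bij_is_inj)

text \<open>The direction of \<open>H x\<close> is the sign of \<open>H x 1 - H x 0\<close>, so each
  direction holds on an open set. Equivariance makes it constant along the dense orbit, which meets
  every nonempty open set.\<close>

lemma flow_lift_orientation:
  assumes l: "flow_lift \<psi> H" and dense: "has_dense_orbit X1 \<phi>1"
  shows "(\<forall>x\<in>topspace X1. strict_mono (H x)) \<or> (\<forall>x\<in>topspace X1. strict_antimono_on UNIV (H x))"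
proof -
  obtain z where z: "z \<in> topspace X1" "X1 closure_of (range (\<lambda>n. A.it n z)) = topspace X1"
    using dense unfolding has_dense_orbit_def by blast
  have inc: "strict_mono (H x) \<longleftrightarrow> H x 0 < H x 1" and dec: "strict_antimono_on UNIV (H x) \<longleftrightarrow> H x 1 < H x 0"
    if "x \<in> topspace X1" for x
    using flow_lift_mono[OF l that] strict_monoD[of "H x" 0 1] monotone_onD[of UNIV "(<)" "\<lambda>x y. y < x" "H x" 0 1] by auto
  have c: "continuous_map X1 euclideanreal (\<lambda>x. H x 1 - H x 0)"
    by (intro continuous_map_diff flow_lift_at_cont[OF l])
  have orb: "strict_mono (H (A.it n z)) \<longleftrightarrow> strict_mono (H z)" for n
  proof -
    obtain m where "\<And>t. H (A.it n z) (t - of_int n) = H z t - of_int m"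
      using flow_lift_equivariant[OF l z(1), of n] by blast
    then have e: "H (A.it n z) t = H z (t + of_int n) - of_int m" for t by (metis add_diff_cancel)
    show ?thesis
    proof
      assume "strict_mono (H z)"
      then show "strict_mono (H (A.it n z))" unfolding strict_mono_def e by simp
    next
      assume a: "strict_mono (H (A.it n z))"
      have "H z t = H (A.it n z) (t - of_int n) + of_int m" for t using e[of "t - of_int n"] by simp
      then show "strict_mono (H z)" using a unfolding strict_mono_def by simp
    qed
  qed
  have meets: "\<exists>n. A.it n z \<in> W" if "openin X1 W" "W \<noteq> {}" for W
  proof -
    have "W \<inter> X1 closure_of (range (\<lambda>n. A.it n z)) \<noteq> {}" using z(2) that openin_subset by blast
    then show ?thesis using openin_Int_closure_of_eq_empty[OF that(1)] by blast
  qed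
  show ?thesis
  proof (cases "strict_mono (H z)")
    case True
    have "strict_mono (H x)" if x: "x \<in> topspace X1" for x
    proof (rule ccontr)
      let ?W = "{x \<in> topspace X1. H x 1 - H x 0 \<in> {..<0}}"
      assume "\<not> strict_mono (H x)"
      then have "x \<in> ?W" using flow_lift_mono[OF l x] dec[OF x] x by auto
      moreover have "openin X1 ?W" by (rule openin_continuous_map_preimage[OF c]) auto
      ultimately obtain n where "A.it n z \<in> ?W" using meets by blast
      then show False using inc[of "A.it n z"] orb[of n] True by auto
    qed
    then show ?thesis by blast
  next
    case False
    have "strict_antimono_on UNIV (H x)" if x: "x \<in> topspace X1" for x
    proof (rule ccontr)
      let ?W = "{x \<in> topspace X1. H x 1 - H x 0 \<in> {0<..}}"
      assume "\<not> strict_antimono_on UNIV (H x)"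
      then have "x \<in> ?W" using flow_lift_mono[OF l x] inc[OF x] x by auto
      moreover have "openin X1 ?W" by (rule openin_continuous_map_preimage[OF c]) auto
      ultimately obtain n where "A.it n z \<in> ?W" using meets by blast
      then show False using inc[of "A.it n z"] orb[of n] False A.it_in[OF z(1)] by auto
    qed
    then show ?thesis by blast
  qed
qed

lemma flow_lift_flow_equivalent:
  assumes l: "flow_lift \<psi> H" and inc: "\<And>x. x \<in> topspace X1 \<Longrightarrow> strict_mono (H x)"
  shows "flow_equivalent X1 \<phi>1 X2 \<phi>2"
  unfolding flow_equivalent_def
proof (intro exI[of _ q] conjI ballI)
  show "homeomorphic_map A.Y B.Y q" by (rule q_homeo)
  fix y assume "y \<in> topspace A.Y"
  then obtain x s where xs: "x \<in> topspace X1" "y = A.cls (x, s)" using A.Y_cases by blast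
  define h where "h t = H x (s + t) - H x s" for t
  have qh: "q (susp_flow t y) = susp_flow (h t) (q y)" for t
    using l xs by (simp add: flow_lift_def susp_flow_class h_def)
  have bH: "bij (H x)" by (rule flow_lift_bij[OF l xs(1)])
  have inj: "inj h"
  proof (rule injI)
    fix t t' assume "h t = h t'"
    then have "H x (s + t) = H x (s + t')" by (simp add: h_def)
    then show "t = t'" using injD[OF bij_is_inj[OF bH]] by fastforce
  qed
  have surj: "surj h"
  proof (rule surjI)
    fix u show "h (inv_into UNIV (H x) (u + H x s) - s) = u"
      using bH by (simp add: h_def bij_is_surj surj_f_inv_f)
  qed
  have cont: "continuous_on UNIV h"
    unfolding h_def
    by (intro continuous_intros continuous_on_compose2[OF flow_lift_line_cont[OF l xs(1)], of UNIV "\<lambda>t. s + t"]) auto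
  have "\<exists>h'. homeomorphism UNIV UNIV h h'"
    using injective_into_1d_eq_homeomorphism[OF cont] inj surj path_connected_UNIV by auto
  moreover have "strict_mono h" using inc[OF xs(1)] by (simp add: h_def strict_mono_def)
  ultimately show "\<exists>h h'. homeomorphism UNIV UNIV h h' \<and> strict_mono h \<and>
      (\<forall>t. q (susp_flow t y) = susp_flow (h t) (q y))" using qh by blast
  have "q ` flow_orbit y = range (\<lambda>t. susp_flow (h t) (q y))"
    unfolding flow_orbit_def image_image using qh by simp
  also have "\<dots> = flow_orbit (q y)" unfolding flow_orbit_def
    using surj image_image[of "\<lambda>t. susp_flow t (q y)" h UNIV] by simp
  finally show "q ` flow_orbit y = flow_orbit (q y)" .
qed

end

section \<open>Reversal of the flow\<close>

context stone
begin

lemma stone_inv: "stone X (inv_map X \<phi>)"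
  by unfold_locales (use stone homeo_inv in \<open>simp add: Stone_system_def\<close>)

lemma int_iter_inv: "x \<in> topspace X \<Longrightarrow> int_iter X (inv_map X \<phi>) n x = it (- n) x"
proof -
  assume x: "x \<in> topspace X"
  interpret I: stone X "inv_map X \<phi>" by (rule stone_inv)
  have inv: "inv_map X (inv_map X \<phi>) z = \<phi> z" if z: "z \<in> topspace X" for z
  proof -
    have "inv_map X \<phi> (\<phi> z) = z" using inv_map_cancel(2)[OF bij z] .
    moreover have "\<phi> z \<in> topspace X" using bij z by (auto simp: bij_betw_def)
    ultimately show ?thesis using inv_map_cancel(2)[OF I.bij, of "\<phi> z"] by simp
  qed
  have in': "(\<phi> ^^ k) x \<in> topspace X" for k using it_in[OF x, of "int k"] by (simp add: int_iter_def)
  have "(inv_map X (inv_map X \<phi>) ^^ k) x = (\<phi> ^^ k) x" for k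
    by (induction k) (use inv in' in auto)
  then show ?thesis unfolding int_iter_def by (cases "n = 0") auto
qed

text \<open>Negating time carries the integer action of \<open>\<phi>\<close> to that of its
  inverse, with \<open>n\<close> replaced by \<open>- n\<close>.\<close>

lemma flip:
  obtains F where "homeomorphic_map Y (suspension X (inv_map X \<phi>)) F"
    "\<And>x t. x \<in> topspace X \<Longrightarrow> F (cls (x, t)) = susp_class X (inv_map X \<phi>) (x, - t)"
proof -
  interpret I: stone X "inv_map X \<phi>" by (rule stone_inv)
  let ?h = "\<lambda>p. I.cls (fst p, - snd p)"
  have "continuous_map XR XR (\<lambda>p. (fst p, - snd p))"
    unfolding continuous_map_pairwise o_def fst_conv snd_conv
    by (intro conjI continuous_map_fst continuous_map_minus continuous_map_snd)
  from continuous_map_compose[OF this I.cls_cont] have hc: "continuous_map XR I.Y ?h" by (simp add: o_def)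
  have iff: "I.cls (x, - t) = I.cls (x', - t') \<longleftrightarrow> cls (x, t) = cls (x', t')"
    if x: "x \<in> topspace X" "x' \<in> topspace X" for x t x' t'
  proof -
    have "I.cls (x, - t) = I.cls (x', - t') \<longleftrightarrow> (\<exists>n. x' = it (- n) x \<and> - t' = - t - of_int n)"
      using I.cls_eq_iff[OF x] int_iter_inv[OF x(1)] by simp
    also have "\<dots> \<longleftrightarrow> (\<exists>n. x' = it n x \<and> t' = t - of_int n)"
      by (rule iffI; elim exE; rule_tac x = "- n" in exI) auto
    finally show ?thesis using cls_eq_iff[OF x] by simp
  qed
  have inv: "?h (it n x, t - of_int n) = ?h (x, t)" if "x \<in> topspace X" for n x t
    using that iff[of "it n x" x "t - of_int n" t] cls_it it_in by simp
  obtain F where F: "continuous_map Y I.Y F" and Fv: "\<And>x t. x \<in> topspace X \<Longrightarrow> F (cls (x, t)) = ?h (x, t)"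
    by (rule descend[OF hc inv]) auto
  have Fv: "F (cls (x, t)) = I.cls (x, - t)" if "x \<in> topspace X" for x t using Fv[OF that] by simp
  have "homeomorphic_map Y I.Y F"
  proof (rule continuous_imp_homeomorphic_map[OF F Y_compact I.Y_haus])
    show "F ` topspace Y = topspace I.Y"
    proof
      show "F ` topspace Y \<subseteq> topspace I.Y" using F by (auto simp: continuous_map_def)
      show "topspace I.Y \<subseteq> F ` topspace Y"
      proof
        fix z assume "z \<in> topspace I.Y"
        then obtain x t where "x \<in> topspace X" "z = I.cls (x, t)" using I.Y_cases by blast
        then have "z = F (cls (x, - t))" "cls (x, - t) \<in> topspace Y" using Fv[of x "- t"] by auto
        then show "z \<in> F ` topspace Y" by blast
      qed
    qed
    show "inj_on F (topspace Y)"
    proof (rule inj_onI)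
      fix y z assume yz: "y \<in> topspace Y" "z \<in> topspace Y" "F y = F z"
      obtain x t where xt: "x \<in> topspace X" "y = cls (x, t)" using yz Y_cases by blast
      obtain x' t' where xt': "x' \<in> topspace X" "z = cls (x', t')" using yz Y_cases by blast
      show "y = z" using yz(3) Fv xt xt' iff by simp
    qed
  qed
  then show ?thesis using that Fv by blast
qed

end

text \<open>Decreasing lifts become increasing after composition with the reversal of the target
  flow. Both implications of the theorem pass through this statement.\<close>

lemma homeomorphic_increasing_lift:
  assumes s: "stone X1 \<phi>1" "stone X2 \<phi>2" and dense: "has_dense_orbit X1 \<phi>1"
    and h: "suspension X1 \<phi>1 homeomorphic_space suspension X2 \<phi>2"
  obtains \<phi> q \<psi> H where "\<phi> = \<phi>2 \<or> \<phi> = inv_map X2 \<phi>2" "stone_homeo X1 \<phi>1 X2 \<phi> q"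
    "stone_map.flow_lift X1 \<phi>1 X2 \<phi> q \<psi> H" "\<And>x. x \<in> topspace X1 \<Longrightarrow> strict_mono (H x)"
proof -
  interpret A: stone X1 \<phi>1 by (rule s)
  interpret B: stone X2 \<phi>2 by (rule s)
  interpret I: stone X2 "inv_map X2 \<phi>2" by (rule B.stone_inv)
  obtain q where q: "homeomorphic_map A.Y B.Y q" using h homeomorphic_space by blast
  interpret Q: stone_homeo X1 \<phi>1 X2 \<phi>2 q
    by unfold_locales (simp_all add: q homeomorphic_imp_continuous_map)
  obtain \<psi> H where l: "Q.flow_lift \<psi> H" using Q.flow_lift_exists by blast
  show ?thesis
  proof (cases "\<forall>x\<in>topspace X1. strict_mono (H x)")
    case True
    then show ?thesis using that[OF _ Q.stone_homeo_axioms l] by blast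
  next
    case False
    then have anti: "strict_antimono_on UNIV (H x)" if "x \<in> topspace X1" for x
      using Q.flow_lift_orientation[OF l dense] that by blast
    obtain F where F: "homeomorphic_map B.Y I.Y F" "\<And>x t. x \<in> topspace X2 \<Longrightarrow> F (B.cls (x, t)) = I.cls (x, - t)"
      using B.flip by blast
    have Fq: "homeomorphic_map A.Y I.Y (F \<circ> q)" by (rule homeomorphic_map_compose[OF q F(1)])
    interpret R: stone_homeo X1 \<phi>1 X2 "inv_map X2 \<phi>2" "F \<circ> q"
      by unfold_locales (use Fq in \<open>simp_all add: homeomorphic_imp_continuous_map\<close>)
    have "continuous_map A.XR euclideanreal (\<lambda>p. - (\<lambda>(x, t). H x t) p)"
      using l by (intro continuous_map_minus) (simp add: Q.flow_lift_def)
    then have "R.flow_lift \<psi> (\<lambda>x t. - H x t)"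
      using l Q.flow_lift_in[OF l] F(2) by (simp add: Q.flow_lift_def R.flow_lift_def case_prod_unfold)
    moreover have "strict_mono (\<lambda>t. - H x t)" if "x \<in> topspace X1" for x
      using anti[OF that] by (simp add: strict_mono_def monotone_on_def)
    ultimately show ?thesis using that[OF _ R.stone_homeo_axioms] by blast
  qed
qed

section \<open>Conjugation by dyadic homeomorphisms\<close>

text \<open>\<open>push\<close> and \<open>pull\<close> ask that conjugation by \<open>F x\<close>
  preserves dyadic germs, not that \<open>F x\<close> has dyadic germs. This admits time reversal,
  whose slope is not a power of 2. \<open>F_loc\<close> asks for local constancy on bounded times
  only, as the neighbourhood must shrink with \<open>N\<close>.\<close>

locale dyadic_conj = stone_homeo +
  fixes \<psi> :: "'a \<Rightarrow> 'b" and F G :: "'a \<Rightarrow> real \<Rightarrow> real"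
  assumes \<psi>_cont: "continuous_map X1 X2 \<psi>"
    and q_val: "x \<in> topspace X1 \<Longrightarrow> q (A.cls (x, t)) = B.cls (\<psi> x, F x t)"
    and FG: "x \<in> topspace X1 \<Longrightarrow> F x (G x s) = s" and GF: "x \<in> topspace X1 \<Longrightarrow> G x (F x t) = t"
    and F_cont: "x \<in> topspace X1 \<Longrightarrow> isCont (F x) t" and G_cont: "x \<in> topspace X1 \<Longrightarrow> isCont (G x) t"
    and F_loc: "x0 \<in> topspace X1 \<Longrightarrow>
      \<exists>C. openin X1 C \<and> x0 \<in> C \<and> (\<forall>x\<in>C. \<forall>t. \<bar>t\<bar> < N \<longrightarrow> F x t = F x0 t)"
    and push: "x \<in> topspace X1 \<Longrightarrow> dgerm f t \<Longrightarrow> dgerm (\<lambda>s. F x (f (G x s))) (F x t)"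
    and pull: "x \<in> topspace X1 \<Longrightarrow> dgerm f (F x t) \<Longrightarrow> dgerm (\<lambda>t. G x (f (F x t))) t"
begin

lemma \<psi>_in: "x \<in> topspace X1 \<Longrightarrow> \<psi> x \<in> topspace X2"
  using \<psi>_cont by (auto simp: continuous_map_def)

lemma \<psi>_open_at:
  assumes C: "openin X1 C" "x0 \<in> C" and loc: "\<And>x t. x \<in> C \<Longrightarrow> \<bar>t\<bar> < N \<Longrightarrow> F x t = F x0 t" and N: "\<bar>t0\<bar> < N"
  obtains D where "openin X2 D" "\<psi> x0 \<in> D" "D \<subseteq> \<psi> ` C"
proof -
  have CX: "C \<subseteq> topspace X1" using C openin_subset by blast
  then have x0: "x0 \<in> topspace X1" using C by blast
  have "\<forall>\<^sub>F t in nhds t0. dist (F x0 t) (F x0 t0) < 1"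
  proof (rule eventually_nhds_comp[OF F_cont[OF x0]])
    have "(1::real) > 0" by simp
    then show "\<forall>\<^sub>F s in nhds (F x0 t0). dist s (F x0 t0) < 1" unfolding eventually_nhds_metric by blast
  qed
  moreover have "\<forall>\<^sub>F t in nhds t0. t \<in> {-N<..<N}"
    using N by (intro eventually_nhds_in_open) (auto simp: abs_less_iff)
  ultimately have "\<forall>\<^sub>F t in nhds t0. dist (F x0 t) (F x0 t0) < 1 \<and> t \<in> {-N<..<N}" by (rule eventually_conj)
  then obtain e where e: "e > 0" "\<And>t. \<bar>t - t0\<bar> < e \<Longrightarrow> \<bar>F x0 t - F x0 t0\<bar> < 1 \<and> \<bar>t\<bar> < N"
    unfolding eventually_nhds_metric dist_real_def
    by (metis abs_less_iff greaterThanLessThan_iff minus_less_iff)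
  let ?I = "{t0 - e<..<t0 + e}"
  have o: "openin B.Y (q ` (A.cls ` (C \<times> ?I)))"
    using homeomorphic_imp_open_map[OF q_homeo] A.cls_box_open[OF C(1), of ?I] by (auto simp: open_map_def)
  have c: "continuous_map X2 B.Y (\<lambda>x. B.cls (x, F x0 t0))"
  proof -
    have "continuous_map X2 B.XR (\<lambda>x. (x, F x0 t0))" by (simp add: continuous_map_pairwise o_def)
    from continuous_map_compose[OF this B.cls_cont] show ?thesis by (simp add: o_def)
  qed
  let ?D = "{x2 \<in> topspace X2. B.cls (x2, F x0 t0) \<in> q ` (A.cls ` (C \<times> ?I))}"
  have "openin X2 ?D" by (rule openin_continuous_map_preimage[OF c o])
  moreover have "\<psi> x0 \<in> ?D"
  proof -
    have "A.cls (x0, t0) \<in> A.cls ` (C \<times> ?I)" using C e(1) by auto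
    moreover have "B.cls (\<psi> x0, F x0 t0) = q (A.cls (x0, t0))" using q_val[OF x0] by simp
    ultimately show ?thesis using \<psi>_in[OF x0] by blast
  qed
  moreover have "?D \<subseteq> \<psi> ` C"
  proof
    fix x2 assume x2: "x2 \<in> ?D"
    then obtain x t where xt: "x \<in> C" "t0 - e < t" "t < t0 + e" "B.cls (x2, F x0 t0) = q (A.cls (x, t))" by auto
    have te: "\<bar>t - t0\<bar> < e" using xt(2,3) by linarith
    have xX: "x \<in> topspace X1" using xt(1) CX by blast
    have "B.cls (\<psi> x, F x0 t) = B.cls (x2, F x0 t0)"
      using xt(4) q_val[OF xX] loc[OF xt(1)] e(2)[OF te] by simp
    then have "x2 = \<psi> x"
      using B.cls_eq_close(1)[OF \<psi>_in[OF xX] _ _ conjunct1[OF e(2)[OF te]]] x2 by blast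
    then show "x2 \<in> \<psi> ` C" using xt(1) by blast
  qed
  ultimately show ?thesis using that by blast
qed

text \<open>The conjugate needs an open transversal in \<open>X2\<close>, and it is found inside the
  image of a transversal of \<open>X1\<close>; this uses \<open>\<psi>_open_at\<close>. In the
  opposite direction a preimage under \<open>\<psi>\<close> suffices.\<close>

lemma conj_local_form:
  assumes r: "\<And>y. y \<in> topspace A.Y \<Longrightarrow> r (q y) = y" "\<And>z. z \<in> topspace B.Y \<Longrightarrow> q (r z) = z"
    "\<And>z. z \<in> topspace B.Y \<Longrightarrow> r z \<in> topspace A.Y" and g: "A.local_form g"
  shows "B.local_form (restrict (q \<circ> g \<circ> r) (topspace B.Y))"
  unfolding B.local_form_def
proof (intro ballI allI)
  fix x2 s0 assume x2: "x2 \<in> topspace X2"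
  let ?k = "restrict (q \<circ> g \<circ> r) (topspace B.Y)"
  obtain x0 t0 where xt: "x0 \<in> topspace X1" "r (B.cls (x2, s0)) = A.cls (x0, t0)"
    by (rule A.Y_cases[OF r(3)[OF B.cls_in[OF x2, of s0]]])
  then have "B.cls (x2, s0) = B.cls (\<psi> x0, F x0 t0)" using r(2)[OF B.cls_in[OF x2, of s0]] q_val by simp
  then obtain n where n: "\<psi> x0 = B.it n x2" "F x0 t0 = s0 - of_int n"
    using B.cls_eq_iff[OF x2 \<psi>_in[OF xt(1)]] by blast
  obtain C f where C: "openin X1 C" "x0 \<in> C" "C \<subseteq> topspace X1" "dgerm f t0"
    "\<forall>\<^sub>F t in nhds t0. \<forall>x\<in>C. g (A.cls (x, t)) = A.cls (x, f t)" by (rule A.local_formE[OF g xt(1)])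
  \<comment> \<open>\<open>F\<close> is applied at the time before and at the time after the action
    of \<open>g\<close>, so both have to lie in the range where it is constant in
    \<open>x\<close>.\<close>
  define N where "N = \<bar>t0\<bar> + \<bar>f t0\<bar> + 1"
  obtain C' where C': "openin X1 C'" "x0 \<in> C'" "\<And>x t. x \<in> C' \<Longrightarrow> \<bar>t\<bar> < N \<Longrightarrow> F x t = F x0 t"
    using F_loc[OF xt(1), of N] by metis
  obtain D where D: "openin X2 D" "\<psi> x0 \<in> D" "D \<subseteq> \<psi> ` (C \<inter> C')"
  proof (rule \<psi>_open_at[of "C \<inter> C'" x0 N t0])
    show "openin X1 (C \<inter> C')" using C(1) C'(1) by (rule openin_Int)
    show "x0 \<in> C \<inter> C'" using C(2) C'(2) by (rule IntI)
    show "\<bar>t0\<bar> < N" by (simp add: N_def)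
    show "F x t = F x0 t" if "x \<in> C \<inter> C'" "\<bar>t\<bar> < N" for x t using C'(3) that by blast
  qed
  let ?f = "\<lambda>s. F x0 (f (G x0 s))"
  have f: "dgerm ?f (s0 + - of_int n)" using push[OF xt(1) C(4)] n(2) by simp
  have Gs: "G x0 (s0 + - of_int n) = t0" using GF[OF xt(1), of t0] n(2) by simp
  have ev: "\<forall>\<^sub>F s in nhds (s0 + - of_int n). \<forall>z\<in>D. ?k (B.cls (z, s)) = B.cls (z, ?f s)"
  proof -
    have "\<forall>\<^sub>F t in nhds t0. t \<in> {-N<..<N}"
      by (intro eventually_nhds_in_open) (auto simp: N_def abs_if)
    moreover have "\<forall>\<^sub>F t in nhds t0. f t \<in> {-N<..<N}"
      by (rule eventually_nhds_comp[OF dgerm_isCont[OF C(4)]])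
        (intro eventually_nhds_in_open, auto simp: N_def abs_if)
    ultimately have "\<forall>\<^sub>F t in nhds t0. \<bar>t\<bar> < N \<and> \<bar>f t\<bar> < N \<and> (\<forall>x\<in>C. g (A.cls (x, t)) = A.cls (x, f t))"
      using C(5) by eventually_elim (auto simp: abs_less_iff)
    then have "\<forall>\<^sub>F s in nhds (s0 + - of_int n). \<bar>G x0 s\<bar> < N \<and> \<bar>f (G x0 s)\<bar> < N \<and>
        (\<forall>x\<in>C. g (A.cls (x, G x0 s)) = A.cls (x, f (G x0 s)))"
      by (intro eventually_nhds_comp[OF G_cont[OF xt(1)]]) (simp only: Gs)
    then show ?thesis
    proof eventually_elim
      case (elim s)
      show ?case
      proof
        fix z assume "z \<in> D"
        then obtain x where x: "x \<in> C" "x \<in> C'" "z = \<psi> x" using D(3) by blast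
        then have xX: "x \<in> topspace X1" using C(3) by blast
        have "q (A.cls (x, G x0 s)) = B.cls (z, s)"
          using q_val[OF xX] C'(3)[OF x(2)] elim FG[OF xt(1)] x(3) by simp
        then have "r (B.cls (z, s)) = A.cls (x, G x0 s)" using r(1)[OF A.cls_in[OF xX, of "G x0 s"]] by simp
        then have "?k (B.cls (z, s)) = q (A.cls (x, f (G x0 s)))"
          using elim x(1,3) \<psi>_in[OF xX] by simp
        then show "?k (B.cls (z, s)) = B.cls (z, ?f s)"
          using q_val[OF xX] C'(3)[OF x(2)] elim x(3) by simp
      qed
    qed
  qed
  let ?D = "{x \<in> topspace X2. B.it n x \<in> D}"
  let ?f' = "\<lambda>s. ?f (s + - of_int n) + of_int n"
  have sh: "dgerm (\<lambda>s. s + - of_int n) s0" by (rule dgerm_shift) (auto intro: dyadic_minus)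
  have "dgerm ?f' s0" using dgerm_comp[OF dgerm_comp[OF sh f] dgerm_shift[OF dyadic_of_int[of n]]] .
  moreover have "openin X2 ?D" by (rule openin_continuous_map_preimage[OF B.it_cont D(1)])
  moreover have "x2 \<in> ?D" using x2 D(2) n(1) by simp
  moreover have "\<forall>\<^sub>F s in nhds s0. \<forall>z\<in>?D. ?k (B.cls (z, s)) = B.cls (z, ?f' s)"
    using eventually_nhds_comp[OF dgerm_isCont[OF sh] ev]
  proof eventually_elim
    case (elim s)
    show ?case
    proof
      fix z assume z: "z \<in> ?D"
      then have "?k (B.cls (B.it n z, s + - of_int n)) = B.cls (B.it n z, ?f (s + - of_int n))" using elim by blast
      then show "?k (B.cls (z, s)) = B.cls (z, ?f' s)"
        using B.cls_it[of z n s] B.cls_it'[of z n "?f (s + - of_int n)"] z by simp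
    qed
  qed
  ultimately show "\<exists>C f. openin X2 C \<and> x2 \<in> C \<and> dgerm f s0 \<and>
     (\<forall>\<^sub>F s in nhds s0. \<forall>z\<in>C. ?k (B.cls (z, s)) = B.cls (z, f s))" by blast
qed

lemma conj_local_form':
  assumes r: "\<And>y. y \<in> topspace A.Y \<Longrightarrow> r (q y) = y" and g: "B.local_form g"
  shows "A.local_form (restrict (r \<circ> g \<circ> q) (topspace A.Y))"
  unfolding A.local_form_def
proof (intro ballI allI)
  fix x0 t0 assume x0: "x0 \<in> topspace X1"
  let ?k = "restrict (r \<circ> g \<circ> q) (topspace A.Y)"
  obtain D f where D: "openin X2 D" "\<psi> x0 \<in> D" "D \<subseteq> topspace X2" "dgerm f (F x0 t0)"
    "\<forall>\<^sub>F s in nhds (F x0 t0). \<forall>z\<in>D. g (B.cls (z, s)) = B.cls (z, f s)" by (rule B.local_formE[OF g \<psi>_in[OF x0]])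
  let ?f = "\<lambda>t. G x0 (f (F x0 t))"
  have f: "dgerm ?f t0" by (rule pull[OF x0 D(4)])
  define N where "N = \<bar>t0\<bar> + \<bar>?f t0\<bar> + 1"
  obtain C' where C': "openin X1 C'" "x0 \<in> C'" "\<And>x t. x \<in> C' \<Longrightarrow> \<bar>t\<bar> < N \<Longrightarrow> F x t = F x0 t"
    using F_loc[OF x0, of N] by metis
  let ?C = "C' \<inter> {x \<in> topspace X1. \<psi> x \<in> D}"
  have "openin X1 ?C" using C'(1) openin_continuous_map_preimage[OF \<psi>_cont D(1)] by blast
  moreover have "x0 \<in> ?C" using x0 C' D by blast
  moreover have "\<forall>\<^sub>F t in nhds t0. \<forall>x\<in>?C. ?k (A.cls (x, t)) = A.cls (x, ?f t)"
  proof -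
    have "\<forall>\<^sub>F t in nhds t0. t \<in> {-N<..<N}"
      by (intro eventually_nhds_in_open) (auto simp: N_def abs_if)
    moreover have "\<forall>\<^sub>F t in nhds t0. ?f t \<in> {-N<..<N}"
      by (rule eventually_nhds_comp[OF dgerm_isCont[OF f]])
        (intro eventually_nhds_in_open, auto simp: N_def abs_if)
    ultimately show ?thesis using eventually_nhds_comp[OF F_cont[OF x0] D(5)]
    proof eventually_elim
      case (elim t)
      then have N: "\<bar>t\<bar> < N" "\<bar>?f t\<bar> < N" by (simp_all add: abs_less_iff)
      show ?case
      proof
        fix x assume x: "x \<in> ?C"
        then have xX: "x \<in> topspace X1" by blast
        have "g (q (A.cls (x, t))) = B.cls (\<psi> x, f (F x0 t))"
          using q_val[OF xX] C'(3)[of x t] x N elim(3) by simp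
        also have "\<dots> = B.cls (\<psi> x, F x (?f t))" using C'(3)[of x "?f t"] x N FG[OF x0] by simp
        also have "\<dots> = q (A.cls (x, ?f t))" using q_val[OF xX] by simp
        finally show "?k (A.cls (x, t)) = A.cls (x, ?f t)" using r xX by simp
      qed
    qed
  qed
  ultimately show "\<exists>C f. openin X1 C \<and> x0 \<in> C \<and> dgerm f t0 \<and>
     (\<forall>\<^sub>F t in nhds t0. \<forall>x\<in>C. ?k (A.cls (x, t)) = A.cls (x, f t))" using f by blast
qed

end

text \<open>Every stage of the isotopy is conjugated; no property of \<open>q\<close> beyond being a
  homeomorphism enters.\<close>

lemma H0_conj:
  assumes s: "stone X1 \<phi>1" "stone X2 \<phi>2"
    and qr: "homeomorphic_maps (suspension X1 \<phi>1) (suspension X2 \<phi>2) q r" and g: "g \<in> H0 X1 \<phi>1"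
  shows "restrict (q \<circ> g \<circ> r) (topspace (suspension X2 \<phi>2)) \<in> H0 X2 \<phi>2"
proof -
  interpret A: stone X1 \<phi>1 by (rule s)
  interpret B: stone X2 \<phi>2 by (rule s)
  have q: "homeomorphic_map A.Y B.Y q" and r: "homeomorphic_map B.Y A.Y r"
    using qr homeomorphic_maps_map by blast+
  let ?k = "restrict (q \<circ> g \<circ> r) (topspace B.Y)"
  have "homotopic_with (homeomorphic_map A.Y A.Y) A.Y A.Y id g" using g by (simp add: H0_def)
  then have "homotopic_with (homeomorphic_map A.Y B.Y) A.Y B.Y (q \<circ> id) (q \<circ> g)"
    by (rule homotopic_with_compose_continuous_map_left)
      (use q in \<open>auto intro: homeomorphic_imp_continuous_map homeomorphic_map_compose\<close>)
  then have "homotopic_with (homeomorphic_map B.Y B.Y) B.Y B.Y (q \<circ> id \<circ> r) (q \<circ> g \<circ> r)"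
    by (rule homotopic_with_compose_continuous_map_right)
      (use r in \<open>auto intro: homeomorphic_imp_continuous_map homeomorphic_map_compose\<close>)
  then have h: "homotopic_with (homeomorphic_map B.Y B.Y) B.Y B.Y id ?k"
  proof (rule homotopic_with_eq)
    fix z assume "z \<in> topspace B.Y"
    then show "id z = (q \<circ> id \<circ> r) z" "?k z = (q \<circ> g \<circ> r) z" using qr by (auto simp: homeomorphic_maps_def)
  next
    fix h k :: "('b \<times> real) set \<Rightarrow> ('b \<times> real) set" assume "\<And>y. y \<in> topspace B.Y \<Longrightarrow> h y = k y"
    then show "homeomorphic_map B.Y B.Y h = homeomorphic_map B.Y B.Y k" by (metis homeomorphic_map_eq)
  qed
  then have "homeomorphic_map B.Y B.Y ?k" using homotopic_with_imp_property by blast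
  then have "bij_betw ?k (topspace B.Y) (topspace B.Y)"
    unfolding homeomorphic_eq_everything_map bij_betw_def by blast
  then have "?k \<in> Bij (topspace B.Y)" by (simp add: Bij_def)
  then show ?thesis using h by (simp add: H0_def)
qed

context dyadic_conj
begin

lemma T_group_iso: "T_group X1 \<phi>1 \<cong> T_group X2 \<phi>2"
proof -
  obtain r where r: "homeomorphic_maps A.Y B.Y q r" using q_homeo homeomorphic_map_maps by blast
  then have r': "homeomorphic_maps B.Y A.Y r q" using homeomorphic_maps_sym by blast
  have rq: "\<And>y. y \<in> topspace A.Y \<Longrightarrow> r (q y) = y" "\<And>z. z \<in> topspace B.Y \<Longrightarrow> q (r z) = z"
    "\<And>z. z \<in> topspace B.Y \<Longrightarrow> r z \<in> topspace A.Y" "\<And>y. y \<in> topspace A.Y \<Longrightarrow> q y \<in> topspace B.Y"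
    using r by (auto simp: homeomorphic_maps_def continuous_map_def)
  define c where "c g = restrict (q \<circ> g \<circ> r) (topspace B.Y)" for g
  define c' where "c' g = restrict (r \<circ> g \<circ> q) (topspace A.Y)" for g
  have c: "c g \<in> T_set X2 \<phi>2" if "g \<in> T_set X1 \<phi>1" for g
    using that H0_conj[OF A.stone_axioms B.stone_axioms r] conj_local_form[OF rq(1,2,3)]
    unfolding c_def A.T_set_iff B.T_set_iff by blast
  have c': "c' g \<in> T_set X1 \<phi>1" if "g \<in> T_set X2 \<phi>2" for g
    using that H0_conj[OF B.stone_axioms A.stone_axioms r'] conj_local_form'[OF rq(1)]
    unfolding c'_def A.T_set_iff B.T_set_iff by blast
  have gin: "g y \<in> topspace A.Y" if "g \<in> T_set X1 \<phi>1" "y \<in> topspace A.Y" for g y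
    using homeomorphic_imp_surjective_map[OF A.T_homeo[OF that(1)]] that(2) by blast
  have gin': "g y \<in> topspace B.Y" if "g \<in> T_set X2 \<phi>2" "y \<in> topspace B.Y" for g y
    using homeomorphic_imp_surjective_map[OF B.T_homeo[OF that(1)]] that(2) by blast
  have cc': "c (c' g) = g" if g: "g \<in> T_set X2 \<phi>2" for g
  proof (rule extensionalityI[of _ "topspace B.Y"])
    show "c (c' g) \<in> extensional (topspace B.Y)" by (simp add: c_def)
    show "g \<in> extensional (topspace B.Y)" using B.T_ext g .
    fix z assume "z \<in> topspace B.Y"
    then show "c (c' g) z = g z" using rq gin'[OF g] by (simp add: c_def c'_def)
  qed
  have c'c: "c' (c g) = g" if g: "g \<in> T_set X1 \<phi>1" for g
  proof (rule extensionalityI[of _ "topspace A.Y"])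
    show "c' (c g) \<in> extensional (topspace A.Y)" by (simp add: c'_def)
    show "g \<in> extensional (topspace A.Y)" using A.T_ext g .
    fix z assume "z \<in> topspace A.Y"
    then show "c' (c g) z = g z" using rq gin[OF g] by (simp add: c_def c'_def)
  qed
  have "c \<in> iso (T_group X1 \<phi>1) (T_group X2 \<phi>2)"
  proof (rule isoI)
    show "c \<in> hom (T_group X1 \<phi>1) (T_group X2 \<phi>2)"
    proof (rule homI)
      fix g h assume gh: "g \<in> carrier (T_group X1 \<phi>1)" "h \<in> carrier (T_group X1 \<phi>1)"
      have "c (compose (topspace A.Y) g h) = compose (topspace B.Y) (c g) (c h)"
        by (rule ext) (use gh rq gin in \<open>auto simp: c_def compose_def restrict_def\<close>)
      then show "c (g \<otimes>\<^bsub>T_group X1 \<phi>1\<^esub> h) = c g \<otimes>\<^bsub>T_group X2 \<phi>2\<^esub> c h"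
        using gh c by (simp add: A.T_mult B.T_mult)
    qed (use c in simp)
    show "bij_betw c (carrier (T_group X1 \<phi>1)) (carrier (T_group X2 \<phi>2))"
      by (rule bij_betw_byWitness[where f' = c']) (use c c' cc' c'c in auto)
  qed
  then show ?thesis by (auto simp: is_iso_def)
qed

end

lemma T_group_flip:
  assumes "stone X \<phi>" shows "T_group X \<phi> \<cong> T_group X (inv_map X \<phi>)"
proof -
  interpret A: stone X \<phi> by fact
  interpret I: stone X "inv_map X \<phi>" by (rule A.stone_inv)
  obtain F where F: "homeomorphic_map A.Y I.Y F" "\<And>x t. x \<in> topspace X \<Longrightarrow> F (A.cls (x, t)) = I.cls (x, - t)"
    using A.flip by blast
  interpret dyadic_conj X \<phi> X "inv_map X \<phi>" F "\<lambda>x. x" "\<lambda>x t. - t" "\<lambda>x t. - t"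
  proof (unfold_locales, goal_cases)
    case 1 show ?case using F(1) homeomorphic_imp_continuous_map by blast
  next
    case 2 show ?case by (rule F(1))
  next
    case 3 show ?case using continuous_map_id by (simp add: id_def)
  next
    case (4 x t) then show ?case by (rule F(2))
  next
    case (7 x0 N) then show ?case by blast
  next
    case (8 x f t) then show ?case using dgerm_neg by blast
  next
    case (9 x f t) then show ?case using dgerm_neg[of f "- t"] by simp
  qed auto
  show ?thesis by (rule T_group_iso)
qed

section \<open>Dyadic interpolation of lifts\<close>

definition dyadic_interp :: "real \<Rightarrow> (real \<Rightarrow> real) \<Rightarrow> bool" where
  "dyadic_interp L f \<longleftrightarrow> strict_mono f \<and> (\<forall>t. dgerm f t) \<and> f 0 = 0 \<and> f 1 = L"

text \<open>The previous map is squeezed into \<open>[0, 1/2]\<close> by the substitution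
  \<open>2 * t\<close>, and a piece of slope 2 climbs by 1 on \<open>[1/2, 1]\<close>. Germs are
  controlled on the whole line, not only on \<open>[0, 1]\<close>, so that translated interpolants
  can later be glued at integers.\<close>

lemma dyadic_interp_nat: "\<exists>f. dyadic_interp (of_nat (Suc p)) f"
proof (induction p)
  case 0
  have "dyadic_interp (of_nat (Suc 0)) (\<lambda>t. t)" by (simp add: dyadic_interp_def strict_mono_def dgerm_id)
  then show ?case by blast
next
  case (Suc p)
  let ?L = "real (Suc p)"
  obtain f where f: "strict_mono f" "\<And>t. dgerm f t" "f 0 = 0" "f 1 = ?L" using Suc by (auto simp: dyadic_interp_def)
  define h where "h t = (if t \<le> 1/2 then f (2 * t + 0) else 2 * t + (?L - 1))" for t
  have dL: "dyadic (?L - 1)" using dyadic_of_int[of "int p"] by simp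
  have g1: "dgerm (\<lambda>t. f (2 * t + 0)) t" for t by (rule dgerm_comp[OF dgerm_affine[OF pow2_2 dyadic_0] f(2)])
  have g2: "dgerm (\<lambda>t. 2 * t + (?L - 1)) t" for t by (rule dgerm_affine[OF pow2_2 dL])
  have d: "dyadic (1/2)" using pow2_dyadic[OF pow2_inverse[OF pow2_2]] .
  have "dgerm h t" for t
  proof (cases t "1/2 :: real" rule: linorder_cases)
    case less
    then have "\<forall>\<^sub>F s in nhds t. s \<in> {..<1/2}" by (intro eventually_nhds_in_open) auto
    then have "\<forall>\<^sub>F s in nhds t. f (2 * s + 0) = h s" by eventually_elim (simp add: h_def)
    then show ?thesis by (rule dgerm_cong_imp[OF g1])
  next
    case equal
    show ?thesis unfolding equal
      by (rule dgerm_glue[OF g1 g2 _ d]) (use f(4) in \<open>auto simp: h_def\<close>)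
  next
    case greater
    then have "\<forall>\<^sub>F s in nhds t. s \<in> {1/2<..}" by (intro eventually_nhds_in_open) auto
    then have "\<forall>\<^sub>F s in nhds t. 2 * s + (?L - 1) = h s" by eventually_elim (simp add: h_def)
    then show ?thesis by (rule dgerm_cong_imp[OF g2])
  qed
  moreover have "strict_mono h"
  proof (rule strict_monoI)
    fix s t :: real assume st: "s < t"
    consider "t \<le> 1/2" | "s \<le> 1/2" "1/2 < t" | "1/2 < s" using st by linarith
    then show "h s < h t"
    proof cases
      case 1 then show ?thesis using st strict_monoD[OF f(1), of "2 * s + 0" "2 * t + 0"] by (simp add: h_def)
    next
      case 2
      have "f (2 * s + 0) \<le> f 1" using 2 strict_mono_less_eq[OF f(1)] by simp
      then show ?thesis using 2 f(4) by (simp add: h_def)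
    next
      case 3 then show ?thesis using st by (simp add: h_def)
    qed
  qed
  moreover have "h 0 = 0" "h 1 = real (Suc (Suc p))" using f by (simp_all add: h_def)
  ultimately have "dyadic_interp (of_nat (Suc (Suc p))) h" by (simp add: dyadic_interp_def)
  then show ?case by blast
qed

text \<open>A positive dyadic number is a positive integer times a power of 2, and scaling by that
  power keeps slopes powers of 2.\<close>

lemma dyadic_interp_exists:
  assumes "dyadic L" "L > 0" shows "\<exists>f. dyadic_interp L f"
proof -
  obtain p :: int and n :: nat where L: "L = of_int p / 2 ^ n" using assms(1) unfolding dyadic_nat by blast
  then have "p > 0" using assms(2) by (simp add: zero_less_divide_iff)
  then obtain k where k: "p = int (Suc k)" by (metis gr0_implies_Suc pos_int_cases)
  obtain f where f: "dyadic_interp (of_nat (Suc k)) f" using dyadic_interp_nat by blast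
  have "dgerm (\<lambda>t. (1 / 2 ^ n) * f t + 0) t" for t
    using f dgerm_comp[OF _ dgerm_affine[OF pow2_inverse[OF pow2_power] dyadic_0], of f t n]
    by (simp add: dyadic_interp_def)
  then have "dyadic_interp L (\<lambda>t. (1 / 2 ^ n) * f t)"
    using f L k by (simp add: dyadic_interp_def strict_mono_def divide_strict_right_mono)
  then show ?thesis by blast
qed

context stone_homeo
begin

text \<open>Only time 0 is approximated: time \<open>n\<close> on the line of \<open>x\<close> is
  time 0 on the line of \<open>it n x\<close>. With errors below a quarter of the adjacent gaps,
  consecutive breakpoints keep more than half of their gap and stay in order.\<close>

definition dyadic_lift :: "('a \<Rightarrow> 'b) \<Rightarrow> ('a \<Rightarrow> real \<Rightarrow> real) \<Rightarrow> ('a \<Rightarrow> real) \<Rightarrow> bool" where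
  "dyadic_lift \<psi> H a \<longleftrightarrow> flow_lift \<psi> H \<and> (\<forall>x\<in>topspace X1. strict_mono (H x)) \<and>
     loc_const X1 a \<and> (\<forall>x\<in>topspace X1. dyadic (a x) \<and> 4 * \<bar>a x - H x 0\<bar> < H x 1 - H x 0 \<and>
        4 * \<bar>a x - H x 0\<bar> < H x 0 - H x (-1))"

lemma dyadic_lift_exists:
  assumes l: "flow_lift \<psi> H" and inc: "\<And>x. x \<in> topspace X1 \<Longrightarrow> strict_mono (H x)"
  obtains a where "dyadic_lift \<psi> H a"
proof -
  let ?P = "\<lambda>x v. dyadic v \<and> 4 * \<bar>v - H x 0\<bar> < H x 1 - H x 0 \<and> 4 * \<bar>v - H x 0\<bar> < H x 0 - H x (-1)"
  have "\<exists>v W. openin X1 W \<and> x \<in> W \<and> (\<forall>x'\<in>W. ?P x' v)" if x: "x \<in> topspace X1" for x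
  proof -
    have gap: "H x 0 < H x 1" "H x (-1) < H x 0" using strict_monoD[OF inc[OF x]] by auto
    \<comment> \<open>A quarter of the smaller gap. The resulting inequalities are strict and
      continuous in \<open>x\<close>, so the constant \<open>v\<close> works nearby too.\<close>
    define \<epsilon> where "\<epsilon> = min (H x 1 - H x 0) (H x 0 - H x (-1)) / 4"
    have "\<epsilon> > 0" using gap by (simp add: \<epsilon>_def)
    then obtain v where v: "dyadic v" "H x 0 < v" "v < H x 0 + \<epsilon>" using dyadic_dense[of "H x 0" "H x 0 + \<epsilon>"] by auto
    let ?g = "\<lambda>x. H x 1 - H x 0 - 4 * \<bar>v - H x 0\<bar>"
    let ?h = "\<lambda>x. H x 0 - H x (-1) - 4 * \<bar>v - H x 0\<bar>"
    have abs: "continuous_map X1 euclideanreal (\<lambda>x. 4 * \<bar>v - H x 0\<bar>)"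
      by (intro continuous_map_real_mult continuous_map_real_abs continuous_map_diff flow_lift_at_cont[OF l]) auto
    have c: "continuous_map X1 euclideanreal ?g" "continuous_map X1 euclideanreal ?h"
      by (intro continuous_map_diff flow_lift_at_cont[OF l] abs)+
    have U: "openin euclideanreal {0<..}" by simp
    have o: "openin X1 {x \<in> topspace X1. ?g x \<in> {0<..}}" "openin X1 {x \<in> topspace X1. ?h x \<in> {0<..}}"
      by (rule openin_continuous_map_preimage[OF c(1) U], rule openin_continuous_map_preimage[OF c(2) U])
    have "4 * \<bar>v - H x 0\<bar> < 4 * \<epsilon>" using v by (simp add: abs_if)
    also have "4 * \<epsilon> = min (H x 1 - H x 0) (H x 0 - H x (-1))" by (simp add: \<epsilon>_def)
    finally have "4 * \<bar>v - H x 0\<bar> < min (H x 1 - H x 0) (H x 0 - H x (-1))" .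
    then have "0 < ?g x" "0 < ?h x" by simp_all
    then have "x \<in> {x \<in> topspace X1. ?g x \<in> {0<..}} \<inter> {x \<in> topspace X1. ?h x \<in> {0<..}}" using x by simp
    moreover have "openin X1 ({x \<in> topspace X1. ?g x \<in> {0<..}} \<inter> {x \<in> topspace X1. ?h x \<in> {0<..}})"
      by (rule openin_Int[OF o])
    moreover have "\<forall>x'\<in>{x \<in> topspace X1. ?g x \<in> {0<..}} \<inter> {x \<in> topspace X1. ?h x \<in> {0<..}}. ?P x' v"
      using v(1) by simp
    ultimately show ?thesis by blast
  qed
  then obtain a where "loc_const X1 a" "\<And>x. x \<in> topspace X1 \<Longrightarrow> ?P x (a x)"
    by (rule A.selection[of ?P]) auto
  then show ?thesis using that[of a] l inc by (simp add: dyadic_lift_def)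
qed

end

section \<open>Breakpoints and the piecewise linear lift\<close>

locale dyadic_lift_homeo = stone_homeo +
  fixes \<psi> H a
  assumes dlift: "dyadic_lift \<psi> H a"
begin

lemma lift: "flow_lift \<psi> H" and inc: "x \<in> topspace X1 \<Longrightarrow> strict_mono (H x)" and a_loc: "loc_const X1 a"
  and a_dyadic: "x \<in> topspace X1 \<Longrightarrow> dyadic (a x)"
  and a_close: "x \<in> topspace X1 \<Longrightarrow> 4 * \<bar>a x - H x 0\<bar> < H x 1 - H x 0"
    "x \<in> topspace X1 \<Longrightarrow> 4 * \<bar>a x - H x 0\<bar> < H x 0 - H x (-1)"
  using dlift by (auto simp: dyadic_lift_def)

text \<open>\<open>H x n - H (\<phi>\<^sup>n x) 0\<close> is an integer, because \<open>(x,n)\<close> and \<open>(\<phi>\<^sup>n x,0)\<close> represent the same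
  point, so \<open>brk x n\<close> is dyadic and locally constant in \<open>x\<close>.\<close>

definition brk :: "'a \<Rightarrow> int \<Rightarrow> real" where
  "brk x n = H x (of_int n) + (a (A.it n x) - H (A.it n x) 0)"

lemma lift_shift:
  assumes x: "x \<in> topspace X1"
  obtains m :: int where "\<psi> (A.it n x) = B.it m (\<psi> x)" "\<And>t. H (A.it n x) (t - of_int n) = H x t - of_int m"
  using flow_lift_equivariant[OF lift x] by blast

lemma brk_dyadic: "x \<in> topspace X1 \<Longrightarrow> dyadic (brk x n)"
proof -
  assume x: "x \<in> topspace X1"
  obtain m where "\<And>t. H (A.it n x) (t - of_int n) = H x t - of_int m" using lift_shift[OF x, of n] by blast
  from this[of "of_int n"] have "brk x n = of_int m + a (A.it n x)" by (simp add: brk_def)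
  then show ?thesis using a_dyadic[OF A.it_in[OF x]] by (simp add: dyadic_add)
qed

lemma brk_near:
  assumes x: "x \<in> topspace X1"
  shows "4 * (brk x n - H x (of_int n)) < H x (of_int n + 1) - H x (of_int n)"
    and "4 * (H x (of_int n) - brk x n) < H x (of_int n) - H x (of_int n - 1)"
proof -
  obtain m where m: "\<And>t. H (A.it n x) (t - of_int n) = H x t - of_int m" using lift_shift[OF x, of n] by blast
  have e: "H (A.it n x) 0 = H x (of_int n) - of_int m" "H (A.it n x) 1 = H x (of_int n + 1) - of_int m"
    "H (A.it n x) (-1) = H x (of_int n - 1) - of_int m"
    using m[of "of_int n"] m[of "of_int n + 1"] m[of "of_int n - 1"] by simp_all
  have 1: "4 * (a (A.it n x) - H (A.it n x) 0) < H (A.it n x) 1 - H (A.it n x) 0"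
  proof -
    have "4 * (a (A.it n x) - H (A.it n x) 0) \<le> 4 * \<bar>a (A.it n x) - H (A.it n x) 0\<bar>"
      by (intro mult_left_mono abs_ge_self) simp
    also have "\<dots> < H (A.it n x) 1 - H (A.it n x) 0" by (rule a_close(1)[OF A.it_in[OF x]])
    finally show ?thesis .
  qed
  have 2: "4 * (H (A.it n x) 0 - a (A.it n x)) < H (A.it n x) 0 - H (A.it n x) (-1)"
  proof -
    have "4 * (H (A.it n x) 0 - a (A.it n x)) \<le> 4 * \<bar>a (A.it n x) - H (A.it n x) 0\<bar>"
      using abs_ge_minus_self[of "a (A.it n x) - H (A.it n x) 0"] by simp
    also have "\<dots> < H (A.it n x) 0 - H (A.it n x) (-1)" by (rule a_close(2)[OF A.it_in[OF x]])
    finally show ?thesis .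
  qed
  show "4 * (brk x n - H x (of_int n)) < H x (of_int n + 1) - H x (of_int n)"
    using 1 e unfolding brk_def right_diff_distrib distrib_left by linarith
  show "4 * (H x (of_int n) - brk x n) < H x (of_int n) - H x (of_int n - 1)"
    using 2 e unfolding brk_def right_diff_distrib distrib_left by linarith
qed

lemma H_less: "x \<in> topspace X1 \<Longrightarrow> H x (of_int n - 1) < H x (of_int n)"
  by (rule strict_monoD[OF inc]) auto

lemma brk_less_H: assumes x: "x \<in> topspace X1" shows "brk x n < H x (of_int n + 1)"
  using brk_near(1)[OF x, of n] H_less[OF x, of "n + 1"] by simp

lemma H_less_brk: assumes x: "x \<in> topspace X1" shows "H x (of_int n - 1) < brk x n"
  using brk_near(2)[OF x, of n] H_less[OF x, of n] unfolding right_diff_distrib by linarith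

lemma brk_less: assumes x: "x \<in> topspace X1" shows "brk x n < brk x (n + 1)"
proof -
  have "4 * (H x (of_int n + 1) - brk x (n + 1)) < H x (of_int n + 1) - H x (of_int n)"
    using brk_near(2)[OF x, of "n + 1"] by simp
  moreover have "H x (of_int n) < H x (of_int n + 1)" by (rule strict_monoD[OF inc[OF x]]) simp
  ultimately show ?thesis using brk_near(1)[OF x, of n] unfolding right_diff_distrib by linarith
qed

lemma brk_mono: assumes x: "x \<in> topspace X1" and "m \<le> n" shows "brk x m \<le> brk x n"
  using assms(2)
proof (induction n rule: int_ge_induct)
  case (step i) then show ?case using brk_less[OF x, of i] by linarith
qed simp

text \<open>\<open>H x\<close> is onto, and \<open>brk x n\<close> lies between the values of
  \<open>H x\<close> at \<open>n - 1\<close> and \<open>n + 1\<close>, so every \<open>s\<close> is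
  enclosed by breakpoints.\<close>

lemma brk_unbounded:
  assumes x: "x \<in> topspace X1" obtains n where "brk x n \<le> s" "s < brk x (n + 1)"
proof -
  have sur: "surj (H x)" using flow_lift_bij[OF lift x] by (rule bij_is_surj)
  then obtain t where t: "H x t = s" by (metis surjD)
  have lo: "brk x (\<lfloor>t\<rfloor> - 1) < s"
  proof -
    have "brk x (\<lfloor>t\<rfloor> - 1) < H x (of_int \<lfloor>t\<rfloor>)"
      using brk_less_H[OF x, of "\<lfloor>t\<rfloor> - 1"] by simp
    also have "\<dots> \<le> H x t" using strict_mono_less_eq[OF inc[OF x]] by simp
    finally show ?thesis using t by simp
  qed
  have hi: "s < brk x (\<lfloor>t\<rfloor> + 2)"
  proof -
    have "H x t < H x (of_int \<lfloor>t\<rfloor> + 1)" by (rule strict_monoD[OF inc[OF x]]) linarith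
    also have "\<dots> < brk x (\<lfloor>t\<rfloor> + 2)"
      using H_less_brk[OF x, of "\<lfloor>t\<rfloor> + 2"] by (simp add: add.commute)
    finally show ?thesis using t by simp
  qed
  have "\<exists>n\<in>{\<lfloor>t\<rfloor> - 1, \<lfloor>t\<rfloor>, \<lfloor>t\<rfloor> + 1}. brk x n \<le> s \<and> s < brk x (n + 1)"
    using lo hi by (cases "s < brk x \<lfloor>t\<rfloor>"; cases "s < brk x (\<lfloor>t\<rfloor> + 1)") (auto simp: not_less less_imp_le add.commute)
  then show ?thesis using that by blast
qed

text \<open>\<open>brk\<close> is shifted by the same integer as \<open>H\<close>, since the
  correction added to \<open>H\<close> at time \<open>n\<close> depends on \<open>it n x\<close>
  alone.\<close>

lemma brk_shift:
  assumes x: "x \<in> topspace X1"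
  obtains m :: int where "\<psi> (A.it k x) = B.it m (\<psi> x)" "\<And>t. H (A.it k x) (t - of_int k) = H x t - of_int m"
    "\<And>n. brk (A.it k x) (n - k) = brk x n - of_int m"
proof -
  obtain m where m: "\<psi> (A.it k x) = B.it m (\<psi> x)" "\<And>t. H (A.it k x) (t - of_int k) = H x t - of_int m"
    using lift_shift[OF x] by blast
  have "brk (A.it k x) (n - k) = brk x n - of_int m" for n
  proof -
    have "A.it (n - k) (A.it k x) = A.it n x" using A.it_add[OF x, of "n - k" k] by simp
    then show ?thesis using m(2)[of "of_int n"] by (simp add: brk_def)
  qed
  then show ?thesis using that m by blast
qed

lemma brk_loc_const: "loc_const X1 (\<lambda>x. brk x n)"
proof -
  have "loc_const X1 (\<lambda>x. H x (of_int n) - H (A.it n x) 0)"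
  proof (rule continuous_int_valued_loc_const)
    have "continuous_map X1 euclideanreal (\<lambda>x. H (A.it n x) 0)"
      using continuous_map_compose[OF A.it_cont[of n] flow_lift_at_cont[OF lift, of 0]] by (simp add: o_def)
    then show "continuous_map X1 euclideanreal (\<lambda>x. H x (of_int n) - H (A.it n x) 0)"
      by (intro continuous_map_diff flow_lift_at_cont[OF lift])
    fix x assume x: "x \<in> topspace X1"
    obtain m where "\<And>t. H (A.it n x) (t - of_int n) = H x t - of_int m" using lift_shift[OF x, of n] by blast
    from this[of "of_int n"] show "H x (of_int n) - H (A.it n x) 0 \<in> \<int>" by simp
  qed
  then have 1: "\<And>x. x \<in> topspace X1 \<Longrightarrow> \<exists>C. openin X1 C \<and> x \<in> C \<and>
      (\<forall>x'\<in>C. H x' (of_int n) - H (A.it n x') 0 = H x (of_int n) - H (A.it n x) 0)"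
    by (simp add: loc_const_def)
  show ?thesis
    unfolding loc_const_def
  proof
    fix x assume x: "x \<in> topspace X1"
    obtain C where C: "openin X1 C" "x \<in> C" "\<forall>x'\<in>C. H x' (of_int n) - H (A.it n x') 0 = H x (of_int n) - H (A.it n x) 0"
      using 1[OF x] by blast
    obtain D where D: "openin X1 D" "A.it n x \<in> D" "\<forall>x'\<in>D. a x' = a (A.it n x)"
      using a_loc A.it_in[OF x, of n] unfolding loc_const_def by blast
    let ?E = "C \<inter> {x \<in> topspace X1. A.it n x \<in> D}"
    have "openin X1 ?E" using C(1) openin_continuous_map_preimage[OF A.it_cont D(1)] by blast
    moreover have "x \<in> ?E" using x C D by blast
    moreover have "brk x' n = brk x n" if x': "x' \<in> ?E" for x'
    proof -
      have "H x' (of_int n) - H (A.it n x') 0 = H x (of_int n) - H (A.it n x) 0" "a (A.it n x') = a (A.it n x)"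
        using x' C(3) D(3) by blast+
      then show ?thesis unfolding brk_def by linarith
    qed
    ultimately show "\<exists>C. openin X1 C \<and> x \<in> C \<and> (\<forall>x'\<in>C. brk x' n = brk x n)" by blast
  qed
qed

lemma brk_loc_const_upto:
  assumes x: "x \<in> topspace X1"
  shows "\<exists>C. openin X1 C \<and> x \<in> C \<and> (\<forall>x'\<in>C. \<forall>n\<in>{-int N..int N}. brk x' n = brk x n)"
proof -
  have "\<exists>C. openin X1 C \<and> x \<in> C \<and> (\<forall>x'\<in>C. \<forall>n\<in>K. brk x' n = brk x n)" if "finite K" for K
    using that
  proof (induction K rule: finite_induct)
    case empty show ?case using x by blast
  next
    case (insert n K)
    then obtain C where C: "openin X1 C" "x \<in> C" "\<forall>x'\<in>C. \<forall>n\<in>K. brk x' n = brk x n" by blast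
    obtain D where D: "openin X1 D" "x \<in> D" "\<forall>x'\<in>D. brk x' n = brk x n"
      using bspec[OF brk_loc_const[of n, unfolded loc_const_def] x] by blast
    have "openin X1 (C \<inter> D)" "x \<in> C \<inter> D" using C D by blast+
    moreover have "\<forall>x'\<in>C \<inter> D. \<forall>i\<in>insert n K. brk x' i = brk x i" using C(3) D(3) by blast
    ultimately show ?case by blast
  qed
  then show ?thesis by blast
qed

text \<open>One interpolant is fixed for each length. Thus the interpolated lift is determined by
  its breakpoints and inherits their equivariance and local constancy.\<close>

definition interp :: "real \<Rightarrow> real \<Rightarrow> real" where "interp L = (SOME f. dyadic_interp L f)"

lemma interp: "dyadic L \<Longrightarrow> L > 0 \<Longrightarrow> dyadic_interp L (interp L)"
  unfolding interp_def by (rule someI_ex[OF dyadic_interp_exists])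

definition PLlift :: "'a \<Rightarrow> real \<Rightarrow> real" where
  "PLlift x t = brk x \<lfloor>t\<rfloor> + interp (brk x (\<lfloor>t\<rfloor> + 1) - brk x \<lfloor>t\<rfloor>) (t - of_int \<lfloor>t\<rfloor>)"

lemma interp_brk:
  assumes x: "x \<in> topspace X1"
  shows "strict_mono (interp (brk x (n + 1) - brk x n))" "dgerm (interp (brk x (n + 1) - brk x n)) t"
    "interp (brk x (n + 1) - brk x n) 0 = 0" "interp (brk x (n + 1) - brk x n) 1 = brk x (n + 1) - brk x n"
  using interp[of "brk x (n + 1) - brk x n"] brk_dyadic[OF x] brk_less[OF x, of n] dyadic_diff
  by (auto simp: dyadic_interp_def)

lemma PLlift_on:
  assumes x: "x \<in> topspace X1" and t: "of_int n \<le> t" "t \<le> of_int n + 1"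
  shows "PLlift x t = brk x n + interp (brk x (n + 1) - brk x n) (t - of_int n)"
proof (cases "t = of_int n + 1")
  \<comment> \<open>At the right endpoint the floor has already jumped to \<open>n + 1\<close>; the
    two formulas agree because the interpolants match there.\<close>
  case True
  then have "\<lfloor>t\<rfloor> = n + 1" by linarith
  then show ?thesis using True interp_brk(3)[OF x, of "n + 1"] interp_brk(4)[OF x, of n] by (simp add: PLlift_def)
next
  case False
  then have "\<lfloor>t\<rfloor> = n" using t by linarith
  then show ?thesis by (simp add: PLlift_def)
qed

lemma PLlift_int: "x \<in> topspace X1 \<Longrightarrow> PLlift x (of_int n) = brk x n"
  using PLlift_on[of x n "of_int n"] interp_brk(3) by simp

lemma PLlift_strict_mono: assumes x: "x \<in> topspace X1" shows "strict_mono (PLlift x)"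
proof (rule strict_monoI)
  have on: "PLlift x s < PLlift x t" if "of_int n \<le> s" "s < t" "t \<le> of_int n + 1" for s t n
    using PLlift_on[OF x, of n s] PLlift_on[OF x, of n t] that
      strict_monoD[OF interp_brk(1)[OF x, of n], of "s - of_int n" "t - of_int n"] by simp
  fix s t :: real assume st: "s < t"
  show "PLlift x s < PLlift x t"
  proof (cases "\<lfloor>s\<rfloor> = \<lfloor>t\<rfloor>")
    case True
    then show ?thesis using on[of "\<lfloor>s\<rfloor>" s t] st by linarith
  next
    case False
    then have "\<lfloor>s\<rfloor> + 1 \<le> \<lfloor>t\<rfloor>" using floor_mono[of s t] st by linarith
    have "PLlift x s < PLlift x (of_int (\<lfloor>s\<rfloor> + 1))" by (rule on[of "\<lfloor>s\<rfloor>"]) linarith+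
    also have "\<dots> = brk x (\<lfloor>s\<rfloor> + 1)" by (rule PLlift_int[OF x])
    also have "\<dots> \<le> brk x \<lfloor>t\<rfloor>" by (rule brk_mono[OF x \<open>\<lfloor>s\<rfloor> + 1 \<le> \<lfloor>t\<rfloor>\<close>])
    also have "\<dots> = PLlift x (of_int \<lfloor>t\<rfloor>)" by (rule PLlift_int[OF x, symmetric])
    also have "\<dots> \<le> PLlift x t"
    proof (cases "of_int \<lfloor>t\<rfloor> < t")
      case True
      then show ?thesis using on[of "\<lfloor>t\<rfloor>" "of_int \<lfloor>t\<rfloor>" t] by simp
    next
      case False
      then have "of_int \<lfloor>t\<rfloor> = t" by linarith
      then show ?thesis by (simp only: order_refl)
    qed
    finally show ?thesis .
  qed
qed

text \<open>At an integer two translated interpolants, both with dyadic germs beyond their own unit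
  intervals, meet at a dyadic time and are glued.\<close>

lemma PLlift_dgerm: assumes x: "x \<in> topspace X1" shows "dgerm (PLlift x) t0"
proof -
  let ?p = "\<lambda>n t. interp (brk x (n + 1) - brk x n) (t + - of_int n) + brk x n"
  have p: "dgerm (?p n) t" for n t
  proof -
    have "dgerm (\<lambda>t. t + - of_int n) t" by (rule dgerm_shift) (auto intro: dyadic_minus)
    from dgerm_comp[OF dgerm_comp[OF this interp_brk(2)[OF x, of n]] dgerm_shift[OF brk_dyadic[OF x, of n]]]
    show ?thesis .
  qed
  have on: "PLlift x t = ?p n t" if "of_int n \<le> t" "t \<le> of_int n + 1" for n t
    using PLlift_on[OF x that] by (simp add: add.commute)
  show ?thesis
  proof (cases "of_int \<lfloor>t0\<rfloor> = t0")
    case False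
    then have "of_int \<lfloor>t0\<rfloor> < t0" "t0 < of_int \<lfloor>t0\<rfloor> + 1" by linarith+
    then have "\<forall>\<^sub>F t in nhds t0. t \<in> {of_int \<lfloor>t0\<rfloor><..<of_int \<lfloor>t0\<rfloor> + 1}" by (intro eventually_nhds_in_open) auto
    then have "\<forall>\<^sub>F t in nhds t0. ?p \<lfloor>t0\<rfloor> t = PLlift x t"
      by eventually_elim (use on[of "\<lfloor>t0\<rfloor>"] in auto)
    then show ?thesis by (rule dgerm_cong_imp[OF p])
  next
    case True
    define n where "n = \<lfloor>t0\<rfloor>"
    have t0: "t0 = of_int n" unfolding n_def by (rule True[symmetric])
    have ev: "\<forall>\<^sub>F t in nhds t0. t \<in> {t0 - 1<..<t0 + 1}" by (intro eventually_nhds_in_open) auto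
    show ?thesis
    proof (rule dgerm_glue[OF p[of "n - 1"] p[of n]])
      show "?p (n - 1) t0 = ?p n t0" using on[of "n - 1" t0] on[of n t0] t0 by simp
      show "dyadic t0" using t0 by simp
      show "\<forall>\<^sub>F t in nhds t0. PLlift x t = (if t \<le> t0 then ?p (n - 1) t else ?p n t)"
        using ev
      proof eventually_elim
        case (elim t)
        then show ?case using on[of "n - 1" t] on[of n t] t0 by (cases "t \<le> t0") auto
      qed
    qed
  qed
qed

lemma PLlift_cont: "x \<in> topspace X1 \<Longrightarrow> continuous_on UNIV (PLlift x)"
  by (intro continuous_at_imp_continuous_on ballI dgerm_isCont PLlift_dgerm)

lemma PLlift_surj: assumes x: "x \<in> topspace X1" shows "\<exists>t. PLlift x t = s"
proof -
  obtain n where n: "brk x n \<le> s" "s < brk x (n + 1)" using brk_unbounded[OF x] by metis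
  have "\<exists>t\<ge>of_int n. t \<le> of_int (n + 1) \<and> PLlift x t = s"
  proof (rule IVT')
    show "PLlift x (of_int n) \<le> s" "s \<le> PLlift x (of_int (n + 1))"
      using n unfolding PLlift_int[OF x] by simp_all
    show "continuous_on {of_int n..of_int (n + 1)} (PLlift x)"
      using continuous_on_subset[OF PLlift_cont[OF x]] by blast
  qed simp
  then show ?thesis by blast
qed

text \<open>The same \<open>m\<close> serves \<open>H\<close> and \<open>PLlift\<close>; this lets
  injectivity of \<open>q\<close> pass to the map built from \<open>PLlift\<close>.\<close>

lemma PLlift_shift:
  assumes x: "x \<in> topspace X1"
  obtains m :: int where "\<psi> (A.it k x) = B.it m (\<psi> x)" "\<And>t. H (A.it k x) (t - of_int k) = H x t - of_int m"
    "\<And>t. PLlift (A.it k x) (t - of_int k) = PLlift x t - of_int m"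
proof -
  obtain m where m: "\<psi> (A.it k x) = B.it m (\<psi> x)" "\<And>t. H (A.it k x) (t - of_int k) = H x t - of_int m"
    "\<And>n. brk (A.it k x) (n - k) = brk x n - of_int m" using brk_shift[OF x] by blast
  have "PLlift (A.it k x) (t - of_int k) = PLlift x t - of_int m" for t
  proof -
    have f: "\<lfloor>t - of_int k\<rfloor> = \<lfloor>t\<rfloor> - k" by linarith
    have "brk (A.it k x) (\<lfloor>t\<rfloor> - k + 1) = brk x (\<lfloor>t\<rfloor> + 1) - of_int m" using m(3)[of "\<lfloor>t\<rfloor> + 1"] by (simp add: algebra_simps)
    then show ?thesis using m(3)[of "\<lfloor>t\<rfloor>"] unfolding PLlift_def f by simp
  qed
  then show ?thesis using that m by blast
qed

lemma PLlift_loc: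
  assumes x0: "x0 \<in> topspace X1"
  shows "\<exists>C. openin X1 C \<and> x0 \<in> C \<and> (\<forall>x\<in>C. \<forall>t. \<bar>t\<bar> < N \<longrightarrow> PLlift x t = PLlift x0 t)"
proof -
  \<comment> \<open>The summand 2 leaves room for both breakpoints around \<open>t\<close>, with
    indices \<open>\<lfloor>t\<rfloor>\<close> and \<open>\<lfloor>t\<rfloor> + 1\<close>.\<close>
  define M where "M = nat \<lceil>\<bar>N\<bar>\<rceil> + 2"
  obtain C where C: "openin X1 C" "x0 \<in> C" "\<forall>x\<in>C. \<forall>n\<in>{-int M..int M}. brk x n = brk x0 n"
    using brk_loc_const_upto[OF x0] by blast
  have "PLlift x t = PLlift x0 t" if x: "x \<in> C" and t: "\<bar>t\<bar> < N" for x t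
  proof -
    have "\<bar>N\<bar> \<le> real (nat \<lceil>\<bar>N\<bar>\<rceil>)" by (rule real_nat_ceiling_ge)
    moreover have "real_of_int (int M) = real (nat \<lceil>\<bar>N\<bar>\<rceil>) + 2"
      by (simp only: M_def of_int_of_nat_eq of_nat_add of_nat_numeral)
    ultimately have M: "of_int (int M) \<ge> \<bar>N\<bar> + 2" by linarith
    have "of_int (- int M) \<le> t - 1" "t + 1 \<le> of_int (int M)" using M t by (auto simp: abs_if split: if_splits)
    then have "\<lfloor>t\<rfloor> \<in> {-int M..int M}" "\<lfloor>t\<rfloor> + 1 \<in> {-int M..int M}" by (simp_all; linarith)+
    then show ?thesis using C(3) x unfolding PLlift_def by simp
  qed
  then show ?thesis using C by blast
qed

text \<open>The new map sends every flow line onto the same flow line as \<open>q\<close> does,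
  which gives surjectivity. If two points have the same image, \<open>q\<close> identifies suitable
  points on their lines, so \<open>x' = it k x\<close>; the integer shared by \<open>H\<close> and
  \<open>PLlift\<close> and strict monotonicity then determine the time.\<close>

lemma PLlift_homeo:
  obtains q' where "homeomorphic_map A.Y B.Y q'" "\<And>x t. x \<in> topspace X1 \<Longrightarrow> q' (A.cls (x, t)) = B.cls (\<psi> x, PLlift x t)"
proof -
  have \<psi>: "continuous_map X1 X2 \<psi>" "\<And>x. x \<in> topspace X1 \<Longrightarrow> \<psi> x \<in> topspace X2"
    using lift flow_lift_in by (auto simp: flow_lift_def)
  have qv: "q (A.cls (x, t)) = B.cls (\<psi> x, H x t)" if "x \<in> topspace X1" for x t
    using lift that by (simp add: flow_lift_def)
  have Fc: "continuous_map A.XR euclideanreal (\<lambda>p. PLlift (fst p) (snd p))"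
  proof (rule continuous_map_locI_eq)
    fix p assume "p \<in> topspace A.XR"
    then obtain x0 t0 where p: "p = (x0, t0)" "x0 \<in> topspace X1" by auto
    obtain C where C: "openin X1 C" "x0 \<in> C" "\<forall>x\<in>C. \<forall>t. \<bar>t\<bar> < \<bar>t0\<bar> + 1 \<longrightarrow> PLlift x t = PLlift x0 t"
      using PLlift_loc[OF p(2)] by blast
    let ?U = "C \<times> {-(\<bar>t0\<bar> + 1)<..<\<bar>t0\<bar> + 1}"
    have "openin A.XR ?U" using C(1) by (simp add: openin_prod_Times_iff)
    moreover have "p \<in> ?U" using p C by auto
    moreover have "continuous_map A.XR euclideanreal (\<lambda>p. PLlift x0 (snd p))"
    proof -
      have "continuous_map euclideanreal euclideanreal (PLlift x0)" using PLlift_cont[OF p(2)] by simp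
      from continuous_map_compose[OF continuous_map_snd this] show ?thesis by (simp add: o_def)
    qed
    moreover have "\<forall>z\<in>?U. PLlift (fst z) (snd z) = PLlift x0 (snd z)" using C(3) by (auto simp: abs_less_iff)
    ultimately show "\<exists>U g. openin A.XR U \<and> p \<in> U \<and> continuous_map A.XR euclideanreal g \<and>
        (\<forall>z\<in>U. PLlift (fst z) (snd z) = g z)" by blast
  qed
  let ?h = "\<lambda>p. B.cls (\<psi> (fst p), PLlift (fst p) (snd p))"
  have "continuous_map A.XR X2 (\<lambda>p. \<psi> (fst p))" using continuous_map_compose[OF continuous_map_fst \<psi>(1)] by (simp add: o_def)
  then have "continuous_map A.XR B.XR (\<lambda>p. (\<psi> (fst p), PLlift (fst p) (snd p)))"
    using Fc by (simp add: continuous_map_pairwise o_def)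
  from continuous_map_compose[OF this B.cls_cont] have hc: "continuous_map A.XR B.Y ?h" by (simp add: o_def)
  have step: "B.cls (\<psi> (A.it k x), PLlift (A.it k x) (t - of_int k)) = B.cls (\<psi> x, PLlift x t)"
    if x: "x \<in> topspace X1" for x t k
  proof -
    obtain m where m: "\<psi> (A.it k x) = B.it m (\<psi> x)" "\<And>t. PLlift (A.it k x) (t - of_int k) = PLlift x t - of_int m"
      using PLlift_shift[OF x] by blast
    show ?thesis unfolding m by (rule B.cls_it[OF \<psi>(2)[OF x]])
  qed
  obtain q' where q': "continuous_map A.Y B.Y q'"
    and q'v: "\<And>x t. x \<in> topspace X1 \<Longrightarrow> q' (A.cls (x, t)) = ?h (x, t)"
    by (rule A.descend[OF hc]) (use step in auto)
  have q'v: "q' (A.cls (x, t)) = B.cls (\<psi> x, PLlift x t)" if "x \<in> topspace X1" for x t using q'v[OF that] by simp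
  have "homeomorphic_map A.Y B.Y q'"
  proof (rule continuous_imp_homeomorphic_map[OF q' A.Y_compact B.Y_haus])
    show "q' ` topspace A.Y = topspace B.Y"
    proof
      show "q' ` topspace A.Y \<subseteq> topspace B.Y" using q' by (auto simp: continuous_map_def)
      show "topspace B.Y \<subseteq> q' ` topspace A.Y"
      proof
        fix z assume "z \<in> topspace B.Y"
        then obtain y where "y \<in> topspace A.Y" "z = q y" using homeomorphic_imp_surjective_map[OF q_homeo] by blast
        then obtain x t where xt: "x \<in> topspace X1" "z = q (A.cls (x, t))" using A.Y_cases by metis
        obtain t' where "PLlift x t' = H x t" using PLlift_surj[OF xt(1)] by blast
        then have "z = q' (A.cls (x, t'))" using xt qv q'v by simp
        then show "z \<in> q' ` topspace A.Y" using xt(1) by auto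
      qed
    qed
    show "inj_on q' (topspace A.Y)"
    proof (rule inj_onI)
      fix y z assume yz: "y \<in> topspace A.Y" "z \<in> topspace A.Y" "q' y = q' z"
      obtain x t where xt: "x \<in> topspace X1" "y = A.cls (x, t)" using yz A.Y_cases by blast
      obtain x' t' where xt': "x' \<in> topspace X1" "z = A.cls (x', t')" using yz A.Y_cases by blast
      have "B.cls (\<psi> x, PLlift x t) = B.cls (\<psi> x', PLlift x' t')" using yz(3) q'v xt xt' by simp
      then obtain n where n: "\<psi> x' = B.it n (\<psi> x)" "PLlift x' t' = PLlift x t - of_int n"
        using B.cls_eq_iff[OF \<psi>(2)[OF xt(1)] \<psi>(2)[OF xt'(1)]] by blast
      obtain s where s: "H x' s = H x 0 - of_int n"
        using flow_lift_bij[OF lift xt'(1)] by (metis bij_is_surj surjD)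
      have "q (A.cls (x', s)) = q (A.cls (x, 0))"
        using qv[OF xt'(1), of s] qv[OF xt(1), of 0] s n(1) B.cls_it[OF \<psi>(2)[OF xt(1)], of n "H x 0"] by simp
      then have "A.cls (x', s) = A.cls (x, 0)"
        using homeomorphic_imp_injective_map[OF q_homeo] A.cls_in xt(1) xt'(1) by (meson inj_onD)
      then obtain k where k: "x' = A.it k x" "s = 0 - of_int k"
        using A.cls_eq_iff[OF xt(1) xt'(1), of 0 s] by auto
      obtain m where "\<psi> (A.it k x) = B.it m (\<psi> x)"
        and m: "\<And>t. H (A.it k x) (t - of_int k) = H x t - of_int m"
          "\<And>t. PLlift (A.it k x) (t - of_int k) = PLlift x t - of_int m"
        by (rule PLlift_shift[OF xt(1), of k]) blast
      have "m = n" using m(1)[of 0] s k by simp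
      then have "PLlift x' (t - of_int k) = PLlift x' t'" using m(2)[of t] n(2) k(1) by simp
      then have "t' = t - of_int k"
        using strict_mono_eq[OF PLlift_strict_mono[OF xt'(1)]] by metis
      then show "y = z" using A.cls_it[OF xt(1), of k t] k(1) xt xt' by simp
    qed
  qed
  then show ?thesis using that q'v by blast
qed

lemma T_group_iso: "T_group X1 \<phi>1 \<cong> T_group X2 \<phi>2"
proof -
  obtain q' where q': "homeomorphic_map A.Y B.Y q'"
    "\<And>x t. x \<in> topspace X1 \<Longrightarrow> q' (A.cls (x, t)) = B.cls (\<psi> x, PLlift x t)" using PLlift_homeo by blast
  define G where "G x = inv_into UNIV (PLlift x)" for x
  have FG: "PLlift x (G x s) = s" if "x \<in> topspace X1" for x s
    unfolding G_def by (rule f_inv_into_f) (use PLlift_surj[OF that, of s] in auto)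
  have GF: "G x (PLlift x t) = t" if "x \<in> topspace X1" for x t
    unfolding G_def by (rule inv_into_f_f) (use strict_mono_imp_inj_on[OF PLlift_strict_mono[OF that]] in auto)
  have Gd: "dgerm (G x) s" if x: "x \<in> topspace X1" for x s
    using dgerm_left_inverse[OF PLlift_dgerm[OF x, of "G x s"], of "G x"] GF[OF x] FG[OF x] by simp
  have "dyadic_conj X1 \<phi>1 X2 \<phi>2 q' \<psi> PLlift G"
  proof (unfold_locales, goal_cases)
    case 1 show ?case using q'(1) homeomorphic_imp_continuous_map by blast
  next
    case 2 show ?case by (rule q'(1))
  next
    case 3 show ?case using lift by (simp add: flow_lift_def)
  next
    case (4 x t) then show ?case by (rule q'(2))
  next
    case (5 x s) then show ?case by (rule FG)
  next
    case (6 x t) then show ?case by (rule GF)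
  next
    case (7 x t) then show ?case using PLlift_dgerm dgerm_isCont by blast
  next
    case (8 x t) then show ?case using Gd dgerm_isCont by blast
  next
    case (9 x0 N) then show ?case by (rule PLlift_loc)
  next
    case (10 x f t)
    have "dgerm (\<lambda>s. f (G x s)) (PLlift x t)"
      by (rule dgerm_comp[OF Gd[OF 10(1)]]) (use GF[OF 10(1)] 10(2) in simp)
    then show ?case by (rule dgerm_comp[OF _ PLlift_dgerm[OF 10(1)]])
  next
    case (11 x f t)
    show ?case by (rule dgerm_comp[OF dgerm_comp[OF PLlift_dgerm[OF 11(1)] 11(2)] Gd[OF 11(1)]])
  qed
  then show ?thesis by (rule dyadic_conj.T_group_iso)
qed

end

lemma T_group_iso_increasing:
  assumes sh: "stone_homeo X1 \<phi>1 X2 \<phi>2 q" and l: "stone_map.flow_lift X1 \<phi>1 X2 \<phi>2 q \<psi> H"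
    and inc: "\<And>x. x \<in> topspace X1 \<Longrightarrow> strict_mono (H x)"
  shows "T_group X1 \<phi>1 \<cong> T_group X2 \<phi>2"
proof -
  interpret stone_homeo X1 \<phi>1 X2 \<phi>2 q by (rule sh)
  obtain a where a: "dyadic_lift \<psi> H a" using dyadic_lift_exists[OF l inc] by blast
  interpret dyadic_lift_homeo X1 \<phi>1 X2 \<phi>2 q \<psi> H a by unfold_locales (rule a)
  show ?thesis by (rule T_group_iso)
qed

theorem theorem8:
  fixes X1 :: "'a topology" and \<phi>1 :: "'a \<Rightarrow> 'a"
    and X2 :: "'b topology" and \<phi>2 :: "'b \<Rightarrow> 'b"
  assumes "Stone_system X1 \<phi>1" and "has_dense_orbit X1 \<phi>1"
    and "Stone_system X2 \<phi>2" and "has_dense_orbit X2 \<phi>2"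
  shows "T_group X1 \<phi>1 \<cong> T_group X2 \<phi>2 \<longleftrightarrow>
    flow_equivalent X1 \<phi>1 X2 \<phi>2 \<or> flow_equivalent X1 \<phi>1 X2 (inv_map X2 \<phi>2)"
proof -
  interpret A: stone X1 \<phi>1 by unfold_locales (rule assms)
  interpret B: stone X2 \<phi>2 by unfold_locales (rule assms)
  interpret I: stone X2 "inv_map X2 \<phi>2" by (rule B.stone_inv)
  show ?thesis
  proof
    assume "T_group X1 \<phi>1 \<cong> T_group X2 \<phi>2"
    then have "A.Y homeomorphic_space B.Y"
      using T_iso_homeomorphic[OF A.stone_axioms B.stone_axioms assms(2,4)] by blast
    then obtain \<phi> q \<psi> H where *: "\<phi> = \<phi>2 \<or> \<phi> = inv_map X2 \<phi>2" "stone_homeo X1 \<phi>1 X2 \<phi> q"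
      "stone_map.flow_lift X1 \<phi>1 X2 \<phi> q \<psi> H" "\<And>x. x \<in> topspace X1 \<Longrightarrow> strict_mono (H x)"
      using homeomorphic_increasing_lift[OF A.stone_axioms B.stone_axioms assms(2)] by metis
    then have "flow_equivalent X1 \<phi>1 X2 \<phi>" using stone_homeo.flow_lift_flow_equivalent by blast
    then show "flow_equivalent X1 \<phi>1 X2 \<phi>2 \<or> flow_equivalent X1 \<phi>1 X2 (inv_map X2 \<phi>2)" using *(1) by blast
  next
    assume "flow_equivalent X1 \<phi>1 X2 \<phi>2 \<or> flow_equivalent X1 \<phi>1 X2 (inv_map X2 \<phi>2)"
    then have "A.Y homeomorphic_space B.Y \<or> A.Y homeomorphic_space I.Y"
      unfolding flow_equivalent_def homeomorphic_space by blast
    \<comment> \<open>As spaces, the suspensions of \<open>\<phi>2\<close> and its inverse agree, so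
      both alternatives reduce to one homeomorphism; its orientation is discarded here and recovered
      from the lift.\<close>
    moreover have "B.Y homeomorphic_space I.Y" using B.flip homeomorphic_space by metis
    ultimately have "A.Y homeomorphic_space B.Y"
      using homeomorphic_space_trans homeomorphic_space_sym by blast
    then obtain \<phi> q \<psi> H where *: "\<phi> = \<phi>2 \<or> \<phi> = inv_map X2 \<phi>2" "stone_homeo X1 \<phi>1 X2 \<phi> q"
      "stone_map.flow_lift X1 \<phi>1 X2 \<phi> q \<psi> H" "\<And>x. x \<in> topspace X1 \<Longrightarrow> strict_mono (H x)"
      using homeomorphic_increasing_lift[OF A.stone_axioms B.stone_axioms assms(2)] by metis
    then have "T_group X1 \<phi>1 \<cong> T_group X2 \<phi>" using T_group_iso_increasing by blast
    moreover have "T_group X2 (inv_map X2 \<phi>2) \<cong> T_group X2 \<phi>2"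
      by (rule group.iso_sym[OF B.T_group T_group_flip[OF B.stone_axioms]])
    ultimately show "T_group X1 \<phi>1 \<cong> T_group X2 \<phi>2" using *(1) iso_trans by blast
  qed
qed

end
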